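(* There exists an absolute constant $C>0$ such that the following holds. Let $m\ge 2$ be an integer and let $G$ be an abelian group with torsion $m$. Let $K$ be a real number and suppose that $A\subseteq G$ is a finite non-empty set with $|A+A|\le K|A|$. Then there is a subgroup $H\le G$ with $|H|\le |A|$ such that $A$ is covered by at most $(2K)^{Cm^3}$ cosets of $H$, and moreover $H\subseteq \ell A-\ell A$ for some positive integer $\ell\le C(2+m\log K)^{C m^3\log m}$.
   Context: An abelian group $G=(G,+)$ has torsion $m$ if $mg=0$ for all $g\in G$ ($m$ is not required to be minimal with this property). Sumsets: $A\pm B=\{a\pm b: a\in A, b\in B\}$, and $\ell A=A+\cdots+A$ is the sum of $\ell$ copies of $A$. $\log$ is the natural logarithm. (The condition $|A+A|\le K|A|$ forces $K\ge 1$.) "Absolute constant" means independent of $m,G,A,K$. *)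

theory Defs
  imports Complex_Main "HOL-Algebra.Coset"
begin

text \<open>
  Abelian groups are HOL-Algebra's \<open>comm_group\<close>s, hence written multiplicatively:
  \<open>A <#>\<^bsub>G\<^esub> B\<close> is the sumset \<open>A + B\<close>, \<open>set_inv\<^bsub>G\<^esub> A\<close> is \<open>-A\<close>,
  and \<open>g [^]\<^bsub>G\<^esub> m\<close> is \<open>mg\<close>.
\<close>

definition has_torsion :: "('a, 'b) monoid_scheme \<Rightarrow> nat \<Rightarrow> bool" where
  "has_torsion G m \<longleftrightarrow> (\<forall>g\<in>carrier G. g [^]\<^bsub>G\<^esub> m = \<one>\<^bsub>G\<^esub>)"

definition set_diff_mult :: "('a, 'b) monoid_scheme \<Rightarrow> 'a set \<Rightarrow> 'a set \<Rightarrow> 'a set" where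
  "set_diff_mult G A B = A <#>\<^bsub>G\<^esub> set_inv\<^bsub>G\<^esub> B"

primrec iter_sumset :: "('a, 'b) monoid_scheme \<Rightarrow> nat \<Rightarrow> 'a set \<Rightarrow> 'a set" where
  "iter_sumset G 0 A = {\<one>\<^bsub>G\<^esub>}"
| "iter_sumset G (Suc l) A = iter_sumset G l A <#>\<^bsub>G\<^esub> A"

text \<open>
  Finiteness is required because \<open>card\<close> of an infinite set is 0.
\<close>

definition covered_by_cosets ::
    "('a, 'b) monoid_scheme \<Rightarrow> 'a set \<Rightarrow> 'a set \<Rightarrow> real \<Rightarrow> bool" where
  "covered_by_cosets G H A N \<longleftrightarrow>
     (\<exists>F. F \<subseteq> rcosets\<^bsub>G\<^esub> H \<and> finite F \<and> real (card F) \<le> N \<and> A \<subseteq> \<Union>F)"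

definition valid_constant :: "'a itself \<Rightarrow> real \<Rightarrow> bool" where
  "valid_constant (_ :: 'a itself) C \<longleftrightarrow>
     0 < C \<and>
     (\<forall>(m::nat) (G :: 'a monoid) A (K::real).
        2 \<le> m \<longrightarrow> comm_group G \<longrightarrow> has_torsion G m \<longrightarrow>
        A \<subseteq> carrier G \<longrightarrow> finite A \<longrightarrow> A \<noteq> {} \<longrightarrow>
        real (card (A <#>\<^bsub>G\<^esub> A)) \<le> K * real (card A) \<longrightarrow>
        (\<exists>H. subgroup H G \<and> finite H \<and> card H \<le> card A \<and>
             covered_by_cosets G H A ((2 * K) powr (C * real m ^ 3)) \<and>
             (\<exists>l::nat. 0 < l \<and>
                real l \<le> C * (2 + real m * ln K) powr (C * real m ^ 3 * ln (real m)) \<and>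
                H \<subseteq> set_diff_mult G (iter_sumset G l A) (iter_sumset G l A))))"

text \<open>
  A polymorphic theorem \<open>\<exists>C > 0. \<forall>G :: 'a monoid. \<dots>\<close> would let \<open>C\<close> depend on the type \<open>'a\<close>,
  and HOL has no quantifier over types to place under \<open>\<exists>C\<close>. To make the constant
  independent of the group, we name one real number, in whose definition no type variable occurs:
  some constant that is valid for the groups with carrier in \<^typ>\<open>nat\<close>. That it is positive and
  valid for groups over every type is then a claim about a single number.

  Nothing is lost by this choice. A finite \<open>A\<close> in a torsion abelian group generates a finite
  subgroup, which is isomorphic to a group with carrier in \<^typ>\<open>nat\<close>; hence a constant is valid
  for all types as soon as it is valid for \<^typ>\<open>nat\<close>.
\<close>

definition absolute_constant :: real where
  "absolute_constant = (SOME C. valid_constant TYPE(nat) C)"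

end

theory Submission
  imports Defs "HOL-Probability.Product_PMF"
begin

text \<open>
  The argument is that of Gowers, Green, Manners and Tao. To a tuple \<open>X\<^sub>1, \<dots>, X\<^sub>m\<close> of independent variables
  attach the multidistance \<open>k = H(X\<^sub>1 + \<dots> + X\<^sub>m) - (H(X\<^sub>1) + \<dots> + H(X\<^sub>m)) / m\<close>. Take an \<open>m \<times> m\<close> array of independent
  copies \<open>x\<^sub>a\<^sub>b\<close> of \<open>X\<^sub>a\<close>. If no tuple made from conditioned entries, from row sums, or from conditioned weighted
  sums has noticeably smaller multidistance, then row sums and column sums are nearly independent given the
  total. Reindexing the array gives the same for any two of \<open>\<Sum> a x\<^sub>a\<^sub>b\<close>, \<open>\<Sum> b x\<^sub>a\<^sub>b\<close> and \<open>\<Sum> (a + b) x\<^sub>a\<^sub>b\<close>. Because of the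
  torsion, the weights may be read modulo \<open>m\<close>, and the third sum is the sum of the first two; an entropic
  Balog-Szemeredi-Gowers argument then produces a variable of tiny doubling, a contradiction. Hence the
  multidistance can be decreased by a factor \<open>1 - c / m\<^sup>3\<close> at a cost in Ruzsa distance proportional to the gain, while
  the supports grow to at most \<open>m\<^sup>3\<close>-fold sumsets. After \<open>O(m\<^sup>3 log(2 + m log K))\<close> steps the doubling is below an absolute
  threshold; such a distribution is close in total variation to its translates by a subgroup, namely by the
  differences of its typical points. Ruzsa's covering lemma turns this into a covering of \<open>A\<close>.
\<close>

section \<open>Entropy of finitely supported distributions\<close>

text \<open>Conditioning turns equal laws into different ones, so the quantity to be decreased must
  be defined for tuples of unrelated laws; this is why a multidistance replaces the doubling of one
  variable. Row sums and column sums always share the total, so independence can only be hoped for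
  given the total. The distance term in the decrement is a budget: multidistance plus
  \<open>\<eta>\<close> times the distance to the uniform law on \<open>A\<close> never increases,
  so the last law still resembles \<open>A\<close>. The exponent 3 has one origin. With decrement
  rate \<open>\<eta>\<close> the array leaks information at most \<open>9 * m^2 * \<eta> * k\<close>
  for each of three pairs, the Balog-Szemeredi-Gowers step adds the three, and passing from one
  difference to an \<open>m\<close>-fold sum multiplies by \<open>m\<close>. The resulting
  \<open>27 * m^3 * \<eta> * k\<close> has to stay below \<open>k\<close>, whence
  \<open>\<eta> = 1 / (50 * m^3)\<close>. The number of steps is \<open>m^3\<close> times the
  logarithm of the ratio between initial and final multidistance, and each step multiplies the
  length of the sums by at most \<open>m^3\<close>; this gives the bound on \<open>l\<close>. The
  constant is \<open>5202 = 3 * 51 * 34\<close>, fixed by the count of steps; the covering bound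
  holds with room to spare.\<close>

abbreviation expect :: "'a pmf \<Rightarrow> ('a \<Rightarrow> real) \<Rightarrow> real" where
  "expect p \<equiv> integral\<^sup>L (measure_pmf p)"

abbreviation prob :: "'a pmf \<Rightarrow> 'a set \<Rightarrow> real" where
  "prob p \<equiv> measure (measure_pmf p)"

definition ent :: "'a pmf \<Rightarrow> real" where
  "ent \<mu> = (\<Sum>x\<in>set_pmf \<mu>. pmf \<mu> x * - ln (pmf \<mu> x))"

definition rv_ent :: "'w pmf \<Rightarrow> ('w \<Rightarrow> 'a) \<Rightarrow> real" where
  "rv_ent p X = ent (map_pmf X p)"

text \<open>Dependence is asked only on the support of \<open>p\<close>, so that relations valid
  almost surely, such as those produced by torsion or by a coupling, can be used.\<close>

definition det :: "'w pmf \<Rightarrow> ('w \<Rightarrow> 'a) \<Rightarrow> ('w \<Rightarrow> 'b) \<Rightarrow> bool" where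
  "det p X Y \<longleftrightarrow> (\<forall>v\<in>set_pmf p. \<forall>w\<in>set_pmf p. X v = X w \<longrightarrow> Y v = Y w)"

lemma detI: "(\<And>v w. v \<in> set_pmf p \<Longrightarrow> w \<in> set_pmf p \<Longrightarrow> X v = X w \<Longrightarrow> Y v = Y w) \<Longrightarrow> det p X Y"
  unfolding det_def by blast

lemma detD: "det p X Y \<Longrightarrow> v \<in> set_pmf p \<Longrightarrow> w \<in> set_pmf p \<Longrightarrow> X v = X w \<Longrightarrow> Y v = Y w"
  unfolding det_def by blast

text \<open>The mass of the fibre of \<open>X\<close> through \<open>w\<close>. With it all
  entropies become sums over the same sample space, and variables with different ranges can be
  compared term by term.\<close>

definition fib :: "'w pmf \<Rightarrow> ('w \<Rightarrow> 'a) \<Rightarrow> 'w \<Rightarrow> real" where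
  "fib p X w = (\<Sum>v\<in>set_pmf p. if X v = X w then pmf p v else 0)"

lemma pmf_map_sum:
  assumes "finite (set_pmf p)"
  shows "pmf (map_pmf X p) x = (\<Sum>v\<in>set_pmf p. if X v = x then pmf p v else 0)"
proof -
  have "pmf (map_pmf X p) x = measure p (X -` {x} \<inter> set_pmf p)"
    by (simp add: pmf_map measure_Int_set_pmf)
  also have "\<dots> = sum (pmf p) (X -` {x} \<inter> set_pmf p)"
    using assms by (intro measure_measure_pmf_finite) auto
  also have "\<dots> = (\<Sum>v\<in>set_pmf p. if X v = x then pmf p v else 0)"
    using assms by (subst sum.inter_filter[symmetric]) (auto intro!: sum.cong)
  finally show ?thesis .
qed

lemma fib_eq_pmf: "finite (set_pmf p) \<Longrightarrow> fib p X w = pmf (map_pmf X p) (X w)"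
  by (simp add: fib_def pmf_map_sum)

lemma fib_pos: "finite (set_pmf p) \<Longrightarrow> w \<in> set_pmf p \<Longrightarrow> fib p X w > 0"
  by (simp add: fib_eq_pmf pmf_positive_iff)

lemma fib_mono:
  assumes "det p X Y" "w \<in> set_pmf p"
  shows "fib p X w \<le> fib p Y w"
  unfolding fib_def by (intro sum_mono) (use detD[OF assms(1) _ assms(2)] in auto)

lemma expectation_finite:
  fixes f :: "'a \<Rightarrow> real"
  assumes "finite (set_pmf p)"
  shows "expect p f = (\<Sum>x\<in>set_pmf p. pmf p x * f x)"
  using assms by (subst integral_measure_pmf[where A = "set_pmf p"]) auto

lemma ent_expectation: "finite (set_pmf \<mu>) \<Longrightarrow> ent \<mu> = expect \<mu> (\<lambda>x. - ln (pmf \<mu> x))"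
  unfolding ent_def by (rule expectation_finite[symmetric])

lemma rv_ent_eq:
  assumes "finite (set_pmf p)"
  shows "rv_ent p X = (\<Sum>w\<in>set_pmf p. pmf p w * - ln (fib p X w))"
proof -
  have "rv_ent p X = expect p (\<lambda>w. - ln (pmf (map_pmf X p) (X w)))"
    unfolding rv_ent_def using assms by (subst ent_expectation) (auto simp only: integral_map_pmf set_map_pmf finite_imageI)
  then show ?thesis by (simp only: expectation_finite[OF assms] fib_eq_pmf[OF assms])
qed

lemma rv_ent_mono:
  assumes fin: "finite (set_pmf p)" and d: "det p X Y"
  shows "rv_ent p Y \<le> rv_ent p X"
  unfolding rv_ent_eq[OF fin]
  by (intro sum_mono mult_left_mono) (auto simp: fib_pos[OF fin] fib_mono[OF d])

lemma rv_ent_cong: "finite (set_pmf p) \<Longrightarrow> det p X Y \<Longrightarrow> det p Y X \<Longrightarrow> rv_ent p X = rv_ent p Y"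
  by (rule antisym; rule rv_ent_mono)

text \<open>Nonnegativity of the mutual information of \<open>P\<close> and \<open>Q\<close> given a
  common function \<open>D\<close>, with the joint entropy weakened to that of a function
  \<open>T\<close> of the pair. It is Gibbs' inequality against the coupling in which
  \<open>P\<close> and \<open>Q\<close> are conditionally independent given \<open>D\<close>. Most
  later entropy inequalities are instances.\<close>

lemma submod:
  assumes fin: "finite (set_pmf p)"
    and PD: "det p P D" and QD: "det p Q D" and PQ: "det p (\<lambda>w. (P w, Q w)) T"
  shows "rv_ent p T + rv_ent p D \<le> rv_ent p P + rv_ent p Q"
proof -
  let ?S = "set_pmf p" and ?J = "\<lambda>w. (P w, Q w)"
  note pos = fib_pos[OF fin]
  have "rv_ent p ?J + rv_ent p D - rv_ent p P - rv_ent p Q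
      = (\<Sum>w\<in>?S. pmf p w * ln (fib p P w * fib p Q w / (fib p ?J w * fib p D w)))"
    unfolding rv_ent_eq[OF fin] sum.distrib[symmetric] sum_subtractf[symmetric]
  proof (intro sum.cong refl)
    fix w assume w: "w \<in> ?S"
    have ln: "ln (fib p P w * fib p Q w / (fib p ?J w * fib p D w))
        = ln (fib p P w) + ln (fib p Q w) - (ln (fib p ?J w) + ln (fib p D w))"
      using pos[OF w, of P] pos[OF w, of Q] pos[OF w, of ?J] pos[OF w, of D] by (simp add: ln_div ln_mult)
    show "pmf p w * - ln (fib p ?J w) + pmf p w * - ln (fib p D w) - pmf p w * - ln (fib p P w) - pmf p w * - ln (fib p Q w)
        = pmf p w * ln (fib p P w * fib p Q w / (fib p ?J w * fib p D w))"
      unfolding ln by (simp add: algebra_simps)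
  qed
  \<comment> \<open>It remains to see that the density ratio has mean at most 1; expanding the two
    fibre masses over \<open>u\<close> and \<open>v\<close> allows the sum over \<open>w\<close> to
    be taken innermost.\<close>
  also have "\<dots> \<le> (\<Sum>w\<in>?S. pmf p w * (fib p P w * fib p Q w / (fib p ?J w * fib p D w) - 1))"
    by (intro sum_mono mult_left_mono ln_le_minus_one) (auto simp: pos)
  also have "\<dots> = (\<Sum>w\<in>?S. pmf p w * (fib p P w * fib p Q w / (fib p ?J w * fib p D w))) - 1"
    using fin by (simp add: right_diff_distrib sum_subtractf sum_pmf_eq_1)
  also have "(\<Sum>w\<in>?S. pmf p w * (fib p P w * fib p Q w / (fib p ?J w * fib p D w)))
      = (\<Sum>w\<in>?S. \<Sum>u\<in>?S. \<Sum>v\<in>?S. if P u = P w \<and> Q v = Q w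
            then pmf p u * pmf p v * (pmf p w / (fib p ?J w * fib p D w)) else 0)"
    (is "?l = ?r")
  proof (intro sum.cong refl)
    fix w assume "w \<in> ?S"
    have "fib p P w * fib p Q w = (\<Sum>u\<in>?S. \<Sum>v\<in>?S. if P u = P w \<and> Q v = Q w then pmf p u * pmf p v else 0)"
      unfolding fib_def sum_product by (intro sum.cong) auto
    then have "pmf p w * (fib p P w * fib p Q w / (fib p ?J w * fib p D w))
       = (\<Sum>u\<in>?S. \<Sum>v\<in>?S. if P u = P w \<and> Q v = Q w then pmf p u * pmf p v else 0) * (pmf p w / (fib p ?J w * fib p D w))"
      by simp
    also have "\<dots> = (\<Sum>u\<in>?S. \<Sum>v\<in>?S. if P u = P w \<and> Q v = Q w
            then pmf p u * pmf p v * (pmf p w / (fib p ?J w * fib p D w)) else 0)"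
      unfolding sum_distrib_right by (intro sum.cong refl) auto
    finally show "pmf p w * (fib p P w * fib p Q w / (fib p ?J w * fib p D w))
       = (\<Sum>u\<in>?S. \<Sum>v\<in>?S. if P u = P w \<and> Q v = Q w
            then pmf p u * pmf p v * (pmf p w / (fib p ?J w * fib p D w)) else 0)" .
  qed
  also have "?r = (\<Sum>u\<in>?S. \<Sum>v\<in>?S. \<Sum>w\<in>?S. if P u = P w \<and> Q v = Q w
            then pmf p u * pmf p v * (pmf p w / (fib p ?J w * fib p D w)) else 0)"
    by (subst sum.swap, intro sum.cong refl sum.swap)
  \<comment> \<open>For fixed \<open>u\<close> and \<open>v\<close> the matching \<open>w\<close>
    form at most one fibre of the pair, and \<open>D\<close> is constant on it, so the factors
    \<open>pmf p w / fib p ?J w\<close> add up to 0 or 1.\<close>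
  also have "\<dots> \<le> (\<Sum>u\<in>?S. \<Sum>v\<in>?S. if D v = D u then pmf p u * pmf p v / fib p D u else 0)"
  proof (intro sum_mono)
    fix u v assume uv: "u \<in> ?S" "v \<in> ?S"
    let ?f = "\<lambda>w. if P u = P w \<and> Q v = Q w
            then pmf p u * pmf p v * (pmf p w / (fib p ?J w * fib p D w)) else 0"
    show "sum ?f ?S \<le> (if D v = D u then pmf p u * pmf p v / fib p D u else 0)"
    proof (cases "\<exists>w\<in>?S. P u = P w \<and> Q v = Q w")
      case False
      then have "sum ?f ?S = 0" by (intro sum.neutral) auto
      then show ?thesis using less_imp_le[OF pos[OF uv(1), of D]] by simp
    next
      case True
      then obtain w0 where w0: "w0 \<in> ?S" "P u = P w0" "Q v = Q w0" by auto
      have D: "D u = D w0" "D v = D w0"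
        using detD[OF PD uv(1) w0(1)] detD[OF QD uv(2) w0(1)] w0 by auto
      have "?f w = pmf p u * pmf p v / fib p D u / fib p ?J w0 * (if ?J w = ?J w0 then pmf p w else 0)"
        if "w \<in> ?S" for w
      proof (cases "?J w = ?J w0")
        case True
        then have "D w = D w0" using detD[OF PD that w0(1)] by auto
        then have "fib p D w = fib p D u" "fib p ?J w = fib p ?J w0" using True D by (auto simp: fib_def)
        then show ?thesis using True w0 by auto
      qed (use w0 in auto)
      then have "sum ?f ?S = pmf p u * pmf p v / fib p D u / fib p ?J w0 * fib p ?J w0"
        unfolding fib_def[of p ?J w0] sum_distrib_left by (intro sum.cong) auto
      then show ?thesis using D pos[OF w0(1), of ?J] by simp
    qed
  qed
  also have "\<dots> = (\<Sum>u\<in>?S. pmf p u)"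
  proof (intro sum.cong refl)
    fix u assume u: "u \<in> ?S"
    have "(\<Sum>v\<in>?S. if D v = D u then pmf p u * pmf p v / fib p D u else 0) = pmf p u / fib p D u * fib p D u"
      unfolding fib_def[of p D u] sum_distrib_left by (intro sum.cong) (auto simp: if_distrib)
    then show "(\<Sum>v\<in>?S. if D v = D u then pmf p u * pmf p v / fib p D u else 0) = pmf p u"
      using pos[OF u, of D] by simp
  qed
  also have "\<dots> = 1" using fin by (simp add: sum_pmf_eq_1)
  finally show ?thesis using rv_ent_mono[OF fin PQ] by linarith
qed

lemma ent_return [simp]: "ent (return_pmf x) = 0"
  by (simp add: ent_def)

lemma rv_ent_const [simp]: "rv_ent p (\<lambda>_. c) = 0"
  by (simp add: rv_ent_def)

lemma rv_ent_Pair_le: "finite (set_pmf p) \<Longrightarrow> rv_ent p (\<lambda>w. (X w, Y w)) \<le> rv_ent p X + rv_ent p Y"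
  using submod[of p X "\<lambda>_. ()" Y "\<lambda>w. (X w, Y w)", OF _ detI detI detI] by simp

lemma rv_ent_map: "rv_ent (map_pmf f p) X = rv_ent p (\<lambda>w. X (f w))"
  by (simp add: rv_ent_def map_pmf_comp)

text \<open>Chain rule: the joint mass is \<open>pmf \<nu> y * pmf (\<kappa> y) x\<close>, and its
  logarithm splits.\<close>

lemma ent_kernel:
  assumes fin: "finite (set_pmf \<nu>)" and fin': "\<And>y. y \<in> set_pmf \<nu> \<Longrightarrow> finite (set_pmf (\<kappa> y))"
  shows "ent (bind_pmf \<nu> (\<lambda>y. map_pmf (\<lambda>x. (x, y)) (\<kappa> y)))
    = ent \<nu> + expect \<nu> (\<lambda>y. ent (\<kappa> y))"
proof -
  let ?p = "bind_pmf \<nu> (\<lambda>y. map_pmf (\<lambda>x. (x, y)) (\<kappa> y))"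
  have pmf: "pmf ?p (x, y) = pmf \<nu> y * pmf (\<kappa> y) x" for x y
  proof -
    have *: "pmf (map_pmf (\<lambda>x. (x, y')) (\<kappa> y')) (x, y) = (if y' = y then pmf (\<kappa> y) x else 0)" for y'
    proof (cases "y' = y")
      case True
      have "inj (\<lambda>x. (x, y))" by (auto simp: inj_on_def)
      from pmf_map_inj'[OF this, of "\<kappa> y" x] True show ?thesis by simp
    next
      case False
      then have "(x, y) \<notin> (\<lambda>x. (x, y')) ` set_pmf (\<kappa> y')" by auto
      from pmf_map_outside[OF this] False show ?thesis by simp
    qed
    show ?thesis unfolding pmf_bind * expectation_finite[OF fin]
      using fin by (simp add: if_distrib set_pmf_iff cong: if_cong)
  qed
  have "set_pmf ?p = (\<lambda>(y, x). (x, y)) ` (SIGMA y:set_pmf \<nu>. set_pmf (\<kappa> y))"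
    by force
  then have "ent ?p = (\<Sum>(y, x)\<in>(SIGMA y:set_pmf \<nu>. set_pmf (\<kappa> y)). pmf ?p (x, y) * - ln (pmf ?p (x, y)))"
    unfolding ent_def by (simp add: sum.reindex inj_on_def case_prod_unfold split_beta)
  also have "\<dots> = (\<Sum>y\<in>set_pmf \<nu>. \<Sum>x\<in>set_pmf (\<kappa> y). pmf ?p (x, y) * - ln (pmf ?p (x, y)))"
    using fin fin' by (subst sum.Sigma) auto
  also have "\<dots> = (\<Sum>y\<in>set_pmf \<nu>. \<Sum>x\<in>set_pmf (\<kappa> y). pmf \<nu> y * - ln (pmf \<nu> y) * pmf (\<kappa> y) x
       + pmf \<nu> y * (pmf (\<kappa> y) x * - ln (pmf (\<kappa> y) x)))"
    by (intro sum.cong refl) (auto simp: pmf ln_mult set_pmf_iff algebra_simps)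
  also have "\<dots> = (\<Sum>y\<in>set_pmf \<nu>. pmf \<nu> y * - ln (pmf \<nu> y)) + (\<Sum>y\<in>set_pmf \<nu>. pmf \<nu> y * ent (\<kappa> y))"
    unfolding sum.distrib sum_distrib_left[symmetric] ent_def
    by (intro arg_cong2[of _ _ _ _ "(+)"] sum.cong refl)
      (use fin' in \<open>auto simp: sum_pmf_eq_1 simp flip: sum_distrib_left\<close>)
  finally show ?thesis by (simp add: ent_def expectation_finite[OF fin])
qed

lemma pair_pmf_kernel: "pair_pmf \<mu> \<nu> = bind_pmf \<nu> (\<lambda>y. map_pmf (\<lambda>x. (x, y)) \<mu>)"
  unfolding pair_pmf_def map_pmf_def by (rule bind_commute_pmf)

lemma ent_pair:
  assumes "finite (set_pmf \<mu>)" "finite (set_pmf \<nu>)"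
  shows "ent (pair_pmf \<mu> \<nu>) = ent \<mu> + ent \<nu>"
  using assms unfolding pair_pmf_kernel by (subst ent_kernel) auto

lemma ent_map_inj: "finite (set_pmf \<mu>) \<Longrightarrow> inj_on f (set_pmf \<mu>) \<Longrightarrow> ent (map_pmf f \<mu>) = ent \<mu>"
  using rv_ent_cong[of \<mu> "\<lambda>x. x" f, OF _ detI detI] by (simp add: rv_ent_def inj_on_def)

text \<open>Gibbs' inequality against the uniform law on \<open>B\<close>.\<close>

lemma ent_le_ln_card:
  assumes "finite B" "set_pmf \<mu> \<subseteq> B"
  shows "ent \<mu> \<le> ln (real (card B))"
proof -
  have fin: "finite (set_pmf \<mu>)" using assms finite_subset by blast
  have c: "card B > 0" using assms set_pmf_not_empty[of \<mu>] by (metis card_gt_0_iff subset_empty)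
  have "ent \<mu> - ln (real (card B)) = (\<Sum>x\<in>set_pmf \<mu>. pmf \<mu> x * (- ln (pmf \<mu> x) - ln (real (card B))))"
    unfolding right_diff_distrib sum_subtractf ent_def sum_distrib_right[symmetric]
    using fin by (simp add: sum_pmf_eq_1)
  also have "\<dots> = (\<Sum>x\<in>set_pmf \<mu>. pmf \<mu> x * ln (1 / (pmf \<mu> x * card B)))"
    using c by (intro sum.cong) (auto simp: ln_div ln_mult set_pmf_iff)
  also have "\<dots> \<le> (\<Sum>x\<in>set_pmf \<mu>. pmf \<mu> x * (1 / (pmf \<mu> x * card B) - 1))"
    using c by (intro sum_mono mult_left_mono ln_le_minus_one) (auto simp: pmf_positive_iff)
  also have "\<dots> = (\<Sum>x\<in>set_pmf \<mu>. 1 / card B - pmf \<mu> x)"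
    using c by (intro sum.cong) (auto simp: field_simps set_pmf_iff)
  also have "\<dots> = card (set_pmf \<mu>) / card B - 1"
    using fin by (simp add: sum_subtractf sum_pmf_eq_1)
  also have "\<dots> \<le> 0" using c card_mono[OF assms] by (simp add: field_simps)
  finally show ?thesis by simp
qed

lemma ent_pmf_of_set: "finite B \<Longrightarrow> B \<noteq> {} \<Longrightarrow> ent (pmf_of_set B) = ln (real (card B))"
  by (simp add: ent_def ln_div)

section \<open>Conditional laws and disintegration\<close>

definition kern :: "('a \<times> 'b) pmf \<Rightarrow> 'b \<Rightarrow> 'a pmf" where
  "kern J y = map_pmf fst (cond_pmf J {z. snd z = y})"

lemma kern_nonempty: "y \<in> snd ` set_pmf J \<Longrightarrow> set_pmf J \<inter> {z. snd z = y} \<noteq> {}"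
  by auto

lemma set_kern: "y \<in> snd ` set_pmf J \<Longrightarrow> set_pmf (kern J y) = {x. (x, y) \<in> set_pmf J}"
  unfolding kern_def set_map_pmf by (subst set_cond_pmf[OF kern_nonempty]) (auto simp: image_iff Bex_def)

text \<open>Brings an arbitrary joint law into the kernel form required by
  \<open>ent_kernel\<close>. The mixture runs only over values \<open>y\<close> of positive mass;
  for other \<open>y\<close> the law \<open>kern J y\<close> has no meaning.\<close>

lemma kern_disint:
  fixes J :: "('a \<times> 'b) pmf"
  shows "J = bind_pmf (map_pmf snd J) (\<lambda>y. map_pmf (\<lambda>x. (x, y)) (kern J y))"
proof -
  have "bind_pmf (map_pmf snd J) (\<lambda>y. map_pmf (\<lambda>x. (x, y)) (kern J y))
      = bind_pmf (map_pmf snd J) (\<lambda>y. cond_pmf J {z. snd z = y})"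
  proof (rule bind_pmf_cong[OF refl])
    fix y assume "y \<in> set_pmf (map_pmf snd J)"
    then have "set_pmf (cond_pmf J {z. snd z = y}) \<subseteq> {z. snd z = y}"
      using set_cond_pmf[OF kern_nonempty, of y J] by simp
    then show "map_pmf (\<lambda>x. (x, y)) (kern J y) = cond_pmf J {z. snd z = y}"
      unfolding kern_def map_pmf_comp by (intro map_pmf_idI) auto
  qed
  also have "\<dots> = J"
  proof (rule bind_cond_pmf_cancel)
    fix y and z :: "'a \<times> 'b" assume "snd z = y"
    then show "prob J {z'. snd z' = y} = prob (map_pmf snd J) {y'. snd z = y'}"
      by (simp add: vimage_def)
  next
    fix y assume "y \<in> set_pmf (map_pmf snd J)"
    then show "set_pmf J \<inter> {z. snd z = y} \<noteq> {}" by auto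
  next
    fix z assume "z \<in> set_pmf J"
    then show "set_pmf (map_pmf snd J) \<inter> {y. snd z = y} \<noteq> {}" by auto
  qed
  finally show ?thesis by (rule sym)
qed

section \<open>Independence\<close>

definition indep :: "'w pmf \<Rightarrow> ('w \<Rightarrow> 'a) \<Rightarrow> ('w \<Rightarrow> 'b) \<Rightarrow> bool" where
  "indep p X Y \<longleftrightarrow> map_pmf (\<lambda>w. (X w, Y w)) p = pair_pmf (map_pmf X p) (map_pmf Y p)"

text \<open>Quantified over all functions and not over a support: \<open>f\<close> may then be
  evaluated at a function that carries default values outside the block \<open>A\<close>.\<close>

definition depends :: "'i set \<Rightarrow> (('i \<Rightarrow> 'v) \<Rightarrow> 'a) \<Rightarrow> bool" where
  "depends A f \<longleftrightarrow> (\<forall>u v. (\<forall>i\<in>A. u i = v i) \<longrightarrow> f u = f v)"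

lemma dependsI: "(\<And>u v. (\<And>i. i \<in> A \<Longrightarrow> u i = v i) \<Longrightarrow> f u = f v) \<Longrightarrow> depends A f"
  unfolding depends_def by blast

lemma dependsD: "depends A f \<Longrightarrow> (\<And>i. i \<in> A \<Longrightarrow> u i = v i) \<Longrightarrow> f u = f v"
  unfolding depends_def by blast

lemma indep_ent:
  assumes "finite (set_pmf p)" "indep p X Y"
  shows "rv_ent p (\<lambda>w. (X w, Y w)) = rv_ent p X + rv_ent p Y"
  using assms unfolding rv_ent_def indep_def by (simp add: ent_pair)

text \<open>The product law splits into its restrictions to \<open>A\<close> and to
  \<open>I - A\<close>; \<open>f\<close> sees only the one and \<open>g\<close> only the
  other.\<close>

lemma Pi_pmf_indep:
  assumes I: "finite I" and sub: "A \<subseteq> I" "B \<subseteq> I" and disj: "A \<inter> B = {}"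
    and f: "depends A f" and g: "depends B g"
  shows "indep (Pi_pmf I d \<mu>) f g"
proof -
  let ?PA = "Pi_pmf A d \<mu>" and ?PB = "Pi_pmf (I - A) d \<mu>"
  let ?merge = "\<lambda>(u, v) x. if x \<in> A then u x else v x"
  have fin: "finite A" "finite (I - A)" using I sub finite_subset by auto
  have "Pi_pmf I d \<mu> = Pi_pmf (A \<union> (I - A)) d \<mu>" using sub by (simp add: Un_absorb1)
  also have "\<dots> = map_pmf ?merge (pair_pmf ?PA ?PB)"
    using fin by (subst Pi_pmf_union) auto
  finally have P: "Pi_pmf I d \<mu> = map_pmf ?merge (pair_pmf ?PA ?PB)" .
  have f': "f (?merge w) = f (fst w)" for w
    by (rule dependsD[OF f]) (auto simp: case_prod_unfold)
  have g': "g (?merge w) = g (snd w)" for w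
    by (rule dependsD[OF g]) (use disj in \<open>auto simp: case_prod_unfold\<close>)
  have 1: "map_pmf f (Pi_pmf I d \<mu>) = map_pmf f ?PA"
    unfolding P map_pmf_comp f' by (simp flip: map_pmf_comp add: map_fst_pair_pmf)
  have 2: "map_pmf g (Pi_pmf I d \<mu>) = map_pmf g ?PB"
    unfolding P map_pmf_comp g' by (simp flip: map_pmf_comp add: map_snd_pair_pmf)
  have "map_pmf (\<lambda>w. (f w, g w)) (Pi_pmf I d \<mu>) = map_pmf (\<lambda>w. (f (fst w), g (snd w))) (pair_pmf ?PA ?PB)"
    unfolding P map_pmf_comp f' g' ..
  also have "\<dots> = pair_pmf (map_pmf f ?PA) (map_pmf g ?PB)"
    unfolding map_pair[symmetric] by (simp add: case_prod_unfold)
  finally show ?thesis unfolding indep_def 1 2 .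
qed

lemma finite_set_Pi_pmf:
  assumes "finite A" "\<And>i. i \<in> A \<Longrightarrow> finite (set_pmf (\<mu> i))"
  shows "finite (set_pmf (Pi_pmf A d \<mu>))"
  using assms by (auto simp: set_Pi_pmf intro!: finite_PiE_dflt)

text \<open>Grouping of independent coordinates. A function in the support of \<open>Pi_pmf\<close>
  takes the default value outside the index set, hence the \<open>d'\<close> on the left.\<close>

lemma Pi_pmf_blocks:
  fixes \<mu> :: "'i \<Rightarrow> 'v pmf"
  assumes I: "finite I" and A: "finite A" and sub: "\<And>s. s \<in> A \<Longrightarrow> B s \<subseteq> I"
    and dep: "\<And>s. s \<in> A \<Longrightarrow> depends (B s) (f s)"
    and disj: "\<And>s t. s \<in> A \<Longrightarrow> t \<in> A \<Longrightarrow> s \<noteq> t \<Longrightarrow> B s \<inter> B t = {}"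
  shows "map_pmf (\<lambda>w s. if s \<in> A then f s w else d') (Pi_pmf I d \<mu>)
    = Pi_pmf A d' (\<lambda>s. map_pmf (f s) (Pi_pmf I d \<mu>))"
  using A sub dep disj
proof (induction A rule: finite_induct)
  case empty
  then show ?case by simp
next
  case (insert x A)
  let ?P = "Pi_pmf I d \<mu>" and ?F = "\<lambda>w s. if s \<in> A then f s w else d'"
  have IH: "map_pmf ?F ?P = Pi_pmf A d' (\<lambda>s. map_pmf (f s) ?P)"
    by (intro insert.IH) (use insert.prems in auto)
  have "indep ?P (f x) ?F"
  proof (rule Pi_pmf_indep[OF I])
    show "depends (\<Union>s\<in>A. B s) ?F"
    proof (rule dependsI)
      fix u v :: "'i \<Rightarrow> 'v" assume "\<And>i. i \<in> (\<Union>s\<in>A. B s) \<Longrightarrow> u i = v i"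
      then have "f s u = f s v" if "s \<in> A" for s
        using that insert.prems(2) by (intro dependsD[of "B s" "f s"]) auto
      then show "?F u = ?F v" by auto
    qed
    show "B x \<inter> (\<Union>s\<in>A. B s) = {}" using insert.prems(3) insert.hyps by blast
  qed (use insert.prems in auto)
  then have "Pi_pmf (insert x A) d' (\<lambda>s. map_pmf (f s) ?P)
      = map_pmf (\<lambda>(y, g). g(x := y)) (map_pmf (\<lambda>w. (f x w, ?F w)) ?P)"
    using insert.hyps unfolding indep_def IH by (subst Pi_pmf_insert) auto
  also have "\<dots> = map_pmf (\<lambda>w s. if s \<in> insert x A then f s w else d') ?P"
    unfolding map_pmf_comp using insert.hyps by (intro map_pmf_cong) (auto simp: fun_eq_iff)
  finally show ?case ..
qed

section \<open>Convolution\<close>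

text \<open>Addition of distributions is convolution, the law of the sum of independent variables.\<close>

instantiation pmf :: (comm_monoid_add) comm_monoid_add
begin

definition zero_pmf :: "'a pmf" where
  "zero_pmf = return_pmf 0"

definition plus_pmf :: "'a pmf \<Rightarrow> 'a pmf \<Rightarrow> 'a pmf" where
  "plus_pmf \<mu> \<nu> = map_pmf (\<lambda>w. fst w + snd w) (pair_pmf \<mu> \<nu>)"

instance
proof
  fix a b c :: "'a pmf"
  show "a + b + c = a + (b + c)"
    unfolding plus_pmf_def pair_map_pmf1 pair_map_pmf2 pair_pair_pmf map_pmf_comp
    by (intro map_pmf_cong) (auto simp: add.assoc)
  show "a + b = b + a"
    unfolding plus_pmf_def by (subst pair_commute_pmf) (simp add: map_pmf_comp case_prod_unfold add.commute)
  show "0 + a = a"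
    unfolding plus_pmf_def zero_pmf_def pair_return_pmf1 map_pmf_comp by simp
qed

end

lemma set_plus_pmf: "set_pmf (\<mu> + \<nu>) = (\<lambda>w. fst w + snd w) ` (set_pmf \<mu> \<times> set_pmf \<nu>)"
  by (simp add: plus_pmf_def)

lemma finite_set_plus_pmf [simp]: "finite (set_pmf \<mu>) \<Longrightarrow> finite (set_pmf \<nu>) \<Longrightarrow> finite (set_pmf (\<mu> + \<nu>))"
  by (simp add: set_plus_pmf)

lemma finite_set_sum_pmf [simp]: "(\<And>i. i \<in> A \<Longrightarrow> finite (set_pmf (\<mu> i))) \<Longrightarrow> finite (set_pmf (\<Sum>i\<in>A. \<mu> i))"
  by (induction A rule: infinite_finite_induct) (auto simp: zero_pmf_def)

lemma indep_plus:
  assumes "indep p X Y"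
  shows "map_pmf (\<lambda>w. X w + Y w) p = map_pmf X p + map_pmf Y p"
  using assms[unfolded indep_def, symmetric] by (simp add: plus_pmf_def map_pmf_comp)

lemma sum_Pi_pmf:
  fixes \<mu> :: "'i \<Rightarrow> 'g::comm_monoid_add pmf"
  assumes I: "finite I" and J: "J \<subseteq> I"
  shows "map_pmf (\<lambda>w. \<Sum>i\<in>J. w i) (Pi_pmf I d \<mu>) = (\<Sum>i\<in>J. \<mu> i)"
proof -
  have "finite J" using assms finite_subset by auto
  then show ?thesis using J
  proof (induction J rule: finite_induct)
    case empty
    then show ?case by (simp add: zero_pmf_def)
  next
    case (insert x J)
    have "indep (Pi_pmf I d \<mu>) (\<lambda>w. w x) (\<lambda>w. \<Sum>i\<in>J. w i)"
      by (rule Pi_pmf_indep[OF I, of "{x}" J]) (use insert in \<open>auto intro!: dependsI sum.cong\<close>)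
    from indep_plus[OF this] show ?case
      using insert I by (simp add: Pi_pmf_component)
  qed
qed

text \<open>The law of \<open>-X\<close>. It is not an additive inverse, since
  \<open>\<mu> + neg \<mu>\<close> is in general not a point mass; laws therefore form only a
  commutative monoid.\<close>

definition neg :: "'g::ab_group_add pmf \<Rightarrow> 'g pmf" where
  "neg \<mu> = map_pmf uminus \<mu>"

lemma set_neg: "set_pmf (neg \<mu>) = uminus ` set_pmf \<mu>"
  by (simp add: neg_def)

lemma finite_set_neg [simp]: "finite (set_pmf \<mu>) \<Longrightarrow> finite (set_pmf (neg \<mu>))"
  by (simp add: neg_def)

lemma neg_neg [simp]: "neg (neg \<mu>) = \<mu>"
  by (simp add: neg_def map_pmf_comp)

lemma neg_add: "neg (\<mu> + \<nu>) = neg \<mu> + neg \<nu>"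
  unfolding neg_def plus_pmf_def pair_map_pmf1 pair_map_pmf2 map_pmf_comp
  by (intro map_pmf_cong) auto

lemma neg_0 [simp]: "neg 0 = 0"
  by (simp add: neg_def zero_pmf_def)

lemma neg_sum: "neg (\<Sum>i\<in>A. \<mu> i) = (\<Sum>i\<in>A. neg (\<mu> i))"
  by (induction A rule: infinite_finite_induct) (auto simp: neg_add)

lemma ent_neg [simp]: "finite (set_pmf \<mu>) \<Longrightarrow> ent (neg \<mu>) = ent \<mu>"
  unfolding neg_def by (intro ent_map_inj) auto

definition smul :: "nat \<Rightarrow> 'g \<Rightarrow> 'g::ab_group_add" where
  "smul n x = (\<Sum>i<n. x)"

lemma smul_0 [simp]: "smul 0 x = 0" and smul_Suc: "smul (Suc n) x = smul n x + x"
  by (simp_all add: smul_def)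

text \<open>One identity for all linear forms in three independent variables: a constant map 0
  removes a variable.\<close>

lemma law3:
  "map_pmf (\<lambda>w. a (fst w) + (b (fst (snd w)) + c (snd (snd w)))) (pair_pmf \<mu> (pair_pmf \<nu> \<rho>))
    = map_pmf a \<mu> + (map_pmf b \<nu> + map_pmf c \<rho>)"
  unfolding plus_pmf_def pair_map_pmf1 pair_map_pmf2 map_pmf_comp
  by (intro map_pmf_cong) auto

lemma ent_le_add:
  fixes \<mu> \<nu> :: "'g::ab_group_add pmf"
  assumes fin: "finite (set_pmf \<mu>)" "finite (set_pmf \<nu>)"
  shows "ent \<mu> \<le> ent (\<mu> + \<nu>)"
proof -
  let ?p = "pair_pmf \<mu> \<nu>"
  have "ent \<mu> + ent \<nu> = rv_ent ?p (\<lambda>w. w)"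
    using fin by (simp add: rv_ent_def ent_pair)
  also have "\<dots> \<le> rv_ent ?p (\<lambda>w. (fst w + snd w, snd w))"
    using fin by (intro rv_ent_mono detI) (auto simp: prod_eq_iff)
  also have "\<dots> \<le> rv_ent ?p (\<lambda>w. fst w + snd w) + rv_ent ?p snd"
    using fin by (intro rv_ent_Pair_le) auto
  finally show ?thesis by (simp add: rv_ent_def plus_pmf_def map_snd_pair_pmf)
qed

context
  fixes \<mu> \<nu> \<rho> :: "'g::ab_group_add pmf"
  assumes fin: "finite (set_pmf \<mu>)" "finite (set_pmf \<nu>)" "finite (set_pmf \<rho>)"
begin

text \<open>The common shape of the next three inequalities: for independent variables the joint
  entropy is the sum \<open>ent \<mu> + ent \<nu> + ent \<rho>\<close>, and two pairs of forms that
  each determine \<open>D\<close> together determine the whole triple.\<close>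

lemma submod3:
  fixes D :: "'g \<times> 'g \<times> 'g \<Rightarrow> 'g" and P\<^sub>1 P\<^sub>2 :: "'g \<times> 'g \<times> 'g \<Rightarrow> 'g"
  defines "p \<equiv> pair_pmf \<mu> (pair_pmf \<nu> \<rho>)"
  assumes "\<And>v w. P\<^sub>1 v = P\<^sub>1 w \<Longrightarrow> P\<^sub>2 v = P\<^sub>2 w \<Longrightarrow> D v = D w"
    "\<And>v w. Q\<^sub>1 v = Q\<^sub>1 w \<Longrightarrow> Q\<^sub>2 v = Q\<^sub>2 w \<Longrightarrow> D v = D w"
    "\<And>v w. P\<^sub>1 v = P\<^sub>1 w \<Longrightarrow> P\<^sub>2 v = P\<^sub>2 w \<Longrightarrow> Q\<^sub>1 v = Q\<^sub>1 w \<Longrightarrow> Q\<^sub>2 v = Q\<^sub>2 w \<Longrightarrow> v = w"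
  shows "ent \<mu> + ent \<nu> + ent \<rho> + rv_ent p D \<le> rv_ent p P\<^sub>1 + rv_ent p P\<^sub>2 + rv_ent p Q\<^sub>1 + rv_ent p Q\<^sub>2"
proof -
  have f: "finite (set_pmf p)" using fin by (simp add: p_def)
  have "ent \<mu> + ent \<nu> + ent \<rho> = rv_ent p (\<lambda>w. w)"
    using fin by (simp add: rv_ent_def p_def ent_pair)
  moreover have "rv_ent p (\<lambda>w. w) + rv_ent p D \<le> rv_ent p (\<lambda>w. (P\<^sub>1 w, P\<^sub>2 w)) + rv_ent p (\<lambda>w. (Q\<^sub>1 w, Q\<^sub>2 w))"
    by (intro submod[OF f] detI) (use assms(2-) in blast)+
  ultimately show ?thesis
    using rv_ent_Pair_le[OF f, of P\<^sub>1 P\<^sub>2] rv_ent_Pair_le[OF f, of Q\<^sub>1 Q\<^sub>2] by linarith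
qed

text \<open>The Kaimanovich-Vershik-Madiman inequality: \<open>x + y + z\<close> is determined by
  \<open>(x, y + z)\<close> and by \<open>(x + z, y)\<close>.\<close>

lemma kvm: "ent (\<mu> + \<nu> + \<rho>) + ent \<rho> \<le> ent (\<mu> + \<rho>) + ent (\<nu> + \<rho>)"
proof -
  let ?x = "fst :: 'g \<times> 'g \<times> 'g \<Rightarrow> 'g" and ?y = "\<lambda>w :: 'g \<times> 'g \<times> 'g. fst (snd w)" and ?z = "\<lambda>w :: 'g \<times> 'g \<times> 'g. snd (snd w)"
  let ?p = "pair_pmf \<mu> (pair_pmf \<nu> \<rho>)"
  have "ent \<mu> + ent \<nu> + ent \<rho> + rv_ent ?p (\<lambda>w. ?x w + (?y w + ?z w))
    \<le> rv_ent ?p ?x + rv_ent ?p (\<lambda>w. ?y w + ?z w) + rv_ent ?p (\<lambda>w. ?x w + ?z w) + rv_ent ?p ?y"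
    by (intro submod3) (auto simp: prod_eq_iff algebra_simps)
  moreover have "rv_ent ?p ?x = ent \<mu>" "rv_ent ?p ?y = ent \<nu>"
    by (auto simp: rv_ent_def map_fst_pair_pmf map_snd_pair_pmf simp flip: map_pmf_comp)
  moreover have "rv_ent ?p (\<lambda>w. ?x w + (?y w + ?z w)) = ent (\<mu> + (\<nu> + \<rho>))"
    "rv_ent ?p (\<lambda>w. ?y w + ?z w) = ent (\<nu> + \<rho>)" "rv_ent ?p (\<lambda>w. ?x w + ?z w) = ent (\<mu> + \<rho>)"
    using law3[of "\<lambda>x. x" "\<lambda>x. x" "\<lambda>x. x" \<mu> \<nu> \<rho>] law3[of "\<lambda>x. 0" "\<lambda>x. x" "\<lambda>x. x" \<mu> \<nu> \<rho>]
      law3[of "\<lambda>x. x" "\<lambda>x. 0" "\<lambda>x. x" \<mu> \<nu> \<rho>] by (simp_all flip: zero_pmf_def add: rv_ent_def)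
  ultimately show ?thesis by (simp add: add.assoc)
qed

text \<open>The triangle inequality for entropic Ruzsa distance before normalisation:
  \<open>x - y\<close> is determined by \<open>(x - z, z - y)\<close> and by
  \<open>(x, y)\<close>.\<close>

lemma ruzsa_triangle: "ent (\<mu> + neg \<nu>) + ent \<rho> \<le> ent (\<mu> + neg \<rho>) + ent (\<rho> + neg \<nu>)"
proof -
  let ?x = "fst :: 'g \<times> 'g \<times> 'g \<Rightarrow> 'g" and ?y = "\<lambda>w :: 'g \<times> 'g \<times> 'g. fst (snd w)" and ?z = "\<lambda>w :: 'g \<times> 'g \<times> 'g. snd (snd w)"
  let ?p = "pair_pmf \<mu> (pair_pmf \<nu> \<rho>)"
  have "ent \<mu> + ent \<nu> + ent \<rho> + rv_ent ?p (\<lambda>w. ?x w + - ?y w)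
    \<le> rv_ent ?p (\<lambda>w. ?x w + - ?z w) + rv_ent ?p (\<lambda>w. - ?y w + ?z w) + rv_ent ?p ?x + rv_ent ?p ?y"
  proof (intro submod3)
    fix v w assume "?x v + - ?z v = ?x w + - ?z w" "- ?y v + ?z v = - ?y w + ?z w"
    then have "(?x v + - ?z v) + (- ?y v + ?z v) = (?x w + - ?z w) + (- ?y w + ?z w)" by simp
    then show "?x v + - ?y v = ?x w + - ?y w" by (simp add: algebra_simps)
  qed (auto simp: prod_eq_iff)
  moreover have "rv_ent ?p ?x = ent \<mu>" "rv_ent ?p ?y = ent \<nu>"
    by (auto simp: rv_ent_def map_fst_pair_pmf map_snd_pair_pmf simp flip: map_pmf_comp)
  moreover have "rv_ent ?p (\<lambda>w. ?x w + - ?y w) = ent (\<mu> + neg \<nu>)"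
    "rv_ent ?p (\<lambda>w. - ?y w + ?z w) = ent (neg \<nu> + \<rho>)" "rv_ent ?p (\<lambda>w. ?x w + - ?z w) = ent (\<mu> + neg \<rho>)"
    using law3[of "\<lambda>x. x" uminus "\<lambda>x. 0" \<mu> \<nu> \<rho>] law3[of "\<lambda>x. 0" uminus "\<lambda>x. x" \<mu> \<nu> \<rho>]
      law3[of "\<lambda>x. x" "\<lambda>x. 0" uminus \<mu> \<nu> \<rho>] by (simp_all flip: zero_pmf_def add: rv_ent_def neg_def)
  ultimately show ?thesis by (simp add: add.commute)
qed

text \<open>\<open>x - (j + 1) y\<close> is the sum of \<open>x - y - z\<close> and
  \<open>z - j y\<close>, and is also determined by \<open>(x, y)\<close>. Raising the multiple by
  one has a fixed price, so that the cost of large multiples grows linearly and not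
  exponentially.\<close>

lemma ent_diff_smul_Suc:
  "ent (\<mu> + neg (map_pmf (smul (Suc j)) \<nu>)) + ent \<rho>
    \<le> ent (\<mu> + neg \<nu> + neg \<rho>) + ent (\<rho> + neg (map_pmf (smul j) \<nu>))"
proof -
  let ?x = "fst :: 'g \<times> 'g \<times> 'g \<Rightarrow> 'g" and ?y = "\<lambda>w :: 'g \<times> 'g \<times> 'g. fst (snd w)" and ?z = "\<lambda>w :: 'g \<times> 'g \<times> 'g. snd (snd w)"
  let ?p = "pair_pmf \<mu> (pair_pmf \<nu> \<rho>)"
  have "ent \<mu> + ent \<nu> + ent \<rho> + rv_ent ?p (\<lambda>w. ?x w + - smul (Suc j) (?y w))
    \<le> rv_ent ?p (\<lambda>w. ?x w + (- ?y w + - ?z w)) + rv_ent ?p (\<lambda>w. - smul j (?y w) + ?z w) + rv_ent ?p ?x + rv_ent ?p ?y"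
  proof (intro submod3)
    fix v w assume "?x v + (- ?y v + - ?z v) = ?x w + (- ?y w + - ?z w)"
      "- smul j (?y v) + ?z v = - smul j (?y w) + ?z w"
    then have "(?x v + (- ?y v + - ?z v)) + (- smul j (?y v) + ?z v)
       = (?x w + (- ?y w + - ?z w)) + (- smul j (?y w) + ?z w)" by simp
    then show "?x v + - smul (Suc j) (?y v) = ?x w + - smul (Suc j) (?y w)"
      by (simp add: smul_Suc algebra_simps)
  qed (auto simp: prod_eq_iff algebra_simps)
  moreover have "rv_ent ?p ?x = ent \<mu>" "rv_ent ?p ?y = ent \<nu>"
    by (auto simp: rv_ent_def map_fst_pair_pmf map_snd_pair_pmf simp flip: map_pmf_comp)
  moreover have "rv_ent ?p (\<lambda>w. ?x w + - smul (Suc j) (?y w)) = ent (\<mu> + neg (map_pmf (smul (Suc j)) \<nu>))"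
    "rv_ent ?p (\<lambda>w. - smul j (?y w) + ?z w) = ent (neg (map_pmf (smul j) \<nu>) + \<rho>)"
    "rv_ent ?p (\<lambda>w. ?x w + (- ?y w + - ?z w)) = ent (\<mu> + (neg \<nu> + neg \<rho>))"
    using law3[of "\<lambda>x. x" "\<lambda>x. - smul (Suc j) x" "\<lambda>x. 0" \<mu> \<nu> \<rho>] law3[of "\<lambda>x. 0" "\<lambda>x. - smul j x" "\<lambda>x. x" \<mu> \<nu> \<rho>]
      law3[of "\<lambda>x. x" uminus uminus \<mu> \<nu> \<rho>] by (simp_all flip: zero_pmf_def add: rv_ent_def neg_def map_pmf_comp)
  ultimately show ?thesis by (simp add: add_ac)
qed

end

text \<open>A Pluennecke-type bound: by \<open>kvm\<close>, a further summand raises the entropy by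
  no more than it would raise that of \<rho> alone.\<close>

lemma kvm_sum:
  fixes \<rho> :: "'g::ab_group_add pmf"
  assumes "finite (set_pmf \<rho>)" "finite J" "\<And>j. j \<in> J \<Longrightarrow> finite (set_pmf (\<mu> j))"
  shows "ent (\<rho> + (\<Sum>j\<in>J. \<mu> j)) \<le> ent \<rho> + (\<Sum>j\<in>J. ent (\<rho> + \<mu> j) - ent \<rho>)"
  using assms(2,3)
proof (induction J rule: finite_induct)
  case (insert x J)
  have "ent (\<mu> x + (\<Sum>j\<in>J. \<mu> j) + \<rho>) + ent \<rho> \<le> ent (\<mu> x + \<rho>) + ent ((\<Sum>j\<in>J. \<mu> j) + \<rho>)"
    by (rule kvm) (use insert assms in auto)
  moreover have "ent (\<rho> + (\<Sum>j\<in>J. \<mu> j)) \<le> ent \<rho> + (\<Sum>j\<in>J. ent (\<rho> + \<mu> j) - ent \<rho>)"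
    using insert by auto
  ultimately show ?case using insert.hyps by (simp add: add_ac)
qed auto

section \<open>Ruzsa distance and multidistance\<close>

definition rd :: "'g::ab_group_add pmf \<Rightarrow> 'g pmf \<Rightarrow> real" where
  "rd \<mu> \<nu> = ent (\<mu> + neg \<nu>) - (ent \<mu> + ent \<nu>) / 2"

definition multidist :: "nat \<Rightarrow> (nat \<Rightarrow> 'g::ab_group_add pmf) \<Rightarrow> real" where
  "multidist m X = ent (\<Sum>i<m. X i) - (\<Sum>i<m. ent (X i)) / m"

lemma ent_le_add2: "finite (set_pmf \<mu>) \<Longrightarrow> finite (set_pmf \<nu>) \<Longrightarrow> ent \<nu> \<le> ent (\<mu> + \<nu>)"
  for \<mu> \<nu> :: "'g::ab_group_add pmf"
  using ent_le_add[of \<nu> \<mu>] by (simp add: add.commute)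

lemma rd_triangle:
  assumes "finite (set_pmf \<mu>)" "finite (set_pmf \<nu>)" "finite (set_pmf \<rho>)"
  shows "rd \<mu> \<nu> \<le> rd \<mu> \<rho> + rd \<rho> \<nu>"
  using ruzsa_triangle[OF assms] by (simp add: rd_def field_simps)

lemma rd_ent_diff:
  assumes "finite (set_pmf \<mu>)" "finite (set_pmf \<nu>)"
  shows "\<bar>ent \<mu> - ent \<nu>\<bar> \<le> 2 * rd \<mu> \<nu>" "0 \<le> rd \<mu> \<nu>"
  using ent_le_add[of \<mu> "neg \<nu>"] ent_le_add2[of \<mu> "neg \<nu>"] assms by (auto simp: rd_def abs_le_iff add_divide_distrib algebra_simps)

text \<open>\<open>kvm_sum\<close> with base \<open>neg \<nu>\<close>: each copy of \<mu> is
  compared with one and the same \<nu>. Control of a single difference becomes control of an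
  \<open>m\<close>-fold sum at the price of a factor \<open>m\<close>.\<close>

lemma multidist_const_le:
  fixes \<mu> \<nu> :: "'g::ab_group_add pmf"
  assumes "finite (set_pmf \<mu>)" "finite (set_pmf \<nu>)" "m > 0"
  shows "multidist m (\<lambda>_. \<mu>) \<le> ent \<nu> - ent \<mu> + m * (ent (\<mu> + neg \<nu>) - ent \<nu>)"
proof -
  have "ent (\<Sum>i<m. \<mu>) \<le> ent (neg \<nu> + (\<Sum>i<m. \<mu>))"
    using assms by (intro ent_le_add2) auto
  also have "\<dots> \<le> ent (neg \<nu>) + (\<Sum>i<m. ent (neg \<nu> + \<mu>) - ent (neg \<nu>))"
    using assms by (intro kvm_sum) auto
  finally show ?thesis using assms by (simp add: multidist_def add.commute)
qed

section \<open>Combinations of the \<open>X i\<close> and of copies of \<open>S\<close>, controlled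
  by the multidistance\<close>

context
  fixes m :: nat and X :: "nat \<Rightarrow> 'g::ab_group_add pmf" and S k
  assumes m: "2 \<le> m" and fin: "\<And>i. i < m \<Longrightarrow> finite (set_pmf (X i))"
  defines "S \<equiv> \<Sum>i<m. X i" and "k \<equiv> multidist m X"
begin

lemma finS: "finite (set_pmf S)"
  unfolding S_def using fin by (intro finite_set_sum_pmf) auto

lemma sum_ent_gap: "(\<Sum>i<m. ent S - ent (X i)) = m * k"
  using m by (simp add: sum_subtractf k_def multidist_def S_def field_simps)

lemma S_split:
  assumes "i < m"
  shows "S = X i + (\<Sum>j\<in>{..<m} - {i}. X j)"
  unfolding S_def using assms by (intro sum.remove) auto

lemma fin_compl: "finite (set_pmf (\<Sum>j\<in>{..<m} - {i}. X j))"
  using fin by (intro finite_set_sum_pmf) auto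

lemma ent_X_le: "i < m \<Longrightarrow> ent (X i) \<le> ent S"
  using ent_le_add[OF fin fin_compl] by (simp add: S_split[of i])

lemma multidist_nonneg: "0 \<le> k"
proof -
  have "0 \<le> m * k" unfolding sum_ent_gap[symmetric] by (intro sum_nonneg) (use ent_X_le in auto)
  then show ?thesis using m by (simp add: zero_le_mult_iff)
qed

text \<open>Two uses of \<open>kvm\<close> with \<open>S = X i + C\<close> give a bound for each
  \<open>i\<close> that involves \<open>X i\<close> and one further summand contained in
  \<open>C\<close>; averaging over \<open>i\<close> turns the loss into
  \<open>2 * k\<close>.\<close>

lemma ent_SS: "ent (S + S) \<le> ent S + 2 * k"
proof -
  obtain n where n: "m = Suc n" "n \<ge> 1" using m by (cases m) auto
  \<comment> \<open>The cyclic successor: it differs from \<open>i\<close> because \<open>m\<close>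
    is at least 2, and as a permutation it makes every entropy occur exactly twice in the sum over
    \<open>i\<close>.\<close>
  define \<sigma> where "\<sigma> i = (if i = n then 0 else Suc i)" for i
  have pair: "ent (S + S) + ent (X i) + ent (X (\<sigma> i)) \<le> 3 * ent S" if i: "i < m" for i
  proof -
    define C where "C = (\<Sum>j\<in>{..<m} - {i}. X j)"
    have S: "S = X i + C" unfolding C_def by (rule S_split[OF i])
    have fC: "finite (set_pmf C)" unfolding C_def by (rule fin_compl)
    have "\<sigma> i \<in> {..<m} - {i}" using i n by (auto simp: \<sigma>_def)
    then have "C = X (\<sigma> i) + (\<Sum>j\<in>{..<m} - {i} - {\<sigma> i}. X j)"
      unfolding C_def by (intro sum.remove) auto
    moreover have "ent (X (\<sigma> i)) \<le> ent (X (\<sigma> i) + (\<Sum>j\<in>{..<m} - {i} - {\<sigma> i}. X j))"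
      using fin \<open>\<sigma> i \<in> _\<close> by (intro ent_le_add finite_set_sum_pmf) auto
    ultimately have 1: "ent (X (\<sigma> i)) \<le> ent C" by simp
    have 2: "ent (X i + X i + C) + ent C \<le> ent S + ent S"
      using kvm[OF fin[OF i] fin[OF i] fC] by (simp add: S)
    have 3: "ent (C + S + X i) + ent (X i) \<le> ent (C + X i) + ent (S + X i)"
      by (rule kvm[OF fC finS fin[OF i]])
    have "C + S + X i = S + S" "C + X i = S" "S + X i = X i + X i + C"
      by (simp_all add: S add_ac)
    then show ?thesis using 1 2 3 by simp
  qed
  have "(\<Sum>i<m. ent (S + S) + ent (X i) + ent (X (\<sigma> i))) \<le> (\<Sum>i<m. 3 * ent S)"
    by (intro sum_mono pair) auto
  moreover have "(\<Sum>i<m. ent (X (\<sigma> i))) = (\<Sum>i<m. ent (X i))"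
  proof -
    have "(\<Sum>i<m. ent (X (\<sigma> i))) = ent (X 0) + (\<Sum>i<n. ent (X (Suc i)))"
      unfolding n(1) by (simp add: \<sigma>_def)
    then show ?thesis unfolding n(1) by (simp only: sum.lessThan_Suc_shift)
  qed
  ultimately have "m * ent (S + S) + 2 * (\<Sum>i<m. ent (X i)) \<le> 3 * (m * ent S)"
    by (simp add: sum.distrib)
  moreover have "(\<Sum>i<m. ent (X i)) = m * ent S - m * k"
    using sum_ent_gap by (simp add: sum_subtractf)
  ultimately have "m * ent (S + S) \<le> m * (ent S + 2 * k)"
    by (simp add: algebra_simps)
  then show ?thesis using m by simp
qed

lemma ent_SmS: "ent (S + neg S) \<le> ent S + 4 * k"
  using ruzsa_triangle[of S S "neg S"] finS ent_SS ent_neg[of "S + S"] by (simp add: neg_add)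

lemma ent_pmf_add_mono:
  fixes \<mu> \<nu> \<mu>' \<nu>' :: "'g pmf"
  assumes "finite (set_pmf \<mu>)" "finite (set_pmf \<nu>)" "finite (set_pmf \<mu>')" "finite (set_pmf \<nu>')"
  shows "ent (\<mu> + \<nu>) \<le> ent ((\<mu> + \<mu>') + (\<nu> + \<nu>'))"
  using ent_le_add[of "\<mu> + \<nu>" "\<mu>' + \<nu>'"] assms by (simp add: add_ac)

lemma sum_S_split:
  assumes "finite J" "\<And>j. j \<in> J \<Longrightarrow> \<tau> j < m"
  shows "(\<Sum>j\<in>J. S) = (\<Sum>j\<in>J. X (\<tau> j)) + (\<Sum>j\<in>J. \<Sum>i\<in>{..<m} - {\<tau> j}. X i)"
  unfolding sum.distrib[symmetric] by (intro sum.cong refl S_split assms)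

text \<open>Completing every \<open>X (\<tau> j)\<close> and \<open>X i\<close> to a copy of
  \<open>S\<close> by fresh independent summands can only raise the entropy; after that
  \<open>kvm_sum\<close> and \<open>ent_SmS\<close> apply.\<close>

lemma ent_X_minus_sum_le:
  assumes "finite J" "\<And>j. j \<in> J \<Longrightarrow> \<tau> j < m" and i: "i < m"
  shows "ent (X i + neg (\<Sum>j\<in>J. X (\<tau> j))) \<le> ent S + 4 * card J * k"
proof -
  have "ent (X i + neg (\<Sum>j\<in>J. X (\<tau> j))) \<le> ent (X i + (\<Sum>j\<in>{..<m} - {i}. X j)
      + (neg (\<Sum>j\<in>J. X (\<tau> j)) + neg (\<Sum>j\<in>J. \<Sum>i\<in>{..<m} - {\<tau> j}. X i)))"
    using assms fin fin_compl by (intro ent_pmf_add_mono finite_set_sum_pmf finite_set_neg) auto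
  also have "\<dots> = ent (S + neg (\<Sum>j\<in>J. S))"
    unfolding S_split[OF i, symmetric] neg_add[symmetric]
    by (subst sum_S_split[symmetric]) (use assms in auto)
  also have "\<dots> \<le> ent S + (\<Sum>j\<in>J. ent (S + neg S) - ent S)"
    unfolding neg_sum using finS assms by (intro kvm_sum finite_set_neg)
  also have "\<dots> \<le> ent S + (\<Sum>j\<in>J. 4 * k)"
    using ent_SmS by (intro add_left_mono sum_mono) auto
  finally show ?thesis by simp
qed

lemma ent_X_minus_X_le: "i < m \<Longrightarrow> ent (X i + neg (X i)) \<le> ent S + 4 * k"
  using ent_X_minus_sum_le[of "{0}" "\<lambda>_. i" i] by simp

text \<open>Each unit of the multiple costs \<open>8 * k\<close>, which is twice the cost
  \<open>4 * k\<close> of \<open>S + neg S\<close>.\<close>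

lemma ent_S_minus_smul: "ent (S + neg (map_pmf (smul j) S)) \<le> ent S + 8 * j * k"
proof (induction j)
  case 0
  have "smul 0 = (\<lambda>_ :: 'g. 0)" by (simp add: fun_eq_iff)
  then have *: "map_pmf (smul 0) S = 0" by (simp add: zero_pmf_def)
  show ?case unfolding * by simp
next
  case (Suc j)
  have "ent (neg S + neg S + S) + ent S \<le> ent (neg S + S) + ent (neg S + S)"
    using finS by (intro kvm) auto
  then have "ent (S + neg S + neg S) \<le> ent S + 8 * k"
    using ent_SmS by (simp add: add_ac)
  moreover have "ent (S + neg (map_pmf (smul (Suc j)) S)) + ent S
      \<le> ent (S + neg S + neg S) + ent (S + neg (map_pmf (smul j) S))"
    by (rule ent_diff_smul_Suc[OF finS finS finS])
  ultimately show ?case using Suc.IH by (simp add: algebra_simps)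
qed

text \<open>The subtracted law is that of the column-weighted sum of the array, see
  \<open>law_wsum\<close>; so this is the distance cost of the competitor in \<open>endgame\<close>.
  The square comes from summing \<open>8 * j\<close> over \<open>j < m\<close>.\<close>

lemma ent_X_minus_weighted_le:
  assumes i: "i < m"
  shows "ent (X i + neg (\<Sum>j<m. map_pmf (smul j) S)) \<le> ent S + 4 * (real m)\<^sup>2 * k"
proof -
  have "ent (X i + neg (\<Sum>j<m. map_pmf (smul j) S))
      \<le> ent (X i + (\<Sum>j\<in>{..<m} - {i}. X j) + (neg (\<Sum>j<m. map_pmf (smul j) S) + 0))"
    using fin i fin_compl finS
    by (intro ent_pmf_add_mono finite_set_neg finite_set_sum_pmf) (auto simp: zero_pmf_def)
  also have "\<dots> = ent (S + (\<Sum>j<m. neg (map_pmf (smul j) S)))"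
    unfolding S_split[OF i, symmetric] by (simp add: neg_sum)
  also have "\<dots> \<le> ent S + (\<Sum>j<m. ent (S + neg (map_pmf (smul j) S)) - ent S)"
    using finS by (intro kvm_sum finite_set_neg) auto
  also have "\<dots> \<le> ent S + (\<Sum>j<m. 8 * real j * k)"
    using ent_S_minus_smul by (intro add_left_mono sum_mono) (auto simp: algebra_simps)
  finally have *: "ent (X i + neg (\<Sum>j<m. map_pmf (smul j) S)) \<le> ent S + (\<Sum>j<m. 8 * real j * k)" .
  have "(\<Sum>j<m. 8 * real j * k) = 8 * k * (\<Sum>j<m. real j)"
    unfolding sum_distrib_left by (intro sum.cong) auto
  also have "(\<Sum>j<m. real j) = real m * (real m - 1) / 2"
    by (induction m) (auto simp: field_simps)
  finally have "(\<Sum>j<m. 8 * real j * k) = 4 * (real m)\<^sup>2 * k - 4 * real m * k"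
    by (simp add: algebra_simps power2_eq_square)
  moreover have "0 \<le> real m * k" using multidist_nonneg by simp
  ultimately show ?thesis using * by linarith
qed

end

section \<open>Averaging over conditional distributions\<close>

text \<open>Concavity of entropy, in the form that conditioning on \<open>y\<close> does not raise
  the entropy of \<open>x\<close>.\<close>

lemma ent_kernel_concave:
  assumes "finite (set_pmf \<nu>)" "\<And>y. y \<in> set_pmf \<nu> \<Longrightarrow> finite (set_pmf (\<kappa> y))"
  shows "expect \<nu> (\<lambda>y. ent (\<kappa> y)) \<le> ent (bind_pmf \<nu> \<kappa>)"
proof -
  let ?J = "bind_pmf \<nu> (\<lambda>y. map_pmf (\<lambda>x. (x, y)) (\<kappa> y))"
  have fin: "finite (set_pmf ?J)" using assms by auto
  have "ent ?J = rv_ent ?J (\<lambda>w. (fst w, snd w))"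
    by (simp add: rv_ent_def)
  also have "\<dots> \<le> rv_ent ?J fst + rv_ent ?J snd"
    by (rule rv_ent_Pair_le[OF fin])
  also have "rv_ent ?J fst = ent (bind_pmf \<nu> \<kappa>)"
    by (simp add: rv_ent_def map_bind_pmf map_pmf_comp)
  also have "rv_ent ?J snd = ent \<nu>"
    by (simp add: rv_ent_def map_bind_pmf map_pmf_comp bind_return_pmf')
  finally show ?thesis using ent_kernel[of \<nu> \<kappa>] assms by simp
qed

lemma bind_plus_pmf: "bind_pmf \<nu> (\<lambda>y. \<mu> + \<kappa> y) = \<mu> + bind_pmf \<nu> \<kappa>"
  unfolding plus_pmf_def pair_pmf_def map_bind_pmf bind_assoc_pmf
  by (subst bind_commute_pmf) simp

lemma neg_bind_pmf: "neg (bind_pmf \<nu> \<kappa>) = bind_pmf \<nu> (\<lambda>y. neg (\<kappa> y))"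
  by (simp add: neg_def map_bind_pmf)

lemma bind_kern: "bind_pmf (map_pmf snd J) (kern J) = map_pmf fst J"
proof -
  have "map_pmf fst J = map_pmf fst (bind_pmf (map_pmf snd J) (\<lambda>y. map_pmf (\<lambda>x. (x, y)) (kern J y)))"
    by (subst kern_disint[of J]) simp
  then show ?thesis by (simp add: map_bind_pmf map_pmf_comp)
qed

lemma finite_set_kern:
  assumes "finite (set_pmf J)" "y \<in> set_pmf (map_pmf snd J)"
  shows "finite (set_pmf (kern J y))" "set_pmf (kern J y) \<subseteq> fst ` set_pmf J"
proof -
  have "set_pmf (kern J y) = {x. (x, y) \<in> set_pmf J}" using assms by (intro set_kern) auto
  then show *: "set_pmf (kern J y) \<subseteq> fst ` set_pmf J" by force
  show "finite (set_pmf (kern J y))" by (rule finite_subset[OF *]) (use assms in auto)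
qed

lemma expectation_ent_kern:
  assumes "finite (set_pmf J)"
  shows "expect (map_pmf snd J) (\<lambda>y. ent (kern J y)) = ent J - ent (map_pmf snd J)"
proof -
  have "ent J = ent (bind_pmf (map_pmf snd J) (\<lambda>y. map_pmf (\<lambda>x. (x, y)) (kern J y)))"
    by (subst kern_disint[of J]) simp
  also have "\<dots> = ent (map_pmf snd J) + expect (map_pmf snd J) (\<lambda>y. ent (kern J y))"
    using assms finite_set_kern(1)[OF assms] by (intro ent_kernel) auto
  finally show ?thesis by simp
qed

lemma expectation_ent_plus_kern_le:
  fixes J :: "('g::ab_group_add \<times> 'b) pmf"
  assumes fin: "finite (set_pmf J)" "finite (set_pmf \<mu>)"
  shows "expect (map_pmf snd J) (\<lambda>y. ent (\<mu> + neg (kern J y))) \<le> ent (\<mu> + neg (map_pmf fst J))"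
proof -
  have "expect (map_pmf snd J) (\<lambda>y. ent (\<mu> + neg (kern J y)))
      \<le> ent (bind_pmf (map_pmf snd J) (\<lambda>y. \<mu> + neg (kern J y)))"
    using fin finite_set_kern(1)[OF fin(1)] by (intro ent_kernel_concave) auto
  also have "bind_pmf (map_pmf snd J) (\<lambda>y. \<mu> + neg (kern J y)) = \<mu> + neg (map_pmf fst J)"
    unfolding bind_plus_pmf neg_bind_pmf[symmetric] bind_kern ..
  finally show ?thesis .
qed

lemma integrable_finite_pmf [simp]: "finite (set_pmf p) \<Longrightarrow> integrable (measure_pmf p) (f :: _ \<Rightarrow> real)"
  by (rule integrable_measure_pmf_finite)

text \<open>Given the second coordinates, the first ones remain independent, with laws
  \<open>kern (J s) (y s)\<close>. The default \<open>(0, d)\<close> gives the vector of second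
  coordinates the value \<open>d\<close> outside \<open>A\<close>, as in the product law of
  \<open>y\<close>.\<close>

lemma law_sum_kern:
  fixes J :: "'i \<Rightarrow> ('g::ab_group_add \<times> 'b) pmf"
  assumes A: "finite A"
  shows "map_pmf (\<lambda>w. (\<Sum>s\<in>A. fst (w s), \<lambda>s. snd (w s))) (Pi_pmf A (0, d) J)
    = bind_pmf (Pi_pmf A d (\<lambda>s. map_pmf snd (J s))) (\<lambda>y. map_pmf (\<lambda>x. (x, y)) (\<Sum>s\<in>A. kern (J s) (y s)))"
    (is "map_pmf ?F _ = _")
proof -
  let ?K = "\<lambda>y s. map_pmf (\<lambda>x. (x, y s)) (kern (J s) (y s))"
  have "Pi_pmf A (0, d) J = Pi_pmf A (0, d)
      (\<lambda>s. bind_pmf (map_pmf snd (J s)) (\<lambda>y. map_pmf (\<lambda>x. (x, y)) (kern (J s) y)))"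
    by (intro Pi_pmf_cong refl kern_disint)
  also have "\<dots> = bind_pmf (Pi_pmf A d (\<lambda>s. map_pmf snd (J s))) (\<lambda>y. Pi_pmf A (0, d) (?K y))"
    by (rule Pi_pmf_bind[OF A])
  finally have "map_pmf ?F (Pi_pmf A (0, d) J)
      = bind_pmf (Pi_pmf A d (\<lambda>s. map_pmf snd (J s))) (\<lambda>y. map_pmf ?F (Pi_pmf A (0, d) (?K y)))"
    by (simp add: map_bind_pmf)
  also have "\<dots> = bind_pmf (Pi_pmf A d (\<lambda>s. map_pmf snd (J s))) (\<lambda>y. map_pmf (\<lambda>x. (x, y)) (\<Sum>s\<in>A. kern (J s) (y s)))"
  proof (rule bind_pmf_cong[OF refl])
    fix y assume "y \<in> set_pmf (Pi_pmf A d (\<lambda>s. map_pmf snd (J s)))"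
    then have y: "y s = d" if "s \<notin> A" for s
      using that A by (auto simp: set_Pi_pmf PiE_dflt_def)
    have "map_pmf ?F (Pi_pmf A (0, d) (?K y)) = map_pmf (\<lambda>w. (\<Sum>s\<in>A. (fst \<circ> w) s, y)) (Pi_pmf A (0, d) (?K y))"
    proof (rule map_pmf_cong[OF refl])
      fix w assume "w \<in> set_pmf (Pi_pmf A (0, d) (?K y))"
      then have w: "w \<in> PiE_dflt A (0, d) (set_pmf \<circ> ?K y)" using A by (simp add: set_Pi_pmf)
      have "snd (w s) = y s" for s
        using w y by (cases "s \<in> A") (auto simp: PiE_dflt_def)
      then show "?F w = (\<Sum>s\<in>A. (fst \<circ> w) s, y)" by auto
    qed
    also have "\<dots> = map_pmf (\<lambda>x. (x, y)) (map_pmf (\<lambda>f. \<Sum>s\<in>A. f s) (map_pmf (\<lambda>w. fst \<circ> w) (Pi_pmf A (0, d) (?K y))))"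
      by (simp add: map_pmf_comp)
    also have "map_pmf (\<lambda>w. fst \<circ> w) (Pi_pmf A (0, d) (?K y)) = Pi_pmf A 0 (\<lambda>s. kern (J s) (y s))"
      by (subst Pi_pmf_map[OF A, symmetric, where dflt' = 0]) (auto simp: map_pmf_comp)
    also have "map_pmf (\<lambda>f. \<Sum>s\<in>A. f s) (Pi_pmf A 0 (\<lambda>s. kern (J s) (y s))) = (\<Sum>s\<in>A. kern (J s) (y s))"
      by (rule sum_Pi_pmf[OF A]) auto
    finally show "map_pmf ?F (Pi_pmf A (0, d) (?K y)) = map_pmf (\<lambda>x. (x, y)) (\<Sum>s\<in>A. kern (J s) (y s))" .
  qed
  finally show ?thesis .
qed

text \<open>The hypothesis holds for the conditioned tuple at every value of the second coordinates,
  and is averaged over these values. Entropies become conditional entropies exactly; only the cross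
  terms with \<open>Z s\<close> need concavity.\<close>

lemma kernel_average:
  fixes J :: "nat \<Rightarrow> ('g::ab_group_add \<times> 'b) pmf" and d :: 'b
  assumes m: "m > 0" and \<eta>: "0 \<le> \<eta>"
    and fin: "\<And>s. s < m \<Longrightarrow> finite (set_pmf (J s))" "\<And>s. s < m \<Longrightarrow> finite (set_pmf (Z s))"
    and hyp: "\<And>Y. (\<And>s. s < m \<Longrightarrow> set_pmf (Y s) \<subseteq> fst ` set_pmf (J s)) \<Longrightarrow>
        c \<le> multidist m Y + \<eta> * (\<Sum>s<m. rd (Z s) (Y s))"
  defines "p \<equiv> Pi_pmf {..<m} (0, d) J"
  shows "c \<le> rv_ent p (\<lambda>w. (\<Sum>s<m. fst (w s), \<lambda>s. snd (w s))) - rv_ent p (\<lambda>w s. snd (w s))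
      - (\<Sum>s<m. ent (J s) - ent (map_pmf snd (J s))) / m
      + \<eta> * (\<Sum>s<m. ent (Z s + neg (map_pmf fst (J s))) - ent (Z s) / 2 - (ent (J s) - ent (map_pmf snd (J s))) / 2)"
proof -
  define N where "N = Pi_pmf {..<m} d (\<lambda>s. map_pmf snd (J s))"
  define \<kappa> where "\<kappa> y s = kern (J s) (y s)" for y s
  have finN: "finite (set_pmf N)" unfolding N_def using fin by (intro finite_set_Pi_pmf) auto
  have N_mem: "y s \<in> set_pmf (map_pmf snd (J s))" if "y \<in> set_pmf N" "s < m" for y s
    using that unfolding N_def by (auto simp: set_Pi_pmf PiE_dflt_def)
  have fin\<kappa>: "finite (set_pmf (\<kappa> y s))" if "y \<in> set_pmf N" "s < m" for y s
    unfolding \<kappa>_def by (intro finite_set_kern fin N_mem that)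
  have comp: "expect N (\<lambda>y. f (y s)) = expect (map_pmf snd (J s)) f"
    if "s < m" for f :: "'b \<Rightarrow> real" and s
  proof -
    have "map_pmf (\<lambda>y. y s) N = map_pmf snd (J s)"
      unfolding N_def using that by (subst Pi_pmf_component) auto
    then show ?thesis by (metis integral_map_pmf)
  qed
  have eJ: "expect N (\<lambda>y. ent (\<kappa> y s)) = ent (J s) - ent (map_pmf snd (J s))" if "s < m" for s
    unfolding \<kappa>_def comp[OF that, of "\<lambda>v. ent (kern (J s) v)"] by (rule expectation_ent_kern[OF fin(1)[OF that]])
  have eZ: "expect N (\<lambda>y. ent (Z s + neg (\<kappa> y s))) \<le> ent (Z s + neg (map_pmf fst (J s)))"
    if "s < m" for s
    unfolding \<kappa>_def comp[OF that, of "\<lambda>v. ent (Z s + neg (kern (J s) v))"]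
    by (rule expectation_ent_plus_kern_le) (use fin that in auto)
  have law: "map_pmf (\<lambda>w. (\<Sum>s<m. fst (w s), \<lambda>s. snd (w s))) p
      = bind_pmf N (\<lambda>y. map_pmf (\<lambda>x. (x, y)) (\<Sum>s<m. \<kappa> y s))"
    unfolding p_def N_def \<kappa>_def by (rule law_sum_kern) simp
  have "rv_ent p (\<lambda>w. (\<Sum>s<m. fst (w s), \<lambda>s. snd (w s)))
      = ent N + expect N (\<lambda>y. ent (\<Sum>s<m. \<kappa> y s))"
    unfolding rv_ent_def law using finN fin\<kappa> by (intro ent_kernel finite_set_sum_pmf) auto
  moreover have "rv_ent p (\<lambda>w s. snd (w s)) = ent N"
  proof -
    have "map_pmf (\<lambda>w s. snd (w s)) p = map_pmf snd (map_pmf (\<lambda>w. (\<Sum>s<m. fst (w s), \<lambda>s. snd (w s))) p)"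
      by (simp add: map_pmf_comp)
    also have "\<dots> = N" unfolding law by (simp add: map_bind_pmf map_pmf_comp bind_return_pmf')
    finally show ?thesis by (simp add: rv_ent_def)
  qed
  ultimately have E: "expect N (\<lambda>y. ent (\<Sum>s<m. \<kappa> y s))
      = rv_ent p (\<lambda>w. (\<Sum>s<m. fst (w s), \<lambda>s. snd (w s))) - rv_ent p (\<lambda>w s. snd (w s))" by simp
  have "expect N (\<lambda>y. c) \<le> expect N (\<lambda>y. multidist m (\<kappa> y) + \<eta> * (\<Sum>s<m. rd (Z s) (\<kappa> y s)))"
  proof (rule integral_mono_AE)
    show "AE y in measure_pmf N. c \<le> multidist m (\<kappa> y) + \<eta> * (\<Sum>s<m. rd (Z s) (\<kappa> y s))"
    proof (rule AE_pmfI)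
      fix y assume "y \<in> set_pmf N"
      then show "c \<le> multidist m (\<kappa> y) + \<eta> * (\<Sum>s<m. rd (Z s) (\<kappa> y s))"
        unfolding \<kappa>_def by (intro hyp finite_set_kern fin N_mem)
    qed
  qed (use finN in auto)
  also have "\<dots> = expect N (\<lambda>y. ent (\<Sum>s<m. \<kappa> y s))
      - (\<Sum>s<m. expect N (\<lambda>y. ent (\<kappa> y s))) / m
      + \<eta> * (\<Sum>s<m. expect N (\<lambda>y. ent (Z s + neg (\<kappa> y s))) - ent (Z s) / 2
          - expect N (\<lambda>y. ent (\<kappa> y s)) / 2)"
    using finN by (simp add: multidist_def rd_def add_divide_distrib diff_diff_eq)
  also have "\<dots> \<le> expect N (\<lambda>y. ent (\<Sum>s<m. \<kappa> y s))
      - (\<Sum>s<m. ent (J s) - ent (map_pmf snd (J s))) / m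
      + \<eta> * (\<Sum>s<m. ent (Z s + neg (map_pmf fst (J s))) - ent (Z s) / 2 - (ent (J s) - ent (map_pmf snd (J s))) / 2)"
    using \<eta> by (intro add_mono mult_left_mono sum_mono diff_mono order.refl) (auto simp: eJ eZ intro!: divide_right_mono sum_mono)
  finally show ?thesis unfolding E by simp
qed

text \<open>The multidistance is symmetric in its tuple, so the reference tuple may be permuted.
  This serves the columns of a reindexed array, which contain the \<open>X i\<close> in another
  order.\<close>

lemma multidist_permute:
  fixes X Y :: "nat \<Rightarrow> 'g::ab_group_add pmf"
  assumes \<pi>: "bij_betw \<pi> {..<m} {..<m}" and hyp: "\<And>Y. (\<And>i. i < m \<Longrightarrow> set_pmf (Y i) \<subseteq> B) \<Longrightarrow>
        c \<le> multidist m Y + \<eta> * (\<Sum>i<m. rd (X i) (Y i))"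
    and Y: "\<And>i. i < m \<Longrightarrow> set_pmf (Y i) \<subseteq> B"
  shows "c \<le> multidist m Y + \<eta> * (\<Sum>i<m. rd (X (\<pi> i)) (Y i))"
proof -
  define \<pi>' where "\<pi>' = the_inv_into {..<m} \<pi>"
  have b: "bij_betw \<pi>' {..<m} {..<m}" unfolding \<pi>'_def by (rule bij_betw_the_inv_into[OF \<pi>])
  have inv: "\<pi> (\<pi>' i) = i" "\<pi>' i < m" if "i < m" for i
    using that \<pi> b f_the_inv_into_f_bij_betw[OF \<pi>] by (auto simp: \<pi>'_def dest: bij_betwE)
  have 1: "(\<Sum>i<m. F (Y (\<pi>' i))) = (\<Sum>i<m. F (Y i))" for F :: "'g pmf \<Rightarrow> real"
    by (rule sum.reindex_bij_betw[OF b])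
  have 2: "(\<Sum>i<m. Y (\<pi>' i)) = (\<Sum>i<m. Y i)"
    by (rule sum.reindex_bij_betw[OF b])
  have "(\<Sum>i<m. rd (X i) (Y (\<pi>' i))) = (\<Sum>i<m. rd (X (\<pi> (\<pi>' i))) (Y (\<pi>' i)))"
    by (intro sum.cong refl) (use inv in auto)
  also have "\<dots> = (\<Sum>i<m. rd (X (\<pi> i)) (Y i))"
    by (rule sum.reindex_bij_betw[OF b])
  finally have 3: "(\<Sum>i<m. rd (X i) (Y (\<pi>' i))) = (\<Sum>i<m. rd (X (\<pi> i)) (Y i))" .
  show ?thesis
    using hyp[of "\<lambda>i. Y (\<pi>' i)"] Y inv 1[of ent] 2 3 by (simp add: multidist_def)
qed

section \<open>The information inequality for an array of independent variables\<close>

lemma expectation_ent_map_kern: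
  assumes "finite (set_pmf J)"
  shows "expect (map_pmf snd J) (\<lambda>y. ent (map_pmf f (kern J y)))
    = ent (map_pmf (\<lambda>z. (f (fst z), snd z)) J) - ent (map_pmf snd J)"
proof -
  have "map_pmf (\<lambda>z. (f (fst z), snd z)) J
      = map_pmf (\<lambda>z. (f (fst z), snd z)) (bind_pmf (map_pmf snd J) (\<lambda>y. map_pmf (\<lambda>x. (x, y)) (kern J y)))"
    by (subst kern_disint[of J]) simp
  also have "\<dots> = bind_pmf (map_pmf snd J) (\<lambda>y. map_pmf (\<lambda>x. (x, y)) (map_pmf f (kern J y)))"
    by (simp add: map_bind_pmf map_pmf_comp)
  also have "ent \<dots> = ent (map_pmf snd J) + expect (map_pmf snd J) (\<lambda>y. ent (map_pmf f (kern J y)))"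
    using assms finite_set_kern(1)[OF assms] by (intro ent_kernel) auto
  finally show ?thesis by simp
qed

text \<open>Both sides are conditional mutual informations given \<open>W\<close>: on the right
  \<open>R\<close> and \<open>C\<close> each determine \<open>W\<close>. By submodularity
  \<open>R\<close> is replaced by its function \<open>Z\<close>, and thereafter \<open>C\<close> by
  \<open>Z'\<close>.\<close>

lemma data_processing:
  assumes fin: "finite (set_pmf p)"
    and R: "det p R Z" "det p R W" and C: "det p C Z'" "det p C W"
  shows "rv_ent p (\<lambda>w. (Z w, W w)) + rv_ent p (\<lambda>w. (Z' w, W w)) - rv_ent p (\<lambda>w. (Z w, Z' w, W w)) - rv_ent p W
    \<le> rv_ent p C + rv_ent p R - rv_ent p (\<lambda>w. (C w, R w)) - rv_ent p W"
proof -
  have Rp: "det p R (\<lambda>w. (Z w, W w))" using R unfolding det_def prod.inject by blast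
  have Cp: "det p C (\<lambda>w. (Z' w, W w))" using C unfolding det_def prod.inject by blast
  have ZC: "det p (\<lambda>w. (Z w, C w)) (\<lambda>w. (Z w, W w))"
    using C(2) unfolding det_def prod.inject by blast
  have "rv_ent p (\<lambda>w. (C w, R w)) + rv_ent p (\<lambda>w. (Z w, W w)) \<le> rv_ent p R + rv_ent p (\<lambda>w. (Z w, C w))"
    by (rule submod[OF fin Rp ZC]) (auto intro: detI)
  moreover have "rv_ent p (\<lambda>w. (Z w, C w)) + rv_ent p (\<lambda>w. (Z' w, W w)) \<le> rv_ent p C + rv_ent p (\<lambda>w. (Z w, Z' w, W w))"
    by (rule submod[OF fin Cp]) (auto intro: detI)
  ultimately show ?thesis by linarith
qed

text \<open>Two copies of \<open>(A, B)\<close> that are conditionally independent given \<open>A + B\<close> and \<open>W\<close> satisfy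
  \<open>A\<^sub>1 - B\<^sub>2 = A\<^sub>2 - B\<^sub>1\<close>.\<close>

lemma entropic_bsg:
  fixes A B :: "'w \<Rightarrow> 'g::ab_group_add" and W :: "'w \<Rightarrow> 'b"
  assumes fin: "finite (set_pmf p)"
  defines "J \<equiv> map_pmf (\<lambda>w. ((A w, B w), (A w + B w, W w))) p"
  shows "expect (map_pmf snd J) (\<lambda>y. ent (map_pmf fst (kern J y) + neg (map_pmf snd (kern J y))))
    \<le> 2 * rv_ent p (\<lambda>w. (A w, W w)) + 2 * rv_ent p (\<lambda>w. (B w, W w)) - 3 * rv_ent p W
      + rv_ent p (\<lambda>w. (A w + B w, W w)) - 2 * rv_ent p (\<lambda>w. (A w, B w, W w))"
proof -
  define \<nu> where "\<nu> = map_pmf snd J"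
  \<comment> \<open>The coupling: \<open>y\<close> is the common value of \<open>(A + B, W)\<close>,
    and the two pairs are drawn independently from \<open>kern J y\<close>.\<close>
  define q where "q = bind_pmf \<nu> (\<lambda>y. map_pmf (\<lambda>x. (x, y)) (pair_pmf (kern J y) (kern J y)))"
  have finJ: "finite (set_pmf J)" using fin by (simp add: J_def)
  have fin\<nu>: "finite (set_pmf \<nu>)" using finJ by (simp add: \<nu>_def)
  have fink: "finite (set_pmf (kern J y))" if "y \<in> set_pmf \<nu>" for y
    using that finite_set_kern(1)[OF finJ] by (simp add: \<nu>_def)
  have finq: "finite (set_pmf q)" unfolding q_def using fin\<nu> fink by auto
  have disint: "bind_pmf \<nu> (\<lambda>y. map_pmf (\<lambda>x. (x, y)) (kern J y)) = J"
    unfolding \<nu>_def by (rule kern_disint[symmetric])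
  have "map_pmf (\<lambda>w. (fst (fst w), snd w)) q = bind_pmf \<nu> (\<lambda>y. map_pmf (\<lambda>x. (x, y)) (map_pmf fst (pair_pmf (kern J y) (kern J y))))"
    by (simp add: q_def map_bind_pmf map_pmf_comp)
  then have m1: "map_pmf (\<lambda>w. (fst (fst w), snd w)) q = J"
    by (simp only: map_fst_pair_pmf disint)
  have "map_pmf (\<lambda>w. (snd (fst w), snd w)) q = bind_pmf \<nu> (\<lambda>y. map_pmf (\<lambda>x. (x, y)) (map_pmf snd (pair_pmf (kern J y) (kern J y))))"
    by (simp add: q_def map_bind_pmf map_pmf_comp)
  then have m2: "map_pmf (\<lambda>w. (snd (fst w), snd w)) q = J"
    by (simp only: map_snd_pair_pmf disint)
  have r1: "rv_ent q (\<lambda>w. F (fst (fst w), snd w)) = rv_ent J F" for F :: "_ \<Rightarrow> 'c"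
    by (subst m1[symmetric]) (simp add: rv_ent_map)
  have r2: "rv_ent q (\<lambda>w. F (snd (fst w), snd w)) = rv_ent J F" for F :: "_ \<Rightarrow> 'c"
    by (subst m2[symmetric]) (simp add: rv_ent_map)
  let ?a1 = "\<lambda>w :: (('g \<times> 'g) \<times> ('g \<times> 'g)) \<times> ('g \<times> 'b). fst (fst (fst w))"
  let ?b1 = "\<lambda>w :: (('g \<times> 'g) \<times> ('g \<times> 'g)) \<times> ('g \<times> 'b). snd (fst (fst w))"
  let ?a2 = "\<lambda>w :: (('g \<times> 'g) \<times> ('g \<times> 'g)) \<times> ('g \<times> 'b). fst (snd (fst w))"
  let ?b2 = "\<lambda>w :: (('g \<times> 'g) \<times> ('g \<times> 'g)) \<times> ('g \<times> 'b). snd (snd (fst w))"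
  let ?W = "\<lambda>w :: (('g \<times> 'g) \<times> ('g \<times> 'g)) \<times> ('g \<times> 'b). snd (snd w)"
  have supp: "fst (snd w) = ?a1 w + ?b1 w" "fst (snd w) = ?a2 w + ?b2 w" if "w \<in> set_pmf q" for w
  proof -
    have 1: "(fst (fst w), snd w) \<in> set_pmf J"
      unfolding m1[symmetric] set_map_pmf using that by (rule image_eqI[OF refl])
    have "(snd (fst w), snd w) \<in> set_pmf J"
      unfolding m2[symmetric] set_map_pmf using that by (rule image_eqI[OF refl])
    with 1 show "fst (snd w) = ?a1 w + ?b1 w" "fst (snd w) = ?a2 w + ?b2 w"
      by (auto simp: J_def)
  qed
  \<comment> \<open>The triples \<open>(a1, b2, W)\<close> and \<open>(a2, b1, W)\<close> both
    determine the difference \<open>a1 - b2\<close>, and together they determine the whole sample,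
    the common sum being \<open>a1 + b1\<close>.\<close>
  have "rv_ent q (\<lambda>w. w) + rv_ent q (\<lambda>w. (?a1 w - ?b2 w, ?W w))
      \<le> rv_ent q (\<lambda>w. (?a1 w, ?b2 w, ?W w)) + rv_ent q (\<lambda>w. (?a2 w, ?b1 w, ?W w))"
  proof (intro submod[OF finq] detI)
    fix v w assume vw: "v \<in> set_pmf q" "w \<in> set_pmf q"
    show "(?a1 v - ?b2 v, ?W v) = (?a1 w - ?b2 w, ?W w)" if "(?a2 v, ?b1 v, ?W v) = (?a2 w, ?b1 w, ?W w)"
    proof -
      have "?a1 u - ?b2 u = ?a2 u - ?b1 u" if "u \<in> set_pmf q" for u
        using supp[OF that] by (simp add: algebra_simps)
      then show ?thesis using that vw by simp
    qed
    assume "((?a1 v, ?b2 v, ?W v), ?a2 v, ?b1 v, ?W v) = ((?a1 w, ?b2 w, ?W w), ?a2 w, ?b1 w, ?W w)"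
    then show "v = w" using supp(1)[OF vw(1)] supp(1)[OF vw(2)] by (simp add: prod_eq_iff)
  qed auto
  moreover have "rv_ent q (\<lambda>w. (?a1 w, ?b2 w, ?W w)) + rv_ent q ?W
      \<le> rv_ent q (\<lambda>w. (?a1 w, ?W w)) + rv_ent q (\<lambda>w. (?b2 w, ?W w))"
    by (intro submod[OF finq] detI) auto
  moreover have "rv_ent q (\<lambda>w. (?a2 w, ?b1 w, ?W w)) + rv_ent q ?W
      \<le> rv_ent q (\<lambda>w. (?a2 w, ?W w)) + rv_ent q (\<lambda>w. (?b1 w, ?W w))"
    by (intro submod[OF finq] detI) auto
  \<comment> \<open>Conditioning on the sum in addition to \<open>W\<close> does not raise the
    entropy of the difference; given \<open>y\<close>, the variables \<open>a1\<close> and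
    \<open>b2\<close> are independent.\<close>
  moreover have "rv_ent q (\<lambda>w. (?a1 w - ?b2 w, snd w)) + rv_ent q ?W
      \<le> rv_ent q (\<lambda>w. (?a1 w - ?b2 w, ?W w)) + rv_ent q snd"
    by (intro submod[OF finq] detI) (auto simp: prod_eq_iff)
  moreover have "rv_ent q (\<lambda>w. (?a1 w - ?b2 w, snd w))
      = ent \<nu> + expect \<nu> (\<lambda>y. ent (map_pmf fst (kern J y) + neg (map_pmf snd (kern J y))))"
  proof -
    have "map_pmf (\<lambda>w. (?a1 w - ?b2 w, snd w)) q
        = bind_pmf \<nu> (\<lambda>y. map_pmf (\<lambda>x. (x, y)) (map_pmf fst (kern J y) + neg (map_pmf snd (kern J y))))"
      by (simp add: q_def map_bind_pmf map_pmf_comp plus_pmf_def neg_def pair_map_pmf1 pair_map_pmf2)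
    then show ?thesis unfolding rv_ent_def using fin\<nu> fink by (simp add: ent_kernel)
  qed
  moreover have "rv_ent q (\<lambda>w. w) = 2 * rv_ent p (\<lambda>w. (A w, B w, W w)) - rv_ent p (\<lambda>w. (A w + B w, W w))"
  proof -
    have "rv_ent q (\<lambda>w. w) = ent \<nu> + expect \<nu> (\<lambda>y. 2 * ent (kern J y))"
      unfolding rv_ent_def q_def using fin\<nu> fink
      by (simp add: ent_kernel ent_pair expectation_finite mult_2[symmetric] sum_distrib_left mult.left_commute)
    also have "\<dots> = 2 * ent J - ent \<nu>"
      using expectation_ent_kern[OF finJ] fin\<nu> by (simp add: \<nu>_def)
    also have "ent J = rv_ent p (\<lambda>w. ((A w, B w), (A w + B w, W w)))"
      by (simp add: rv_ent_def J_def)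
    also have "\<dots> = rv_ent p (\<lambda>w. (A w, B w, W w))"
      by (intro rv_ent_cong[OF fin] detI) auto
    also have "ent \<nu> = rv_ent p (\<lambda>w. (A w + B w, W w))"
      by (simp add: \<nu>_def J_def rv_ent_def map_pmf_comp)
    finally show ?thesis .
  qed
  moreover have "rv_ent q snd = ent \<nu>"
    using r1[of snd] by (simp add: \<nu>_def rv_ent_def)
  moreover have "rv_ent q ?W = rv_ent p W"
    using r1[of "\<lambda>z. snd (snd z)"] by (simp add: J_def rv_ent_map)
  moreover have "rv_ent q (\<lambda>w. (?a1 w, ?W w)) = rv_ent p (\<lambda>w. (A w, W w))"
    using r1[of "\<lambda>z. (fst (fst z), snd (snd z))"] by (simp add: J_def rv_ent_map)
  moreover have "rv_ent q (\<lambda>w. (?a2 w, ?W w)) = rv_ent p (\<lambda>w. (A w, W w))"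
    using r2[of "\<lambda>z. (fst (fst z), snd (snd z))"] by (simp add: J_def rv_ent_map)
  moreover have "rv_ent q (\<lambda>w. (?b1 w, ?W w)) = rv_ent p (\<lambda>w. (B w, W w))"
    using r1[of "\<lambda>z. (snd (fst z), snd (snd z))"] by (simp add: J_def rv_ent_map)
  moreover have "rv_ent q (\<lambda>w. (?b2 w, ?W w)) = rv_ent p (\<lambda>w. (B w, W w))"
    using r2[of "\<lambda>z. (snd (fst z), snd (snd z))"] by (simp add: J_def rv_ent_map)
  ultimately show ?thesis unfolding \<nu>_def[symmetric] by linarith
qed

lemma smul_add: "smul n (x + y) = smul n x + smul n y"
  by (simp add: smul_def sum.distrib)

lemma smul_sum: "smul n (\<Sum>i\<in>A. f i) = (\<Sum>i\<in>A. smul n (f i))"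
  unfolding smul_def by (rule sum.swap)

lemma smul_zero [simp]: "smul n 0 = 0"
  by (simp add: smul_def)

lemma map_pmf_hom_sum:
  fixes f :: "'g::ab_group_add \<Rightarrow> 'h::ab_group_add"
  assumes "\<And>x y. f (x + y) = f x + f y" "f 0 = 0"
  shows "map_pmf f (\<Sum>i\<in>A. \<mu> i) = (\<Sum>i\<in>A. map_pmf f (\<mu> i))"
proof (induction A rule: infinite_finite_induct)
  case (insert x A)
  then show ?case
    using assms(1) by (simp add: plus_pmf_def pair_map_pmf1 pair_map_pmf2 map_pmf_comp)
      (simp add: insert.IH[symmetric] pair_map_pmf1 pair_map_pmf2 map_pmf_comp)
qed (auto simp: zero_pmf_def assms)

lemma smul_add_left: "smul (a + b) x = smul a x + smul b x"
  by (induction a) (simp_all add: smul_Suc add_ac)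

lemma smul_mod:
  assumes "smul m x = 0"
  shows "smul (a mod m) x = smul a x"
proof -
  have 0: "smul (n * m) x = 0" for n
    by (induction n) (simp_all add: smul_add_left assms)
  have "smul a x = smul (a div m * m + a mod m) x" by simp
  also have "\<dots> = smul (a mod m) x" by (simp only: smul_add_left 0 add_0)
  finally show ?thesis ..
qed

definition sumset_pow :: "nat \<Rightarrow> 'g::ab_group_add set \<Rightarrow> 'g set" where
  "sumset_pow n A = {\<Sum>i<n. f i | f. \<forall>i<n. f i \<in> A}"

lemma sumset_powI:
  assumes "finite J" "\<And>j. j \<in> J \<Longrightarrow> f j \<in> A"
  shows "(\<Sum>j\<in>J. f j) \<in> sumset_pow (card J) A"
proof -
  obtain h where h: "bij_betw h {0..<card J} J" using ex_bij_betw_nat_finite[OF assms(1)] by blast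
  then have "(\<Sum>j\<in>J. f j) = (\<Sum>i<card J. f (h i))"
    by (simp add: sum.reindex_bij_betw[symmetric] atLeast0LessThan)
  moreover have "f (h i) \<in> A" if "i < card J" for i
    using that h assms(2) by (auto dest: bij_betwE)
  ultimately show ?thesis unfolding sumset_pow_def by (intro CollectI exI[of _ "\<lambda>i. f (h i)"]) auto
qed

lemma sumset_pow_1 [simp]: "sumset_pow (Suc 0) A = A"
  by (auto simp: sumset_pow_def)

section \<open>The \<open>m\<close> by \<open>m\<close> array, on the assumption that no tuple
  improves on \<open>X\<close>\<close>

context
  fixes m :: nat and X :: "nat \<Rightarrow> 'g::ab_group_add pmf" and A :: "'g set" and \<eta> :: real
    and I :: "(nat \<times> nat) set" and p :: "(nat \<times> nat \<Rightarrow> 'g) pmf" and S k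
  assumes m: "2 \<le> m" and fin: "\<And>i. i < m \<Longrightarrow> finite (set_pmf (X i))"
    and supp: "\<And>i. i < m \<Longrightarrow> set_pmf (X i) \<subseteq> A" and \<eta>: "0 \<le> \<eta>"
    and hyp: "\<And>n Y. 1 \<le> n \<Longrightarrow> n \<le> m ^ 3 \<Longrightarrow> (\<And>i. i < m \<Longrightarrow> set_pmf (Y i) \<subseteq> sumset_pow n A) \<Longrightarrow>
      (1 - \<eta>) * multidist m X \<le> multidist m Y + \<eta> * (\<Sum>i<m. rd (X i) (Y i))"
  defines "I \<equiv> {..<m} \<times> {..<m}" and "p \<equiv> Pi_pmf I 0 (\<lambda>x. X (fst x))"
    and "S \<equiv> \<Sum>i<m. X i" and "k \<equiv> multidist m X"
begin

lemma finI: "finite I"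
  by (simp add: I_def)

lemma finp: "finite (set_pmf p)"
  unfolding p_def using fin by (intro finite_set_Pi_pmf) (auto simp: I_def)

lemma supp_p: "w \<in> set_pmf p \<Longrightarrow> x \<in> I \<Longrightarrow> w x \<in> set_pmf (X (fst x))"
  unfolding p_def using finI by (cases x) (auto simp: set_Pi_pmf PiE_dflt_def)

lemma law_array:
  assumes "J \<subseteq> I" "inj_on \<phi> J" "\<phi> ` J \<subseteq> I"
  shows "map_pmf (\<lambda>w. \<Sum>x\<in>J. w (\<phi> x)) p = (\<Sum>x\<in>J. X (fst (\<phi> x)))"
proof -
  have "map_pmf (\<lambda>w. \<Sum>x\<in>J. w (\<phi> x)) p = map_pmf (\<lambda>w. \<Sum>y\<in>\<phi> ` J. w y) p"
    using assms by (simp add: sum.reindex)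
  also have "\<dots> = (\<Sum>y\<in>\<phi> ` J. X (fst y))"
    unfolding p_def by (rule sum_Pi_pmf[OF finI assms(3)])
  finally show ?thesis using assms by (simp add: sum.reindex)
qed

definition total :: "(nat \<times> nat \<Rightarrow> 'g) \<Rightarrow> 'g" where
  "total w = (\<Sum>x\<in>I. w x)"

context
  fixes \<phi> :: "nat \<times> nat \<Rightarrow> nat \<times> nat"
  assumes \<phi>: "bij_betw \<phi> I I" and col: "\<And>j. j < m \<Longrightarrow> bij_betw (\<lambda>s. fst (\<phi> (s, j))) {..<m} {..<m}"
begin

text \<open>The array is read through \<phi>: position \<open>(s, j)\<close> holds
  \<open>w (\<phi> (s, j))\<close>. By the condition on \<phi> each column contains every
  \<open>X i\<close> once in some order, so all column sums have law \<open>S\<close>.\<close>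

definition colsum :: "nat \<Rightarrow> (nat \<times> nat \<Rightarrow> 'g) \<Rightarrow> 'g" where
  "colsum j w = (\<Sum>s<m. w (\<phi> (s, j)))"

text \<open>Filled up with zeros, so that dropping a column is a function update and no column
  leaves a constant.\<close>

definition colsums :: "nat \<Rightarrow> (nat \<times> nat \<Rightarrow> 'g) \<Rightarrow> nat \<Rightarrow> 'g" where
  "colsums j w = (\<lambda>i. if j \<le> i \<and> i < m then colsum i w else 0)"

text \<open>The part of row \<open>s\<close> from column \<open>j\<close> on;
  \<open>tail s 0\<close> is the full row sum. Columns are stripped off one at a time in the chain
  rule below.\<close>

definition tail :: "nat \<Rightarrow> nat \<Rightarrow> (nat \<times> nat \<Rightarrow> 'g) \<Rightarrow> 'g" where
  "tail s j w = (\<Sum>i\<in>{j..<m}. w (\<phi> (s, i)))"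

definition tails :: "nat \<Rightarrow> (nat \<times> nat \<Rightarrow> 'g) \<Rightarrow> nat \<Rightarrow> 'g" where
  "tails j w = (\<lambda>s. if s < m then tail s j w else 0)"

definition column :: "nat \<Rightarrow> (nat \<times> nat \<Rightarrow> 'g) \<Rightarrow> nat \<Rightarrow> 'g" where
  "column j w = (\<lambda>s. if s < m then w (\<phi> (s, j)) else 0)"

lemma \<phi>_in: "s < m \<Longrightarrow> j < m \<Longrightarrow> \<phi> (s, j) \<in> I"
  using bij_betwE[OF \<phi>] by (auto simp: I_def)

lemma \<phi>_inj: "inj_on \<phi> J" if "J \<subseteq> I"
  using bij_betw_imp_inj_on[OF \<phi>] that inj_on_subset by blast

lemma \<phi>_img: "\<phi> ` J \<subseteq> I" if "J \<subseteq> I"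
  using bij_betwE[OF \<phi>] that by auto

lemma \<phi>_eq: "s < m \<Longrightarrow> j < m \<Longrightarrow> s' < m \<Longrightarrow> j' < m \<Longrightarrow> \<phi> (s, j) = \<phi> (s', j') \<longleftrightarrow> s = s' \<and> j = j'"
  using inj_on_eq_iff[OF bij_betw_imp_inj_on[OF \<phi>], of "(s, j)" "(s', j')"] by (auto simp: I_def)

lemma tail_Suc: "j < m \<Longrightarrow> tail s j w = w (\<phi> (s, j)) + tail s (Suc j) w"
  unfolding tail_def by (rule sum.atLeast_Suc_lessThan)

lemma fst_\<phi>: "s < m \<Longrightarrow> j < m \<Longrightarrow> fst (\<phi> (s, j)) < m"
  using \<phi>_in[of s j] by (simp add: I_def mem_Times_iff)

lemma tails_column:
  "j < m \<Longrightarrow> tails j w = (\<lambda>s. column j w s + tails (Suc j) w s)"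
  by (auto simp: tails_def column_def tail_Suc fun_eq_iff)

lemma colsum_column: "colsum j w = (\<Sum>s<m. column j w s)"
  by (simp add: colsum_def column_def)

lemma colsums_Suc: "j < m \<Longrightarrow> colsums j w = (colsums (Suc j) w)(j := colsum j w)"
  by (auto simp: colsums_def fun_eq_iff)

lemma colsums_Suc': "colsums (Suc j) w = (colsums j w)(j := 0)"
  by (auto simp: colsums_def fun_eq_iff)

lemma colsum_conv_colsums: "j < m \<Longrightarrow> colsum j w = colsums j w j"
  by (simp add: colsums_def)

text \<open>A chain rule for the entropy of the column sums given the row tails. Revealing column
  \<open>j\<close> splits \<open>tails j\<close> into that column and \<open>tails (Suc j)\<close>;
  the column is independent of all later ones and therefore tells nothing more about their
  sums.\<close>

lemma array_step:
  assumes j: "j < m"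
  shows "rv_ent p (\<lambda>w. (colsums (Suc j) w, tails (Suc j) w)) - rv_ent p (tails (Suc j))
      + (rv_ent p (\<lambda>w. (colsum j w, tails j w)) - rv_ent p (tails j))
    \<le> rv_ent p (\<lambda>w. (colsums j w, tails j w)) - rv_ent p (tails j)"
proof -
  let ?T = "\<lambda>w. ((colsums (Suc j) w, tails (Suc j) w), column j w)"
  have "rv_ent p ?T + rv_ent p (\<lambda>w. (colsum j w, tails j w))
      \<le> rv_ent p (\<lambda>w. (colsums j w, tails j w)) + rv_ent p (\<lambda>w. (colsum j w, tails j w, column j w))"
  proof (intro submod[OF finp] detI)
    fix v w
    assume eq: "((colsums j v, tails j v), colsum j v, tails j v, column j v)
      = ((colsums j w, tails j w), colsum j w, tails j w, column j w)"
    then have "tails (Suc j) v = tails (Suc j) w"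
      using tails_column[OF j, of v] tails_column[OF j, of w] by (auto simp: fun_eq_iff)
    then show "?T v = ?T w" using eq by (simp add: colsums_Suc')
  qed (auto simp: colsum_conv_colsums[OF j])
  moreover have "rv_ent p (\<lambda>w. (colsum j w, tails j w, column j w)) \<le> rv_ent p (\<lambda>w. (tails (Suc j) w, column j w))"
    by (intro rv_ent_mono[OF finp] detI) (auto simp: colsum_column tails_column[OF j])
  moreover have "\<dots> \<le> rv_ent p (tails (Suc j)) + rv_ent p (column j)"
    by (rule rv_ent_Pair_le[OF finp])
  moreover have "rv_ent p ?T = rv_ent p (\<lambda>w. (colsums (Suc j) w, tails (Suc j) w)) + rv_ent p (column j)"
  proof (rule indep_ent[OF finp], unfold p_def,
      rule Pi_pmf_indep[OF finI, of "\<phi> ` ({..<m} \<times> {Suc j..<m})" "\<phi> ` ({..<m} \<times> {j})"])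
    show "\<phi> ` ({..<m} \<times> {Suc j..<m}) \<inter> \<phi> ` ({..<m} \<times> {j}) = {}"
      using j by (auto simp: \<phi>_eq)
    show "depends (\<phi> ` ({..<m} \<times> {Suc j..<m})) (\<lambda>w. (colsums (Suc j) w, tails (Suc j) w))"
      by (intro dependsI) (auto simp: colsums_def colsum_def tails_def tail_def fun_eq_iff intro!: sum.cong)
    show "depends (\<phi> ` ({..<m} \<times> {j})) (column j)"
      by (intro dependsI) (auto simp: column_def fun_eq_iff)
  qed (use j \<phi>_in in auto)
  ultimately show ?thesis by linarith
qed

text \<open>Telescoping of \<open>array_step\<close>. Only \<open>m - 1\<close> terms appear: in the
  last column the tails are the entries themselves and determine the column sum.\<close>

lemma array_sum:
  "(\<Sum>j<m - 1. rv_ent p (\<lambda>w. (colsum j w, tails j w)) - rv_ent p (tails j))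
    \<le> rv_ent p (\<lambda>w. (colsums 0 w, tails 0 w)) - rv_ent p (tails 0)"
proof -
  let ?a = "\<lambda>j. rv_ent p (\<lambda>w. (colsums j w, tails j w)) - rv_ent p (tails j)"
  have "(\<Sum>j<n. rv_ent p (\<lambda>w. (colsum j w, tails j w)) - rv_ent p (tails j)) + ?a n \<le> ?a 0" if "n \<le> m" for n
    using that
  proof (induction n)
    case (Suc n)
    then show ?case using array_step[of n] by (simp add: algebra_simps)
  qed simp
  from this[of "m - 1"] have "(\<Sum>j<m - 1. rv_ent p (\<lambda>w. (colsum j w, tails j w)) - rv_ent p (tails j)) + ?a (m - 1) \<le> ?a 0"
    by simp
  moreover have "0 \<le> ?a (m - 1)" using rv_ent_mono[OF finp detI, of "\<lambda>w. (colsums (m - 1) w, tails (m - 1) w)" "tails (m - 1)"] by simp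
  ultimately show ?thesis by linarith
qed

lemma law_tail:
  assumes "s < m"
  shows "map_pmf (tail s j) p = (\<Sum>i\<in>{j..<m}. X (fst (\<phi> (s, i))))"
proof -
  have "tail s j = (\<lambda>w. \<Sum>x\<in>Pair s ` {j..<m}. w (\<phi> x))"
    by (simp add: tail_def fun_eq_iff sum.reindex inj_on_def)
  moreover have "map_pmf (\<lambda>w. \<Sum>x\<in>Pair s ` {j..<m}. w (\<phi> x)) p = (\<Sum>x\<in>Pair s ` {j..<m}. X (fst (\<phi> x)))"
    by (intro law_array \<phi>_inj \<phi>_img) (use assms in \<open>auto simp: I_def\<close>)
  ultimately show ?thesis by (simp add: sum.reindex inj_on_def)
qed

lemma sum_col: "j < m \<Longrightarrow> (\<Sum>s<m. F (X (fst (\<phi> (s, j))))) = (\<Sum>i<m. F (X i))"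
  for F :: "'g pmf \<Rightarrow> 'z::comm_monoid_add"
  using sum.reindex_bij_betw[OF col, of j "\<lambda>i. F (X i)"] by simp

lemma law_colsum:
  assumes "j < m"
  shows "map_pmf (colsum j) p = S"
proof -
  have "colsum j = (\<lambda>w. \<Sum>x\<in>(\<lambda>s. (s, j)) ` {..<m}. w (\<phi> x))"
    by (simp add: colsum_def fun_eq_iff sum.reindex inj_on_def)
  moreover have "map_pmf (\<lambda>w. \<Sum>x\<in>(\<lambda>s. (s, j)) ` {..<m}. w (\<phi> x)) p = (\<Sum>x\<in>(\<lambda>s. (s, j)) ` {..<m}. X (fst (\<phi> x)))"
    by (intro law_array \<phi>_inj \<phi>_img) (use assms in \<open>auto simp: I_def\<close>)
  moreover have "(\<Sum>x\<in>(\<lambda>s. (s, j)) ` {..<m}. X (fst (\<phi> x))) = S"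
    using sum_col[OF assms, of "\<lambda>x. x"] by (simp add: sum.reindex inj_on_def S_def)
  ultimately show ?thesis by simp
qed

lemma total_tail: "total w = (\<Sum>s<m. tail s 0 w)" and total_colsum: "total w = (\<Sum>j<m. colsum j w)"
proof -
  have "total w = (\<Sum>x\<in>I. w (\<phi> x))"
    unfolding total_def by (rule sum.reindex_bij_betw[OF \<phi>, symmetric])
  then have *: "total w = (\<Sum>s<m. \<Sum>j<m. w (\<phi> (s, j)))"
    by (simp add: I_def sum.cartesian_product)
  then show "total w = (\<Sum>s<m. tail s 0 w)"
    by (simp add: tail_def atLeast0LessThan)
  show "total w = (\<Sum>j<m. colsum j w)"
    unfolding * colsum_def by (rule sum.swap)
qed

lemma rv_ent_tail_0: "s < m \<Longrightarrow> rv_ent p (tail s m) = 0"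
  by (simp add: rv_ent_def law_tail zero_pmf_def)

lemma ent_tail_pair:
  assumes s: "s < m" and j: "j < m"
  shows "rv_ent p (\<lambda>w. (w (\<phi> (s, j)), tail s j w)) = ent (X (fst (\<phi> (s, j)))) + rv_ent p (tail s (Suc j))"
proof -
  have "rv_ent p (\<lambda>w. (w (\<phi> (s, j)), tail s j w)) = rv_ent p (\<lambda>w. (w (\<phi> (s, j)), tail s (Suc j) w))"
    by (intro rv_ent_cong[OF finp] detI) (auto simp: tail_Suc[OF j])
  also have "\<dots> = rv_ent p (\<lambda>w. w (\<phi> (s, j))) + rv_ent p (tail s (Suc j))"
  proof (rule indep_ent[OF finp], unfold p_def,
      rule Pi_pmf_indep[OF finI, of "{\<phi> (s, j)}" "\<phi> ` ({s} \<times> {Suc j..<m})"])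
    show "{\<phi> (s, j)} \<inter> \<phi> ` ({s} \<times> {Suc j..<m}) = {}"
      using s j by (auto simp: \<phi>_eq)
    show "depends (\<phi> ` ({s} \<times> {Suc j..<m})) (tail s (Suc j))"
      by (intro dependsI) (auto simp: tail_def intro!: sum.cong)
    show "depends {\<phi> (s, j)} (\<lambda>w. w (\<phi> (s, j)))" by (intro dependsI) auto
  qed (use s j \<phi>_in in auto)
  also have "rv_ent p (\<lambda>w. w (\<phi> (s, j))) = ent (X (fst (\<phi> (s, j))))"
    unfolding rv_ent_def p_def using \<phi>_in[OF s j] by (simp add: Pi_pmf_component finI)
  finally show ?thesis .
qed

lemma hyp_col:
  assumes "j < m" "1 \<le> n" "n \<le> m ^ 3" "\<And>s. s < m \<Longrightarrow> set_pmf (Y s) \<subseteq> sumset_pow n A"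
  shows "(1 - \<eta>) * k \<le> multidist m Y + \<eta> * (\<Sum>s<m. rd (X (fst (\<phi> (s, j)))) (Y s))"
  unfolding k_def
  by (rule multidist_permute[OF col[OF assms(1)]]) (use hyp assms in auto)

text \<open>The competitor is column \<open>j\<close> with each entry conditioned on the tail of its
  row. Rows are disjoint blocks, so \<open>kernel_average\<close> applies, and the distance cost is
  that of \<open>X i + neg (X i)\<close>.\<close>

lemma column_bound:
  assumes j: "j < m"
  shows "(1 - \<eta>) * k \<le> rv_ent p (\<lambda>w. (colsum j w, tails j w)) - rv_ent p (tails j)
    - (\<Sum>s<m. ent (X (fst (\<phi> (s, j)))) + rv_ent p (tail s (Suc j)) - rv_ent p (tail s j)) / m
    + \<eta> * (\<Sum>s<m. ent S + 4 * k - ent (X (fst (\<phi> (s, j)))) / 2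
         - (ent (X (fst (\<phi> (s, j)))) + rv_ent p (tail s (Suc j)) - rv_ent p (tail s j)) / 2)"
proof -
  define J where "J s = map_pmf (\<lambda>w. (w (\<phi> (s, j)), tail s j w)) p" for s
  let ?F = "\<lambda>w s. if s < m then (w (\<phi> (s, j)), tail s j w) else (0, 0)"
  have fst_J: "map_pmf fst (J s) = X (fst (\<phi> (s, j)))" if "s < m" for s
    unfolding J_def p_def map_pmf_comp using \<phi>_in[OF that j] by (simp add: Pi_pmf_component finI)
  have snd_J: "ent (map_pmf snd (J s)) = rv_ent p (tail s j)" for s
    by (simp add: J_def map_pmf_comp rv_ent_def)
  have ent_J: "ent (J s) = ent (X (fst (\<phi> (s, j)))) + rv_ent p (tail s (Suc j))" if "s < m" for s
    using ent_tail_pair[OF that j] by (simp add: J_def rv_ent_def)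
  have finJ: "finite (set_pmf (J s))" for s using finp by (simp add: J_def)
  have P: "Pi_pmf {..<m} (0, 0) J = map_pmf ?F p"
  proof -
    have "map_pmf (\<lambda>w s. if s \<in> {..<m} then (w (\<phi> (s, j)), tail s j w) else (0, 0)) p = Pi_pmf {..<m} (0, 0) J"
      unfolding p_def J_def
    proof (rule Pi_pmf_blocks[OF finI, where B = "\<lambda>s. \<phi> ` ({s} \<times> {j..<m})"])
      fix s assume "s \<in> {..<m}"
      then show "depends (\<phi> ` ({s} \<times> {j..<m})) (\<lambda>w. (w (\<phi> (s, j)), tail s j w))"
        using j by (intro dependsI) (auto simp: tail_def intro!: sum.cong)
    qed (use \<phi>_in \<phi>_eq in \<open>auto simp: \<phi>_eq\<close>)
    then show ?thesis by simp
  qed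
  have "(1 - \<eta>) * k \<le> rv_ent (Pi_pmf {..<m} (0, 0) J) (\<lambda>w. (\<Sum>s<m. fst (w s), \<lambda>s. snd (w s)))
      - rv_ent (Pi_pmf {..<m} (0, 0) J) (\<lambda>w s. snd (w s))
      - (\<Sum>s<m. ent (J s) - ent (map_pmf snd (J s))) / m
      + \<eta> * (\<Sum>s<m. ent (X (fst (\<phi> (s, j))) + neg (map_pmf fst (J s))) - ent (X (fst (\<phi> (s, j)))) / 2
          - (ent (J s) - ent (map_pmf snd (J s))) / 2)"
  proof (rule kernel_average)
    fix Y assume Y: "\<And>s. s < m \<Longrightarrow> set_pmf (Y s) \<subseteq> fst ` set_pmf (J s)"
    have "set_pmf (Y s) \<subseteq> sumset_pow 1 A" if "s < m" for s
    proof -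
      have "fst ` set_pmf (J s) = set_pmf (X (fst (\<phi> (s, j))))"
        by (simp flip: fst_J[OF that])
      then show ?thesis using Y[OF that] supp[OF fst_\<phi>[OF that j]] by auto
    qed
    then show "(1 - \<eta>) * k \<le> multidist m Y + \<eta> * (\<Sum>s<m. rd (X (fst (\<phi> (s, j)))) (Y s))"
      using m by (intro hyp_col[OF j, of 1]) auto
  qed (use m \<eta> finJ fin fst_\<phi> j in auto)
  also have "rv_ent (Pi_pmf {..<m} (0, 0) J) (\<lambda>w. (\<Sum>s<m. fst (w s), \<lambda>s. snd (w s))) = rv_ent p (\<lambda>w. (colsum j w, tails j w))"
    unfolding P rv_ent_map by (intro arg_cong[of _ _ "rv_ent p"]) (auto simp: colsum_def tails_def fun_eq_iff)
  also have "rv_ent (Pi_pmf {..<m} (0, 0) J) (\<lambda>w s. snd (w s)) = rv_ent p (tails j)"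
    unfolding P rv_ent_map by (intro arg_cong[of _ _ "rv_ent p"]) (auto simp: tails_def fun_eq_iff)
  also have "(\<Sum>s<m. ent (J s) - ent (map_pmf snd (J s)))
      = (\<Sum>s<m. ent (X (fst (\<phi> (s, j)))) + rv_ent p (tail s (Suc j)) - rv_ent p (tail s j))"
    by (intro sum.cong) (auto simp: ent_J snd_J)
  finally have 1: "(1 - \<eta>) * k \<le> rv_ent p (\<lambda>w. (colsum j w, tails j w)) - rv_ent p (tails j)
    - (\<Sum>s<m. ent (X (fst (\<phi> (s, j)))) + rv_ent p (tail s (Suc j)) - rv_ent p (tail s j)) / m
    + \<eta> * (\<Sum>s<m. ent (X (fst (\<phi> (s, j))) + neg (map_pmf fst (J s))) - ent (X (fst (\<phi> (s, j)))) / 2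
          - (ent (J s) - ent (map_pmf snd (J s))) / 2)" .
  have "(\<Sum>s<m. ent (X (fst (\<phi> (s, j))) + neg (map_pmf fst (J s))) - ent (X (fst (\<phi> (s, j)))) / 2
          - (ent (J s) - ent (map_pmf snd (J s))) / 2)
     \<le> (\<Sum>s<m. ent S + 4 * k - ent (X (fst (\<phi> (s, j)))) / 2
         - (ent (X (fst (\<phi> (s, j)))) + rv_ent p (tail s (Suc j)) - rv_ent p (tail s j)) / 2)"
  proof (intro sum_mono)
    fix s assume "s \<in> {..<m}"
    then have s: "s < m" by simp
    show "ent (X (fst (\<phi> (s, j))) + neg (map_pmf fst (J s))) - ent (X (fst (\<phi> (s, j)))) / 2
          - (ent (J s) - ent (map_pmf snd (J s))) / 2
       \<le> ent S + 4 * k - ent (X (fst (\<phi> (s, j)))) / 2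
         - (ent (X (fst (\<phi> (s, j)))) + rv_ent p (tail s (Suc j)) - rv_ent p (tail s j)) / 2"
      using ent_X_minus_X_le[OF m fin fst_\<phi>[OF s j]] by (simp add: fst_J[OF s] ent_J[OF s] snd_J S_def k_def)
  qed
  from mult_left_mono[OF this \<eta>] 1 show ?thesis by linarith
qed

text \<open>The competitor is the tuple of row sums, supported in the \<open>m\<close>-fold sumset.
  Its reference is column \<open>m - 1\<close>, so that together with the columns
  \<open>j < m - 1\<close> each column is used exactly once.\<close>

lemma rows_bound:
  "(1 - \<eta>) * k \<le> rv_ent p total - (\<Sum>s<m. rv_ent p (tail s 0)) / m
    + \<eta> * (\<Sum>s<m. ent S + 4 * m * k - ent (X (fst (\<phi> (s, m - 1)))) / 2 - rv_ent p (tail s 0) / 2)"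
proof -
  define Y where "Y s = map_pmf (tail s 0) p" for s
  have law: "Y s = (\<Sum>i<m. X (fst (\<phi> (s, i))))" if "s < m" for s
    unfolding Y_def law_tail[OF that] by (simp add: atLeast0LessThan)
  have ent_Y: "ent (Y s) = rv_ent p (tail s 0)" for s by (simp add: Y_def rv_ent_def)
  have "(1 - \<eta>) * k \<le> multidist m Y + \<eta> * (\<Sum>s<m. rd (X (fst (\<phi> (s, m - 1)))) (Y s))"
  proof (rule hyp_col)
    show "m \<le> m ^ 3" using m by (simp add: power3_eq_cube)
    show "set_pmf (Y s) \<subseteq> sumset_pow m A" if s: "s < m" for s
    proof
      fix x assume "x \<in> set_pmf (Y s)"
      then obtain w where w: "w \<in> set_pmf p" "x = (\<Sum>i\<in>{0..<m}. w (\<phi> (s, i)))"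
        by (auto simp: Y_def tail_def)
      have "(\<Sum>i\<in>{0..<m}. w (\<phi> (s, i))) \<in> sumset_pow (card {0..<m}) A"
        by (intro sumset_powI) (use subsetD[OF supp[OF fst_\<phi>[OF s]] supp_p[OF w(1) \<phi>_in[OF s]]] in auto)
      then show "x \<in> sumset_pow m A" using w by simp
    qed
  qed (use m in auto)
  moreover have "(\<Sum>s<m. Y s) = map_pmf total p"
  proof -
    have "map_pmf total p = map_pmf (\<lambda>w. \<Sum>x\<in>I. w (\<phi> x)) p"
      unfolding total_def by (intro map_pmf_cong refl sum.reindex_bij_betw[OF \<phi>, symmetric])
    also have "\<dots> = (\<Sum>x\<in>I. X (fst (\<phi> x)))"
      by (intro law_array \<phi>_inj) (use bij_betwE[OF \<phi>] in auto)
    also have "\<dots> = (\<Sum>s<m. \<Sum>j<m. X (fst (\<phi> (s, j))))"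
      by (simp add: I_def sum.cartesian_product)
    finally show ?thesis using law by simp
  qed
  moreover have "(\<Sum>s<m. rd (X (fst (\<phi> (s, m - 1)))) (Y s))
    \<le> (\<Sum>s<m. ent S + 4 * m * k - ent (X (fst (\<phi> (s, m - 1)))) / 2 - rv_ent p (tail s 0) / 2)"
  proof (intro sum_mono)
    fix s assume "s \<in> {..<m}"
    then have s: "s < m" by simp
    have "ent (X (fst (\<phi> (s, m - 1))) + neg (Y s)) \<le> ent S + 4 * card {..<m} * k"
      unfolding law[OF s] S_def k_def by (rule ent_X_minus_sum_le[OF m fin]) (use fst_\<phi> s m in auto)
    then show "rd (X (fst (\<phi> (s, m - 1)))) (Y s)
       \<le> ent S + 4 * m * k - ent (X (fst (\<phi> (s, m - 1)))) / 2 - rv_ent p (tail s 0) / 2"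
      by (simp add: rd_def ent_Y add_divide_distrib)
  qed
  from mult_left_mono[OF this \<eta>] calculation show ?thesis
    by (simp add: multidist_def ent_Y rv_ent_def)
qed

lemma ent_colsums_le: "rv_ent p (colsums 0) \<le> m * ent S"
proof -
  have "rv_ent p (colsums (m - n)) \<le> n * ent S" if "n \<le> m" for n
    using that
  proof (induction n)
    case 0
    have "colsums m = (\<lambda>_ _. 0)" by (auto simp: colsums_def fun_eq_iff)
    then show ?case by simp
  next
    case (Suc n)
    define j where "j = m - Suc n"
    have j: "j < m" "Suc j = m - n" using Suc.prems by (auto simp: j_def)
    have "rv_ent p (colsums j) \<le> rv_ent p (\<lambda>w. (colsum j w, colsums (Suc j) w))"
      by (intro rv_ent_mono[OF finp] detI) (auto simp: colsums_Suc[OF j(1)])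
    also have "\<dots> \<le> rv_ent p (colsum j) + rv_ent p (colsums (Suc j))"
      by (rule rv_ent_Pair_le[OF finp])
    also have "rv_ent p (colsum j) = ent S" by (simp add: rv_ent_def law_colsum[OF j(1)])
    also have "rv_ent p (colsums (Suc j)) \<le> n * ent S" unfolding j using Suc by simp
    finally show ?case by (simp add: j_def algebra_simps)
  qed
  from this[of m] show ?thesis by simp
qed

text \<open>The left side is the mutual information of column sums and row sums given the total. The
  hypothesis is used for \<open>m\<close> competitors; the \<open>m * k\<close> so gained equals the
  gap \<open>m * ent S - H\<close> that bounds the information, and only terms with a factor \<eta>
  survive.\<close>

lemma array_information:
  "rv_ent p (colsums 0) + rv_ent p (tails 0) - rv_ent p (\<lambda>w. (colsums 0 w, tails 0 w)) - rv_ent p total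
    \<le> 9 * (real m)\<^sup>2 * \<eta> * k"
proof -
  define H where "H = (\<Sum>i<m. ent (X i))"
  define T where "T = (\<Sum>s<m. rv_ent p (tail s 0))"
  define g where "g s j = ent (X (fst (\<phi> (s, j)))) + rv_ent p (tail s (Suc j)) - rv_ent p (tail s j)" for s j
  define E where "E j = rv_ent p (\<lambda>w. (colsum j w, tails j w)) - rv_ent p (tails j)" for j
  have col_H: "(\<Sum>s<m. ent (X (fst (\<phi> (s, j))))) = H" if "j < m" for j
    unfolding H_def by (rule sum_col[OF that])
  have m1: "real (m - Suc 0) = real m - 1" using m by simp
  have "(\<Sum>j<m - 1. g s j) = (\<Sum>j<m. g s j) - g s (m - 1)" for s
    using m by (cases m) auto
  \<comment> \<open>In \<open>j\<close> the tail entropies telescope from the full row sum down to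
    the empty tail. The term at \<open>m - 1\<close> vanishes because that tail is a single entry,
    so the sum up to \<open>m - 1\<close> has the same value.\<close>
  moreover have "(\<Sum>j<m. g s j) = (\<Sum>j<m. ent (X (fst (\<phi> (s, j))))) - rv_ent p (tail s 0)" if "s < m" for s
    unfolding g_def add_diff_eq[symmetric] sum.distrib
    using sum_lessThan_telescope[of "\<lambda>j. rv_ent p (tail s j)" m] rv_ent_tail_0[OF that] by simp
  moreover have "g s (m - 1) = 0" if "s < m" for s
  proof -
    have "{m - 1..<m} = {m - 1}" using m by auto
    then have "rv_ent p (tail s (m - 1)) = ent (X (fst (\<phi> (s, m - 1))))"
      by (simp add: rv_ent_def law_tail[OF that])
    then show ?thesis using m rv_ent_tail_0[OF that] by (simp add: g_def)
  qed
  ultimately have "(\<Sum>s<m. \<Sum>j<m - 1. g s j) = (\<Sum>s<m. \<Sum>j<m. ent (X (fst (\<phi> (s, j))))) - T"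
    by (simp add: T_def sum_subtractf)
  also have "(\<Sum>s<m. \<Sum>j<m. ent (X (fst (\<phi> (s, j))))) = m * H"
    by (subst sum.swap) (simp add: col_H)
  finally have gsum: "(\<Sum>j<m - 1. \<Sum>s<m. g s j) = m * H - T" by (subst sum.swap)
  have "(\<Sum>j<m - 1. (1 - \<eta>) * k) \<le> (\<Sum>j<m - 1. E j - (\<Sum>s<m. g s j) / m
      + \<eta> * (m * (ent S + 4 * k) - H / 2 - (\<Sum>s<m. g s j) / 2))"
  proof (intro sum_mono)
    fix j assume "j \<in> {..<m - 1}"
    then have j: "j < m" by auto
    have "(\<Sum>s<m. ent S + 4 * k - ent (X (fst (\<phi> (s, j)))) / 2 - g s j / 2)
      = m * (ent S + 4 * k) - H / 2 - (\<Sum>s<m. g s j) / 2"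
      by (simp add: sum_subtractf sum.distrib sum_divide_distrib[symmetric] col_H[OF j])
    then show "(1 - \<eta>) * k \<le> E j - (\<Sum>s<m. g s j) / m + \<eta> * (m * (ent S + 4 * k) - H / 2 - (\<Sum>s<m. g s j) / 2)"
      using column_bound[OF j] unfolding E_def g_def[symmetric] by simp
  qed
  also have "\<dots> = (\<Sum>j<m - 1. E j) - (m * H - T) / m
      + \<eta> * ((m - 1) * (m * (ent S + 4 * k) - H / 2) - (m * H - T) / 2)"
    unfolding gsum[symmetric] by (simp add: sum.distrib sum_subtractf sum_divide_distrib sum_distrib_left[symmetric])
  finally have 1: "(real m - 1) * ((1 - \<eta>) * k) \<le> (\<Sum>j<m - 1. E j) - (m * H - T) / m
      + \<eta> * ((real m - 1) * (m * (ent S + 4 * k) - H / 2) - (m * H - T) / 2)"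
    by (simp add: m1)
  have "(\<Sum>s<m. ent S + 4 * m * k - ent (X (fst (\<phi> (s, m - 1)))) / 2 - rv_ent p (tail s 0) / 2)
      = m * (ent S + 4 * m * k) - H / 2 - T / 2"
    using m by (simp add: sum_subtractf sum.distrib sum_divide_distrib[symmetric] col_H T_def)
  then have 2: "(1 - \<eta>) * k \<le> rv_ent p total - T / m + \<eta> * (m * (ent S + 4 * m * k) - H / 2 - T / 2)"
    using rows_bound unfolding T_def[symmetric] by simp
  have mH: "m * ent S - H = m * k"
    using sum_ent_gap[OF m fin] by (simp add: sum_subtractf H_def S_def k_def)
  \<comment> \<open>The entropies \<open>T\<close> of the row sums enter the columns with sign plus
    and the rows with sign minus, and cancel.\<close>
  have 3: "(m * H - T) / m = H - T / m" using m by (simp add: diff_divide_distrib)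
  have 4: "(real m - 1) * (m * (ent S + 4 * k) - H / 2) - (m * H - T) / 2 + (m * (ent S + 4 * m * k) - H / 2 - T / 2)
      = m * (m * ent S - H) + 8 * real m * real m * k - 4 * real m * k"
    by (simp add: field_simps)
  have "m * ((1 - \<eta>) * k) = (real m - 1) * ((1 - \<eta>) * k) + (1 - \<eta>) * k"
    by (simp add: algebra_simps)
  also have "\<dots> \<le> (\<Sum>j<m - 1. E j) - H + rv_ent p total
      + \<eta> * ((real m - 1) * (m * (ent S + 4 * k) - H / 2) - (m * H - T) / 2 + (m * (ent S + 4 * m * k) - H / 2 - T / 2))"
    using 1 2 unfolding 3 by (simp add: algebra_simps)
  also have "\<dots> = (\<Sum>j<m - 1. E j) - H + rv_ent p total + \<eta> * (9 * (real m)\<^sup>2 * k - 4 * real m * k)"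
    unfolding 4 mH by (simp add: power2_eq_square algebra_simps)
  finally have 5: "m * k \<le> (\<Sum>j<m - 1. E j) - H + rv_ent p total + 9 * (real m)\<^sup>2 * \<eta> * k - 3 * (\<eta> * (real m * k))"
    by (simp add: algebra_simps)
  have "0 \<le> \<eta> * (real m * k)" using \<eta> multidist_nonneg[OF m fin] by (simp add: k_def)
  then show ?thesis
    using 5 mH array_sum ent_colsums_le unfolding E_def by linarith
qed

end

section \<open>Weighted sums of the array and the use of torsion\<close>

definition wsum :: "(nat \<times> nat \<Rightarrow> nat) \<Rightarrow> (nat \<times> nat \<Rightarrow> 'g) \<Rightarrow> 'g" where
  "wsum \<rho> w = (\<Sum>x\<in>I. smul (\<rho> x) (w x))"

text \<open>If the weight \<rho> reads the row index and \<open>\<rho>'\<close> the column index,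
  the weighted sums are functions of the row sums and of the column sums, and
  \<open>data_processing\<close> carries \<open>array_information\<close> over to them.\<close>

lemma wsum_information:
  assumes \<phi>: "bij_betw \<phi> I I" and col: "\<And>j. j < m \<Longrightarrow> bij_betw (\<lambda>s. fst (\<phi> (s, j))) {..<m} {..<m}"
    and \<rho>: "\<And>s j. s < m \<Longrightarrow> j < m \<Longrightarrow> \<rho> (\<phi> (s, j)) = s"
    and \<rho>': "\<And>s j. s < m \<Longrightarrow> j < m \<Longrightarrow> \<rho>' (\<phi> (s, j)) = j"
  shows "rv_ent p (\<lambda>w. (wsum \<rho> w, total w)) + rv_ent p (\<lambda>w. (wsum \<rho>' w, total w))
      - rv_ent p (\<lambda>w. (wsum \<rho> w, wsum \<rho>' w, total w)) - rv_ent p total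
    \<le> 9 * (real m)\<^sup>2 * \<eta> * k"
proof -
  have reindex: "wsum \<sigma> w = (\<Sum>s<m. \<Sum>j<m. smul (\<sigma> (\<phi> (s, j))) (w (\<phi> (s, j))))" for \<sigma> w
  proof -
    have "wsum \<sigma> w = (\<Sum>x\<in>I. smul (\<sigma> (\<phi> x)) (w (\<phi> x)))"
      unfolding wsum_def by (rule sum.reindex_bij_betw[OF \<phi>, symmetric])
    then show ?thesis by (simp add: I_def sum.cartesian_product)
  qed
  have 1: "wsum \<rho> w = (\<Sum>s<m. smul s (tails \<phi> 0 w s))" for w
    unfolding reindex smul_sum by (intro sum.cong refl) (simp add: tails_def[OF \<phi> col] tail_def[OF \<phi> col] smul_sum \<rho> atLeast0LessThan)
  have 2: "wsum \<rho>' w = (\<Sum>j<m. smul j (colsums \<phi> 0 w j))" for w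
    unfolding reindex by (subst sum.swap, intro sum.cong refl) (simp add: colsums_def[OF \<phi> col] colsum_def[OF \<phi> col] smul_sum \<rho>')
  have 3: "total w = (\<Sum>s<m. tails \<phi> 0 w s)" for w
    using total_tail[OF \<phi> col, of w] by (simp add: tails_def[OF \<phi> col])
  have 4: "total w = (\<Sum>j<m. colsums \<phi> 0 w j)" for w
    using total_colsum[OF \<phi> col, of w] by (simp add: colsums_def[OF \<phi> col])
  have "rv_ent p (\<lambda>w. (wsum \<rho> w, total w)) + rv_ent p (\<lambda>w. (wsum \<rho>' w, total w))
      - rv_ent p (\<lambda>w. (wsum \<rho> w, wsum \<rho>' w, total w)) - rv_ent p total
    \<le> rv_ent p (colsums \<phi> 0) + rv_ent p (tails \<phi> 0) - rv_ent p (\<lambda>w. (colsums \<phi> 0 w, tails \<phi> 0 w)) - rv_ent p total"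
    by (intro data_processing[OF finp] detI) (simp_all only: 1 2, simp_all only: 3, simp add: 4[unfolded 3])
  also have "\<dots> \<le> 9 * (real m)\<^sup>2 * \<eta> * k"
    by (rule array_information[OF \<phi> col])
  finally show ?thesis .
qed

text \<open>Column \<open>b\<close> contains every \<open>X a\<close> once, all with weight
  \<open>b\<close>, and so contributes a \<open>b\<close>-fold multiple of a copy of
  \<open>S\<close>.\<close>

lemma law_wsum: "map_pmf (wsum snd) p = (\<Sum>j<m. map_pmf (smul j) S)"
proof -
  have "map_pmf (wsum snd) p = map_pmf (\<lambda>w. \<Sum>x\<in>I. w x) (map_pmf (\<lambda>w x. if x \<in> I then smul (snd x) (w x) else 0) p)"
    unfolding map_pmf_comp by (intro map_pmf_cong) (auto simp: wsum_def intro!: sum.cong)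
  also have "map_pmf (\<lambda>w x. if x \<in> I then smul (snd x) (w x) else 0) p
      = Pi_pmf I 0 (\<lambda>x. map_pmf (\<lambda>w. smul (snd x) (w x)) p)"
    unfolding p_def by (rule Pi_pmf_blocks[OF finI finI, where B = "\<lambda>x. {x}"]) (auto simp: depends_def)
  also have "map_pmf (\<lambda>w. \<Sum>x\<in>I. w x) \<dots> = (\<Sum>x\<in>I. map_pmf (\<lambda>w. smul (snd x) (w x)) p)"
    by (rule sum_Pi_pmf[OF finI]) simp
  also have "\<dots> = (\<Sum>x\<in>I. map_pmf (smul (snd x)) (X (fst x)))"
  proof (intro sum.cong refl)
    fix x assume "x \<in> I"
    then have x: "map_pmf (\<lambda>w. w x) p = X (fst x)" unfolding p_def by (simp add: Pi_pmf_component finI)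
    have "map_pmf (\<lambda>w. smul (snd x) (w x)) p = map_pmf (smul (snd x)) (map_pmf (\<lambda>w. w x) p)"
      by (simp add: map_pmf_comp)
    then show "map_pmf (\<lambda>w. smul (snd x) (w x)) p = map_pmf (smul (snd x)) (X (fst x))"
      unfolding x .
  qed
  also have "\<dots> = (\<Sum>b<m. \<Sum>a<m. map_pmf (smul b) (X a))"
    unfolding I_def by (subst sum.swap) (simp add: sum.cartesian_product case_prod_unfold)
  also have "\<dots> = (\<Sum>b<m. map_pmf (smul b) S)"
    unfolding S_def by (intro sum.cong refl map_pmf_hom_sum[symmetric] smul_add smul_zero)
  finally show ?thesis .
qed

text \<open>Fix all columns but 0 and 1, whose weights are 0 and 1. What remains is the entropy of
  \<open>Q 1\<close> given \<open>Q 0 + Q 1\<close>, that is \<open>2 * ent S - ent (S + S)\<close>,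
  and \<open>ent_SS\<close> applies.\<close>

lemma ent_wsum_given_total: "ent S - 2 * k \<le> rv_ent p (\<lambda>w. (wsum snd w, total w)) - rv_ent p total"
proof -
  obtain n where n: "m = Suc (Suc n)" using m by (metis add_2_eq_Suc le_Suc_ex)
  define Q where "Q b w = (\<Sum>a<m. w (a, b))" for b and w :: "nat \<times> nat \<Rightarrow> 'g"
  define G where "G w = (\<lambda>x. if x \<in> I \<and> 2 \<le> snd x then w x else 0)" for w :: "nat \<times> nat \<Rightarrow> 'g"
  have split: "(\<Sum>x\<in>I. F x) = (\<Sum>a<m. F (a, 0)) + (\<Sum>a<m. F (a, 1)) + (\<Sum>x\<in>I. if 2 \<le> snd x then F x else 0)"
    for F :: "nat \<times> nat \<Rightarrow> 'g"
  proof -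
    have "(\<Sum>b<m. F (a, b)) = F (a, 0) + F (a, 1) + (\<Sum>b<m. if 2 \<le> b then F (a, b) else 0)" for a
      unfolding n sum.lessThan_Suc_shift by (simp add: add.assoc)
    moreover have "(\<Sum>x\<in>I. F' x) = (\<Sum>a<m. \<Sum>b<m. F' (a, b))" for F' :: "nat \<times> nat \<Rightarrow> 'g"
      by (simp add: I_def sum.cartesian_product)
    ultimately show ?thesis by (simp add: sum.distrib)
  qed
  have W: "total w = Q 0 w + Q 1 w + (\<Sum>x\<in>I. G w x)" for w
    unfolding total_def split[of w] Q_def G_def by (simp cong: sum.cong)
  have Z: "wsum snd w = Q 1 w + (\<Sum>x\<in>I. smul (snd x) (G w x))" for w
    unfolding wsum_def split[of "\<lambda>x. smul (snd x) (w x)"] Q_def G_def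
    by (auto simp: smul_Suc smul_zero intro!: sum.cong)
  have law: "map_pmf (Q b) p = S" if "b < m" for b
  proof -
    have "Q b = (\<lambda>w. \<Sum>x\<in>(\<lambda>a. (a, b)) ` {..<m}. w x)"
      by (simp add: Q_def fun_eq_iff sum.reindex inj_on_def)
    moreover have "map_pmf (\<lambda>w. \<Sum>x\<in>(\<lambda>a. (a, b)) ` {..<m}. w x) p = (\<Sum>x\<in>(\<lambda>a. (a, b)) ` {..<m}. X (fst x))"
      by (rule law_array[where \<phi> = "\<lambda>x. x"]) (use that in \<open>auto simp: I_def\<close>)
    ultimately show ?thesis by (simp add: sum.reindex inj_on_def S_def)
  qed
  have depQ: "depends ({..<m} \<times> {b}) (Q b)" for b
    by (intro dependsI) (auto simp: Q_def)
  have depG: "depends ({..<m} \<times> {2..<m}) G"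
    by (intro dependsI) (auto simp: G_def I_def fun_eq_iff)
  have i01: "indep p (Q 0) (Q 1)"
    unfolding p_def by (rule Pi_pmf_indep[OF finI _ _ _ depQ depQ]) (use m in \<open>auto simp: I_def\<close>)
  have i1G: "indep p (Q 1) G"
    unfolding p_def by (rule Pi_pmf_indep[OF finI _ _ _ depQ depG]) (use m in \<open>auto simp: I_def\<close>)
  have depQG: "depends ({..<m} \<times> {1..<m}) (\<lambda>w. (Q 1 w, G w))"
    using m by (intro dependsI) (auto simp: Q_def G_def I_def fun_eq_iff)
  have i01G: "indep p (Q 0) (\<lambda>w. (Q 1 w, G w))"
    unfolding p_def by (rule Pi_pmf_indep[OF finI _ _ _ depQ depQG]) (use m in \<open>auto simp: I_def\<close>)
  have "rv_ent p (\<lambda>w. (Q 0 w, Q 1 w, G w)) + rv_ent p total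
      \<le> rv_ent p (\<lambda>w. (wsum snd w, total w)) + rv_ent p (\<lambda>w. (Q 0 w + Q 1 w, G w))"
  proof (intro submod[OF finp] detI)
    fix v w assume eq: "((wsum snd v, total v), Q 0 v + Q 1 v, G v) = ((wsum snd w, total w), Q 0 w + Q 1 w, G w)"
    then have "Q 1 v = Q 1 w" unfolding Z by auto
    then show "(Q 0 v, Q 1 v, G v) = (Q 0 w, Q 1 w, G w)" using eq by auto
  qed (auto simp: W)
  moreover have "rv_ent p (\<lambda>w. (Q 0 w, Q 1 w, G w)) = ent S + (ent S + rv_ent p G)"
    using indep_ent[OF finp i01G] indep_ent[OF finp i1G] law[of 0] law[of 1] m by (simp add: rv_ent_def)
  moreover have "rv_ent p (\<lambda>w. (Q 0 w + Q 1 w, G w)) \<le> rv_ent p (\<lambda>w. Q 0 w + Q 1 w) + rv_ent p G"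
    by (rule rv_ent_Pair_le[OF finp])
  moreover have "rv_ent p (\<lambda>w. Q 0 w + Q 1 w) = ent (S + S)"
    using indep_plus[OF i01] law[of 0] law[of 1] m by (simp add: rv_ent_def)
  ultimately show ?thesis using ent_SS[where X = X, OF m fin] unfolding S_def[symmetric] k_def[symmetric] by linarith
qed

lemma wsum_snd_mem: "w \<in> set_pmf p \<Longrightarrow> wsum snd w \<in> sumset_pow (card (SIGMA x:I. {..<snd x})) A"
proof -
  assume w: "w \<in> set_pmf p"
  have "wsum snd w = (\<Sum>x\<in>I. \<Sum>t<snd x. w x)"
    by (simp add: wsum_def smul_def)
  also have "\<dots> = (\<Sum>z\<in>(SIGMA x:I. {..<snd x}). w (fst z))"
    using finI by (subst sum.Sigma) (auto simp: case_prod_unfold)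
  also have "\<dots> \<in> sumset_pow (card (SIGMA x:I. {..<snd x})) A"
  proof (rule sumset_powI)
    fix z assume "z \<in> (SIGMA x:I. {..<snd x})"
    then have "fst z \<in> I" by auto
    then show "w (fst z) \<in> A" using supp_p[OF w, of "fst z"] supp[of "fst (fst z)"] by (auto simp: I_def)
  qed (use finI in auto)
  finally show ?thesis .
qed

text \<open>The number of summands, with multiplicity, in the column-weighted sum. It is the longest
  sum formed from the array, and the reason why the hypothesis admits \<open>n\<close> up to
  \<open>m^3\<close>.\<close>

lemma card_weights: "1 \<le> card (SIGMA x:I. {..<snd x})" "card (SIGMA x:I. {..<snd x}) \<le> m ^ 3"
proof -
  have "((0, 1), 0) \<in> (SIGMA x:I. {..<snd x})" using m by (auto simp: I_def)
  then have "(SIGMA x:I. {..<snd x}) \<noteq> {}" by blast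
  moreover have "finite (SIGMA x:I. {..<snd x})" using finI by auto
  ultimately have "card (SIGMA x:I. {..<snd x}) > 0" unfolding card_gt_0_iff by blast
  then show "1 \<le> card (SIGMA x:I. {..<snd x})" by simp
  have "card (SIGMA x:I. {..<snd x}) \<le> card (I \<times> {..<m})"
    using finI by (intro card_mono) (auto simp: I_def)
  also have "\<dots> = m ^ 3" by (simp add: I_def power3_eq_cube)
  finally show "card (SIGMA x:I. {..<snd x}) \<le> m ^ 3" .
qed

text \<open>The one place where torsion enters the array argument. Weights below \<open>m\<close>
  are forced by reading them off as indices of the array, so the sum of two of them has to be
  reduced modulo \<open>m\<close>.\<close>

lemma wsum_torsion:
  assumes tor: "\<And>x. x \<in> A \<Longrightarrow> smul m x = 0" and w: "w \<in> set_pmf p"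
  shows "wsum (\<lambda>x. (fst x + snd x) mod m) w = wsum snd w + wsum fst w"
  unfolding wsum_def sum.distrib[symmetric]
proof (intro sum.cong refl)
  fix x assume x: "x \<in> I"
  then have "w x \<in> A" using supp_p[OF w x] supp[of "fst x"] by (auto simp: I_def)
  then have "smul m (w x) = 0" by (rule tor)
  then show "smul ((fst x + snd x) mod m) (w x) = smul (snd x) (w x) + smul (fst x) (w x)"
    by (simp add: smul_mod smul_add_left add.commute)
qed

text \<open>The three pairs among \<open>\<Sum> a x\<^sub>a\<^sub>b\<close>, \<open>\<Sum> b x\<^sub>a\<^sub>b\<close> and \<open>\<Sum> (a + b) x\<^sub>a\<^sub>b\<close> are row- and column-weighted sums
  for three reindexings of the array.\<close>

lemma wsum_pairs:
  defines "t \<equiv> 9 * (real m)\<^sup>2 * \<eta> * k" and "\<sigma> \<equiv> \<lambda>x. (fst x + snd x) mod m"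
  shows "rv_ent p (\<lambda>w. (wsum fst w, total w)) + rv_ent p (\<lambda>w. (wsum snd w, total w))
      - rv_ent p (\<lambda>w. (wsum fst w, wsum snd w, total w)) - rv_ent p total \<le> t" (is ?A)
    "rv_ent p (\<lambda>w. (wsum fst w, total w)) + rv_ent p (\<lambda>w. (wsum \<sigma> w, total w))
      - rv_ent p (\<lambda>w. (wsum fst w, wsum \<sigma> w, total w)) - rv_ent p total \<le> t" (is ?B)
    "rv_ent p (\<lambda>w. (wsum snd w, total w)) + rv_ent p (\<lambda>w. (wsum \<sigma> w, total w))
      - rv_ent p (\<lambda>w. (wsum snd w, wsum \<sigma> w, total w)) - rv_ent p total \<le> t" (is ?C)
proof -
  \<comment> \<open>\<open>r s j\<close> is \<open>j - s\<close> modulo \<open>m\<close>, the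
    solution of \<open>s + r = j\<close>; for fixed \<open>j\<close> it is an involution in
    \<open>s\<close>. With \<open>(s, r s j)\<close> or \<open>(r s j, s)\<close> as cell, the
    column index \<open>j\<close> is the weight \<open>a + b\<close> modulo
    \<open>m\<close>.\<close>
  define r where "r s j = (if s \<le> j then j - s else j + m - s)" for s j :: nat
  have r: "r s j < m" "r (r s j) j = s" "(s + r s j) mod m = j" "(r s j + s) mod m = j" if "s < m" "j < m" for s j
    using that by (auto simp: r_def)
  have r': "r a ((a + b) mod m) = b" if "a < m" "b < m" for a b
    using that by (cases "a + b < m") (auto simp: r_def mod_if)
  have r'': "r b ((a + b) mod m) = a" if "a < m" "b < m" for a b
    using r'[OF that(2,1)] by (simp add: add.commute)
  show ?A
    unfolding t_def by (rule wsum_information[where \<phi> = "\<lambda>x. x"]) (auto simp: bij_betw_def)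
  show ?B
    unfolding t_def
  proof (rule wsum_information[where \<phi> = "\<lambda>(s, j). (s, r s j)"])
    show "bij_betw (\<lambda>(s, j). (s, r s j)) I I"
      by (rule bij_betw_byWitness[where f' = "\<lambda>(a, b). (a, (a + b) mod m)"]) (use r r' m in \<open>auto simp: I_def\<close>)
  qed (use r in \<open>auto simp: bij_betw_def \<sigma>_def\<close>)
  show ?C
    unfolding t_def
  proof (rule wsum_information[where \<phi> = "\<lambda>(s, j). (r s j, s)"])
    show "bij_betw (\<lambda>(s, j). (r s j, s)) I I"
      by (rule bij_betw_byWitness[where f' = "\<lambda>(a, b). (b, (a + b) mod m)"])
        (use r r'' m in \<open>auto simp: I_def\<close>)
    show "bij_betw (\<lambda>s. fst ((\<lambda>(s, j). (r s j, s)) (s, j))) {..<m} {..<m}" if "j < m" for j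
      by (rule bij_betw_byWitness[where f' = "\<lambda>s. r s j"]) (use r that in auto)
  qed (use r in \<open>auto simp: \<sigma>_def\<close>)
qed

text \<open>The competitor is the constant tuple \<open>U y\<close>, the law of
  \<open>\<Sum> b x\<close> conditioned on the third weighted sum and on the total. Averaged over
  \<open>y\<close>, its multidistance is at most \<open>3 * m * t\<close>, a fixed fraction of
  \<open>k\<close>, and the hypothesis fails for positive \<open>k\<close>.\<close>

lemma endgame:
  assumes tor: "\<And>x. x \<in> A \<Longrightarrow> smul m x = 0" and eta: "\<eta> = 1 / (50 * real m ^ 3)"
  shows "k \<le> 0"
proof (rule ccontr)
  assume "\<not> k \<le> 0"
  then have k: "k > 0" by simp
  define t where "t = 9 * (real m)\<^sup>2 * \<eta> * k"
  define \<sigma> where "\<sigma> x = (fst x + snd x) mod m" for x :: "nat \<times> nat"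
  let ?Z1 = "wsum fst" and ?Z2 = "wsum snd" and ?W = total
  define J where "J = map_pmf (\<lambda>w. ((?Z2 w, ?Z1 w), (?Z2 w + ?Z1 w, ?W w))) p"
  define \<nu> where "\<nu> = map_pmf snd J"
  define U where "U y = map_pmf fst (kern J y)" for y
  define V where "V y = map_pmf snd (kern J y)" for y
  define a where "a = rv_ent p (\<lambda>w. (?Z2 w, ?W w))"
  define b where "b = rv_ent p (\<lambda>w. (?Z1 w, ?W w))"
  define c where "c = rv_ent p (\<lambda>w. (?Z2 w + ?Z1 w, ?W w))"
  define ab where "ab = rv_ent p (\<lambda>w. (?Z2 w, ?Z1 w, ?W w))"
  have finJ: "finite (set_pmf J)" using finp by (simp add: J_def)
  have fin\<nu>: "finite (set_pmf \<nu>)" using finJ by (simp add: \<nu>_def)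
  have Z3: "wsum \<sigma> w = ?Z2 w + ?Z1 w" if "w \<in> set_pmf p" for w
    using wsum_torsion[OF tor that] by (simp add: \<sigma>_def[abs_def])
  have c': "rv_ent p (\<lambda>w. (wsum \<sigma> w, ?W w)) = c"
    unfolding c_def rv_ent_def by (intro arg_cong[of _ _ ent] map_pmf_cong) (auto simp: Z3)
  have ab1: "rv_ent p (\<lambda>w. (?Z1 w, ?Z2 w, ?W w)) = ab" "rv_ent p (\<lambda>w. (?Z1 w, wsum \<sigma> w, ?W w)) = ab"
      "rv_ent p (\<lambda>w. (?Z2 w, wsum \<sigma> w, ?W w)) = ab"
    unfolding ab_def by (intro rv_ent_cong[OF finp] detI; auto simp: Z3)+
  have I12: "a + b - ab - rv_ent p ?W \<le> t" and I13: "b + c - ab - rv_ent p ?W \<le> t" and I23: "a + c - ab - rv_ent p ?W \<le> t"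
    using wsum_pairs[folded \<sigma>_def[abs_def]] unfolding c' ab1 a_def[symmetric] b_def[symmetric] t_def[symmetric] by simp_all
  have entJ: "ent (map_pmf snd J) = c" by (simp add: J_def c_def rv_ent_def map_pmf_comp)
  have EU: "expect \<nu> (\<lambda>y. ent (U y)) = ab - c"
  proof -
    have "ent (map_pmf (\<lambda>z. (fst (fst z), snd z)) J) = rv_ent p (\<lambda>w. (?Z2 w, (?Z2 w + ?Z1 w, ?W w)))"
      by (simp add: J_def rv_ent_def map_pmf_comp)
    also have "\<dots> = ab" unfolding ab_def by (intro rv_ent_cong[OF finp] detI) auto
    finally show ?thesis unfolding \<nu>_def U_def expectation_ent_map_kern[OF finJ] entJ by simp
  qed
  have EV: "expect \<nu> (\<lambda>y. ent (V y)) = ab - c"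
  proof -
    have "ent (map_pmf (\<lambda>z. (snd (fst z), snd z)) J) = rv_ent p (\<lambda>w. (?Z1 w, (?Z2 w + ?Z1 w, ?W w)))"
      by (simp add: J_def rv_ent_def map_pmf_comp)
    also have "\<dots> = ab" unfolding ab_def by (intro rv_ent_cong[OF finp] detI) auto
    finally show ?thesis unfolding \<nu>_def V_def expectation_ent_map_kern[OF finJ] entJ by simp
  qed
  have EUV: "expect \<nu> (\<lambda>y. ent (U y + neg (V y))) \<le> 2 * a + 2 * b - 3 * rv_ent p ?W + c - 2 * ab"
    using entropic_bsg[OF finp, of ?Z2 ?Z1 ?W] unfolding J_def[symmetric] \<nu>_def U_def V_def a_def b_def c_def ab_def .
  have finU: "finite (set_pmf (U y))" "finite (set_pmf (V y))" if "y \<in> set_pmf \<nu>" for y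
    using that finite_set_kern(1)[OF finJ] by (auto simp: U_def V_def \<nu>_def)
  have bindU: "bind_pmf \<nu> U = map_pmf ?Z2 p"
  proof -
    have "bind_pmf \<nu> U = map_pmf fst (bind_pmf \<nu> (kern J))" by (simp add: U_def[abs_def] map_bind_pmf)
    also have "\<dots> = map_pmf ?Z2 p" unfolding \<nu>_def bind_kern by (simp add: J_def map_pmf_comp)
    finally show ?thesis .
  qed
  \<comment> \<open>By concavity the conditioned laws may be mixed again, and their mixture is the
    law of the whole weighted sum.\<close>
  have EX: "expect \<nu> (\<lambda>y. ent (X i + neg (U y))) \<le> ent S + 4 * (real m)\<^sup>2 * k" if i: "i < m" for i
  proof -
    have "expect \<nu> (\<lambda>y. ent (X i + neg (U y))) \<le> ent (bind_pmf \<nu> (\<lambda>y. X i + neg (U y)))"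
      using fin\<nu> finU fin[OF i] by (intro ent_kernel_concave) auto
    also have "bind_pmf \<nu> (\<lambda>y. X i + neg (U y)) = X i + neg (\<Sum>j<m. map_pmf (smul j) S)"
      unfolding bind_plus_pmf neg_bind_pmf[symmetric] bindU law_wsum ..
    also have "ent \<dots> \<le> ent S + 4 * (real m)\<^sup>2 * k"
      unfolding S_def k_def by (rule ent_X_minus_weighted_le[OF m fin i])
    finally show ?thesis .
  qed
  have lower: "(1 - \<eta>) * k \<le> (ent (V y) - ent (U y) + m * (ent (U y + neg (V y)) - ent (V y)))
      + \<eta> * (\<Sum>i<m. ent (X i + neg (U y)) - (ent (X i) + ent (U y)) / 2)" if y: "y \<in> set_pmf \<nu>" for y
  proof -
    have "set_pmf (U y) \<subseteq> sumset_pow (card (SIGMA x:I. {..<snd x})) A"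
    proof
      fix x assume "x \<in> set_pmf (U y)"
      moreover have "set_pmf (kern J y) \<subseteq> fst ` set_pmf J"
        using finite_set_kern(2)[OF finJ] y unfolding \<nu>_def by blast
      ultimately have "x \<in> fst ` fst ` set_pmf J" unfolding U_def set_map_pmf by blast
      then obtain w where "w \<in> set_pmf p" "x = wsum snd w" by (auto simp: J_def)
      then show "x \<in> sumset_pow (card (SIGMA x:I. {..<snd x})) A" using wsum_snd_mem by simp
    qed
    then have "(1 - \<eta>) * k \<le> multidist m (\<lambda>_. U y) + \<eta> * (\<Sum>i<m. rd (X i) (U y))"
      unfolding k_def using card_weights by (intro hyp) auto
    moreover have "multidist m (\<lambda>_. U y) \<le> ent (V y) - ent (U y) + m * (ent (U y + neg (V y)) - ent (V y))"
      using finU[OF y] m by (intro multidist_const_le) auto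
    ultimately show ?thesis by (simp add: rd_def)
  qed
  have "(1 - \<eta>) * k = expect \<nu> (\<lambda>y. (1 - \<eta>) * k)" by simp
  also have "\<dots> \<le> expect \<nu> (\<lambda>y. (ent (V y) - ent (U y) + m * (ent (U y + neg (V y)) - ent (V y)))
      + \<eta> * (\<Sum>i<m. ent (X i + neg (U y)) - (ent (X i) + ent (U y)) / 2))"
    by (rule integral_mono_AE) (use fin\<nu> lower in \<open>auto intro!: AE_pmfI\<close>)
  also have "\<dots> = m * (expect \<nu> (\<lambda>y. ent (U y + neg (V y))) - (ab - c))
      + \<eta> * (\<Sum>i<m. expect \<nu> (\<lambda>y. ent (X i + neg (U y))) - (ent (X i) + (ab - c)) / 2)"
    using fin\<nu> by (simp add: EU EV add_divide_distrib diff_diff_eq)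
  also have "\<dots> \<le> m * ((2 * a + 2 * b - 3 * rv_ent p ?W + c - 2 * ab) - (ab - c))
      + \<eta> * (\<Sum>i<m. (ent S + 4 * (real m)\<^sup>2 * k) - (ent (X i) + (ab - c)) / 2)"
    using EUV EX \<eta> by (intro add_mono mult_left_mono sum_mono diff_mono order.refl) auto
  also have "\<dots> \<le> m * (3 * t) + \<eta> * (\<Sum>i<m. (ent S + 4 * (real m)\<^sup>2 * k) - (ent (X i) + (ent S - 2 * k - t)) / 2)"
  proof (intro add_mono mult_left_mono sum_mono diff_mono order.refl)
    \<comment> \<open>The left side is exactly the sum of the three conditional mutual informations
      \<open>I12\<close>, \<open>I13\<close> and \<open>I23\<close>.\<close>
    show "(2 * a + 2 * b - 3 * rv_ent p ?W + c - 2 * ab) - (ab - c) \<le> 3 * t"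
      using I12 I13 I23 by linarith
    \<comment> \<open>\<open>ab - c\<close> is the entropy of \<open>?Z2\<close> given the third sum
      and the total; by \<open>I23\<close> it is at most \<open>t\<close> below the entropy given
      the total alone.\<close>
    show "(ent (X i) + (ent S - 2 * k - t)) / 2 \<le> (ent (X i) + (ab - c)) / 2" for i
      using I23 ent_wsum_given_total unfolding a_def[symmetric] by (simp add: divide_right_mono)
  qed (use \<eta> in auto)
  also have "(\<Sum>i<m. (ent S + 4 * (real m)\<^sup>2 * k) - (ent (X i) + (ent S - 2 * k - t)) / 2)
      = (\<Sum>i<m. ent S - ent (X i)) / 2 + m * (4 * (real m)\<^sup>2 * k + k + t / 2)"
    by (simp add: sum_subtractf sum.distrib sum_divide_distrib[symmetric] add_divide_distrib diff_divide_distrib algebra_simps)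
  also have "(\<Sum>i<m. ent S - ent (X i)) = m * k"
    unfolding S_def k_def by (rule sum_ent_gap[OF m fin])
  finally have main: "(1 - \<eta>) * k \<le> m * (3 * t) + \<eta> * (m * k / 2 + m * (4 * (real m)\<^sup>2 * k + k + t / 2))" .
  \<comment> \<open>Of the right side, \<open>27 / 50 * k\<close> comes from
    \<open>3 * m * t\<close> and \<open>4 / 50 * k\<close> from the distances; all other terms carry
    the factor \<open>\<eta> * M\<close>, at most 1/200. The 50 in \<eta> has to exceed 27 + 4 with
    a margin.\<close>
  define M where "M = real m"
  have M: "M \<ge> 2" using m by (simp add: M_def)
  have e: "\<eta> * M ^ 3 = 1 / 50" using M unfolding eta M_def by simp
  have M2: "M ^ 2 \<ge> 4" using power_mono[OF M, of 2] by simp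
  have em: "\<eta> * M \<le> 1 / 200"
  proof -
    have "\<eta> * M * 4 \<le> \<eta> * M * M ^ 2" using M2 M \<eta> by (intro mult_left_mono) auto
    also have "\<dots> = 1 / 50" using e by (simp add: power2_eq_square power3_eq_cube)
    finally show ?thesis by simp
  qed
  have e1: "\<eta> \<le> 1 / 400" using em mult_left_mono[OF M \<eta>] by simp
  have et: "t \<le> 9 / 50 * k"
  proof -
    have "M ^ 2 * \<eta> \<le> M ^ 3 * \<eta>" using M \<eta> by (intro mult_right_mono power_increasing) auto
    then have "M ^ 2 * \<eta> \<le> 1 / 50" using e by (simp add: mult.commute)
    then have "9 * (M ^ 2 * \<eta>) * k \<le> 9 * (1 / 50) * k" using k by (intro mult_right_mono mult_left_mono) auto
    then show ?thesis by (simp add: t_def M_def mult.assoc)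
  qed
  have t0: "0 \<le> t" using k \<eta> by (simp add: t_def)
  have mt: "M * (3 * t) = 27 / 50 * k"
    using e by (simp add: t_def M_def power2_eq_square power3_eq_cube)
  have "\<eta> * (M * k / 2 + M * (4 * M\<^sup>2 * k + k + t / 2)) = (\<eta> * M) * (3 / 2 * k + t / 2) + 4 * (\<eta> * M ^ 3) * k"
    by (simp add: power2_eq_square power3_eq_cube algebra_simps)
  also have "\<dots> \<le> 1 / 200 * (3 / 2 * k + 9 / 100 * k) + 4 * (1 / 50) * k"
    unfolding e using em et k \<eta> M t0 by (intro add_mono mult_mono) auto
  finally have "(1 - \<eta>) * k \<le> 27 / 50 * k + (1 / 200 * (3 / 2 * k + 9 / 100 * k) + 4 * (1 / 50) * k)"
    using main mt unfolding M_def by linarith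
  moreover have "(1 - 1 / 400) * k \<le> (1 - \<eta>) * k" using e1 k by (intro mult_right_mono) auto
  ultimately have "(1 - 1 / 400) * k \<le> 27 / 50 * k + (1 / 200 * (3 / 2 * k + 9 / 100 * k) + 4 * (1 / 50) * k)"
    by (rule order_trans[rotated])
  then show False using k by (simp add: field_simps)
qed

end

text \<open>\<open>endgame\<close> read backwards: for positive multidistance the standing
  hypothesis on the array must fail for some \<open>n\<close> and \<open>Y\<close>.\<close>

theorem multidist_decrement:
  fixes X :: "nat \<Rightarrow> 'g::ab_group_add pmf"
  assumes m: "2 \<le> m" and fin: "\<And>i. i < m \<Longrightarrow> finite (set_pmf (X i))"
    and supp: "\<And>i. i < m \<Longrightarrow> set_pmf (X i) \<subseteq> A"
    and tor: "\<And>x. x \<in> A \<Longrightarrow> smul m x = 0" and pos: "multidist m X > 0"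
  defines "\<eta> \<equiv> 1 / (50 * real m ^ 3)"
  obtains n Y where "1 \<le> n" "n \<le> m ^ 3" "\<And>i. i < m \<Longrightarrow> set_pmf (Y i) \<subseteq> sumset_pow n A"
    "multidist m Y + \<eta> * (\<Sum>i<m. rd (X i) (Y i)) < (1 - \<eta>) * multidist m X"
proof (rule ccontr)
  assume *: "\<not> thesis"
  have "multidist m X \<le> 0"
  proof (rule endgame[where \<eta> = \<eta> and A = A])
    fix n Y assume "1 \<le> n" "n \<le> m ^ 3" "\<And>i. i < m \<Longrightarrow> set_pmf (Y i) \<subseteq> sumset_pow n A"
    then show "(1 - \<eta>) * multidist m X \<le> multidist m Y + \<eta> * (\<Sum>i<m. rd (X i) (Y i))"
      using * that[of n Y] by fastforce
  qed (use assms in auto)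
  then show False using pos by simp
qed

section \<open>Iterating the decrement\<close>

lemma sumset_pow_mult: "sumset_pow a (sumset_pow b A) \<subseteq> sumset_pow (a * b) A"
proof
  fix x assume "x \<in> sumset_pow a (sumset_pow b A)"
  then obtain f where f: "x = (\<Sum>i<a. f i)" "\<forall>i<a. f i \<in> sumset_pow b A" by (auto simp: sumset_pow_def)
  then have "\<forall>i. \<exists>g. i < a \<longrightarrow> f i = (\<Sum>j<b. g j) \<and> (\<forall>j<b. g j \<in> A)" unfolding sumset_pow_def by blast
  then obtain g where g: "\<And>i. i < a \<Longrightarrow> f i = (\<Sum>j<b. g i j)" "\<And>i j. i < a \<Longrightarrow> j < b \<Longrightarrow> g i j \<in> A" by metis
  have "x = (\<Sum>z\<in>{..<a} \<times> {..<b}. g (fst z) (snd z))"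
    unfolding f using g by (simp add: sum.cartesian_product case_prod_unfold)
  also have "\<dots> \<in> sumset_pow (card ({..<a} \<times> {..<b})) A"
    by (rule sumset_powI) (use g in auto)
  finally show "x \<in> sumset_pow (a * b) A" by simp
qed

lemma finite_sumset_pow:
  assumes "finite A"
  shows "finite (sumset_pow n A)"
proof (rule finite_subset)
  show "sumset_pow n A \<subseteq> (\<lambda>f. \<Sum>i<n. f i) ` ({..<n} \<rightarrow>\<^sub>E A)"
  proof
    fix x assume "x \<in> sumset_pow n A"
    then obtain f where "x = (\<Sum>i<n. f i)" "\<forall>i<n. f i \<in> A" by (auto simp: sumset_pow_def)
    then show "x \<in> (\<lambda>f. \<Sum>i<n. f i) ` ({..<n} \<rightarrow>\<^sub>E A)"
      by (intro image_eqI[where x = "restrict f {..<n}"]) auto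
  qed
qed (use assms in \<open>auto intro!: finite_PiE\<close>)

lemma sumset_pow_torsion:
  assumes "\<And>x. x \<in> A \<Longrightarrow> smul m x = 0" "x \<in> sumset_pow n A"
  shows "smul m x = 0"
  using assms by (auto simp: sumset_pow_def smul_sum intro!: sum.neutral)

text \<open>The last clause is a potential that no step increases. It bounds the total drift from
  \<mu> by the initial multidistance, whatever the number of steps.\<close>

lemma multidist_iterate:
  fixes \<mu> :: "'g::ab_group_add pmf"
  assumes m: "2 \<le> m" and A: "finite A" "set_pmf \<mu> \<subseteq> A" and tor: "\<And>x. x \<in> A \<Longrightarrow> smul m x = 0" and \<theta>: "\<theta> > 0"
  defines "\<eta> \<equiv> 1 / (50 * real m ^ 3)" and "k\<^sub>0 \<equiv> multidist m (\<lambda>_. \<mu>)"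
  shows "\<exists>n Y. 1 \<le> n \<and> n \<le> m ^ (3 * N) \<and> (\<forall>i<m. set_pmf (Y i) \<subseteq> sumset_pow n A)
    \<and> multidist m Y \<le> max \<theta> ((1 - \<eta>) ^ N * k\<^sub>0)
    \<and> multidist m Y + \<eta> * (\<Sum>i<m. rd \<mu> (Y i)) \<le> k\<^sub>0 + \<eta> * (m * rd \<mu> \<mu>)"
proof (induction N)
  case 0
  show ?case
    by (rule exI[of _ 1], rule exI[of _ "\<lambda>_. \<mu>"]) (use A in \<open>auto simp: k\<^sub>0_def sumset_pow_1\<close>)
next
  case (Suc N)
  then obtain n Y where n: "1 \<le> n" "n \<le> m ^ (3 * N)" and Y: "\<And>i. i < m \<Longrightarrow> set_pmf (Y i) \<subseteq> sumset_pow n A"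
    and D: "multidist m Y \<le> max \<theta> ((1 - \<eta>) ^ N * k\<^sub>0)"
    and R: "multidist m Y + \<eta> * (\<Sum>i<m. rd \<mu> (Y i)) \<le> k\<^sub>0 + \<eta> * (m * rd \<mu> \<mu>)" by blast
  have "real m ^ 3 \<ge> 1" using m by simp
  then have m3: "0 < 50 * real m ^ 3" "1 \<le> 50 * real m ^ 3" by linarith+
  have \<eta>: "0 < \<eta>" "\<eta> \<le> 1" unfolding \<eta>_def divide_le_eq_1_pos[OF m3(1)] zero_less_divide_iff using m3 by auto
  have finA: "finite (sumset_pow n A)" for n by (rule finite_sumset_pow[OF A(1)])
  have fin: "finite (set_pmf (Y i))" if "i < m" for i using Y[OF that] finA finite_subset by blast
  have fin\<mu>: "finite (set_pmf \<mu>)" using A finite_subset by blast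
  show ?case
  \<comment> \<open>Below \<theta> the tuple is kept for good, as the decrement asks for positive
    multidistance.\<close>
  proof (cases "multidist m Y \<le> \<theta>")
    case True
    moreover have "m ^ (3 * N) \<le> m ^ (3 * Suc N)" using m by (intro power_increasing) auto
    ultimately show ?thesis using n Y R by (intro exI[of _ n] exI[of _ Y]) auto
  next
    case False
    then have pos: "multidist m Y > 0" and D': "multidist m Y \<le> (1 - \<eta>) ^ N * k\<^sub>0" using \<theta> D by auto
    obtain n' Z where n': "1 \<le> n'" "n' \<le> m ^ 3" and Z: "\<And>i. i < m \<Longrightarrow> set_pmf (Z i) \<subseteq> sumset_pow n' (sumset_pow n A)"
      and dec: "multidist m Z + \<eta> * (\<Sum>i<m. rd (Y i) (Z i)) < (1 - \<eta>) * multidist m Y"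
    proof (rule multidist_decrement[OF m fin Y _ pos])
      show "smul m x = 0" if "x \<in> sumset_pow n A" for x using sumset_pow_torsion[OF tor that] .
    qed (auto simp: \<eta>_def)
    have Z': "set_pmf (Z i) \<subseteq> sumset_pow (n' * n) A" if "i < m" for i
      using Z[OF that] sumset_pow_mult by blast
    have finZ: "finite (set_pmf (Z i))" if "i < m" for i using Z'[OF that] finA finite_subset by blast
    have "0 \<le> (\<Sum>i<m. rd (Y i) (Z i))" using fin finZ by (intro sum_nonneg rd_ent_diff) auto
    then have nn: "0 \<le> \<eta> * (\<Sum>i<m. rd (Y i) (Z i))" using \<eta> by simp
    have "multidist m Z \<le> (1 - \<eta>) * multidist m Y" using dec nn by linarith
    also have "\<dots> \<le> (1 - \<eta>) * ((1 - \<eta>) ^ N * k\<^sub>0)" using D' \<eta> by (intro mult_left_mono) auto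
    finally have 1: "multidist m Z \<le> (1 - \<eta>) ^ Suc N * k\<^sub>0" by simp
    have "(\<Sum>i<m. rd \<mu> (Z i)) \<le> (\<Sum>i<m. rd \<mu> (Y i) + rd (Y i) (Z i))"
      using fin finZ fin\<mu> by (intro sum_mono rd_triangle) auto
    from mult_left_mono[OF this, of \<eta>] \<eta> have "\<eta> * (\<Sum>i<m. rd \<mu> (Z i)) \<le> \<eta> * (\<Sum>i<m. rd \<mu> (Y i)) + \<eta> * (\<Sum>i<m. rd (Y i) (Z i))"
      by (simp add: sum.distrib distrib_left)
    \<comment> \<open>The step pays \<open>\<eta> * (\<Sum>i<m. rd (Y i) (Z i))\<close> out of the
      drop in multidistance, and by the triangle inequality this covers the new distance to
      \<mu>.\<close>
    moreover have "(1 - \<eta>) * multidist m Y \<le> multidist m Y" using \<eta> pos by (simp add: algebra_simps)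
    ultimately have 2: "multidist m Z + \<eta> * (\<Sum>i<m. rd \<mu> (Z i)) \<le> k\<^sub>0 + \<eta> * (m * rd \<mu> \<mu>)"
      using dec R by linarith
    have 3: "n' * n \<le> m ^ (3 * Suc N)" using mult_mono[OF n'(2) n(2)] by (simp add: power_add[symmetric])
    have 4: "1 \<le> n' * n" using n n' by simp
    show ?thesis
      by (rule exI[of _ "n' * n"], rule exI[of _ Z]) (use 1 2 3 4 Z' in auto)
  qed
qed

lemma ent_pmf_of_set_add:
  fixes A :: "'g::ab_group_add set" and K :: real
  assumes A: "finite A" "A \<noteq> {}" and K: "real (card {x + y | x y. x \<in> A \<and> y \<in> A}) \<le> K * card A"
  shows "ent (pmf_of_set A + pmf_of_set A) \<le> ln K + ln (card A)" "K > 0"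
proof -
  let ?AA = "{x + y | x y. x \<in> A \<and> y \<in> A}"
  have AA: "?AA = (\<lambda>z. fst z + snd z) ` (A \<times> A)" by force
  have fin: "finite ?AA" unfolding AA using A by auto
  have "?AA \<noteq> {}" using A by blast
  then have c: "card ?AA > 0" using fin by (simp add: card_gt_0_iff)
  have cA: "card A > 0" using A by (simp add: card_gt_0_iff)
  have "0 < K * card A" using K c by linarith
  then show K0: "K > 0" using cA by (simp add: zero_less_mult_iff)
  have "ent (pmf_of_set A + pmf_of_set A) \<le> ln (card ?AA)"
    by (rule ent_le_ln_card[OF fin]) (use A in \<open>auto simp: set_plus_pmf AA\<close>)
  also have "\<dots> \<le> ln (K * card A)" using K c K0 cA by (intro ln_mono) auto
  also have "\<dots> = ln K + ln (card A)" using K0 cA by (simp add: ln_mult)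
  finally show "ent (pmf_of_set A + pmf_of_set A) \<le> ln K + ln (card A)" .
qed

lemma card_le_sumset:
  fixes A :: "'g::ab_group_add set"
  assumes A: "finite A" "A \<noteq> {}"
  shows "card A \<le> card {x + y | x y. x \<in> A \<and> y \<in> A}"
proof -
  obtain a where a: "a \<in> A" using A by auto
  have "{x + y | x y. x \<in> A \<and> y \<in> A} = (\<lambda>z. fst z + snd z) ` (A \<times> A)" by force
  then have fin: "finite {x + y | x y. x \<in> A \<and> y \<in> A}" using A by simp
  have "card A = card ((\<lambda>x. x + a) ` A)" by (intro card_image[symmetric]) auto
  also have "\<dots> \<le> card {x + y | x y. x \<in> A \<and> y \<in> A}" using a by (intro card_mono fin) auto
  finally show ?thesis .
qed

text \<open>With \<open>M = 2 + m L\<close>, both \<open>m / 32768\<close> and \<open>m L\<close>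
  are at most \<open>M\<close>, and the numerical factor is at most \<open>2^32\<close>, hence at
  most \<open>M^32\<close>; so \<open>q\<close> is at most \<open>M^34\<close>. The rounding term 1
  raises 50 to 51, and \<open>3 * 51 * 34 = 5202\<close>.\<close>

lemma step_count_bound:
  fixes m N :: nat and L :: real
  assumes m: "2 \<le> m" and L: "L \<ge> 1 / 32768"
    and N: "real N \<le> 50 * real m ^ 3 * ln (5 * (real m)\<^sup>2 * L * 16384) + 1"
  shows "real (m ^ (3 * N)) \<le> (2 + real m * L) powr (5202 * real m ^ 3 * ln (real m))"
proof -
  define M where "M = 2 + real m * L"
  define q where "q = 5 * (real m)\<^sup>2 * L * 16384"
  have mL: "0 < real m * L" using m L by simp
  have M: "M \<ge> 2" using mL by (simp add: M_def)
  have m': "real m \<le> 32768 * M" 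
  proof -
    have "real m * (1 / 32768) \<le> real m * L" using L by (intro mult_left_mono) auto
    then show ?thesis by (simp add: M_def)
  qed
  have "q = 5 * 16384 * (real m * (real m * L))" by (simp add: q_def power2_eq_square)
  also have "\<dots> \<le> 5 * 16384 * ((32768 * M) * M)"
    using m' mL M by (intro mult_left_mono mult_mono) (auto simp: M_def)
  also have "\<dots> \<le> 2 ^ 32 * M ^ 2" by (simp add: power2_eq_square)
  also have "\<dots> \<le> M ^ 32 * M ^ 2" using M by (intro mult_right_mono power_mono) auto
  finally have q_le: "q \<le> M ^ 34" by (simp flip: power_add)
  have q_ge: "q \<ge> 10"
  proof -
    have "(real m)\<^sup>2 \<ge> 4" using power_mono[of 2 "real m" 2] m by simp
    then have "4 * (1 / 32768) \<le> (real m)\<^sup>2 * L" using L by (intro mult_mono) auto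
    then show ?thesis by (simp add: q_def mult_ac)
  qed
  have lnq1: "1 \<le> ln q"
  proof -
    have "exp 1 \<le> (3::real)" by (rule exp_le)
    then show ?thesis using q_ge by (subst ln_ge_iff) auto
  qed
  have lnq2: "ln q \<le> 34 * ln M"
  proof -
    have "ln q \<le> ln (M ^ 34)" using q_le q_ge by (intro ln_mono) auto
    then show ?thesis using M by (simp add: ln_realpow)
  qed
  have m3: "real m ^ 3 \<ge> 1" using m by simp
  have "1 \<le> real m ^ 3 * ln q" using mult_mono[OF m3 lnq1] by simp
  then have "real N \<le> 51 * (real m ^ 3 * ln q)" using N by (simp add: q_def)
  also have "\<dots> \<le> 51 * (real m ^ 3 * (34 * ln M))"
    using lnq2 by (intro mult_left_mono) auto
  finally have N': "real N \<le> 1734 * real m ^ 3 * ln M" by (simp add: mult_ac)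
  have "real (m ^ (3 * N)) = real m powr real (3 * N)"
    using m by (subst powr_realpow) auto
  also have "\<dots> = exp (real (3 * N) * ln (real m))" using m by (simp add: powr_def)
  also have "\<dots> \<le> exp (5202 * real m ^ 3 * ln M * ln (real m))"
  proof -
    have "real (3 * N) \<le> 3 * (1734 * real m ^ 3 * ln M)" using N' by linarith
    from mult_right_mono[OF this, of "ln (real m)"]
    have "real (3 * N) * ln (real m) \<le> (3 * (1734 * real m ^ 3 * ln M)) * ln (real m)" using m by simp
    then show ?thesis by simp
  qed
  also have "\<dots> = M powr (5202 * real m ^ 3 * ln (real m))" using M by (simp add: powr_def mult_ac)
  finally show ?thesis by (simp add: M_def)
qed

text \<open>If the uniform law on \<open>A\<close> already has tiny doubling it is taken itself.
  Otherwise \<open>ln K\<close> is bounded below, so that the logarithm of the ratio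
  \<open>q\<close> is at least of constant size and rounding the number of steps is
  harmless.\<close>

theorem entropic_approximation:
  fixes A :: "'g::ab_group_add set" and K :: real
  assumes m: "2 \<le> m" and A: "finite A" "A \<noteq> {}" and tor: "\<And>x. x \<in> A \<Longrightarrow> smul m x = 0"
    and K: "real (card {x + y | x y. x \<in> A \<and> y \<in> A}) \<le> K * card A"
  obtains n \<nu> where "1 \<le> n" "real n \<le> (2 + real m * ln K) powr (5202 * real m ^ 3 * ln (real m))"
    "set_pmf \<nu> \<subseteq> sumset_pow n A" "rd \<nu> \<nu> \<le> 1 / 16384" "rd (pmf_of_set A) \<nu> \<le> 52 * real m ^ 3 * ln K + 1"
proof -
  define \<mu> where "\<mu> = pmf_of_set A"
  define L where "L = ln K"
  have fin\<mu>: "finite (set_pmf \<mu>)" and set\<mu>: "set_pmf \<mu> = A" using A by (auto simp: \<mu>_def)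
  have e\<mu>: "ent \<mu> = ln (card A)" unfolding \<mu>_def using A by (rule ent_pmf_of_set)
  have cA: "card A > 0" using A by (simp add: card_gt_0_iff)
  have add: "ent (\<mu> + \<mu>) \<le> L + ent \<mu>" using ent_pmf_of_set_add(1)[OF A K] e\<mu> by (simp add: \<mu>_def L_def)
  have L0: "L \<ge> 0" using add ent_le_add[OF fin\<mu> fin\<mu>] by linarith
  have r\<mu>: "rd \<mu> \<mu> \<le> 2 * L"
    using ruzsa_triangle[OF fin\<mu> fin\<mu> finite_set_neg[OF fin\<mu>]] add fin\<mu> ent_neg[of "\<mu> + \<mu>"] by (simp add: rd_def neg_add)
  have M1: "1 \<le> (2 + real m * L) powr (5202 * real m ^ 3 * ln (real m))"
    using m L0 by (intro ge_one_powr_ge_zero) (auto intro!: mult_nonneg_nonneg)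
  show ?thesis
  proof (cases "rd \<mu> \<mu> \<le> 1 / 16384")
    case True
    show ?thesis
    proof (rule that[of 1 \<mu>])
      have "0 \<le> 52 * real m ^ 3 * L" using L0 by simp
      then show "rd (pmf_of_set A) \<mu> \<le> 52 * real m ^ 3 * ln K + 1" using True unfolding \<mu>_def[symmetric] L_def by linarith
    qed (use True M1 in \<open>auto simp: L_def set\<mu> sumset_pow_1\<close>)
  next
    case False
    then have L: "L \<ge> 1 / 32768" using r\<mu> by simp
    define \<eta> where "\<eta> = 1 / (50 * real m ^ 3)"
    \<comment> \<open>One component satisfies
      \<open>rd (Y i) (Y i) \<le> (m + 4) * multidist m Y\<close>, at most \<open>5 * m\<close>
      times the multidistance; \<theta> makes this 1/16384.\<close>
    define \<theta> where "\<theta> = 1 / (16384 * (5 * real m))"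
    \<comment> \<open>The ratio of the initial bound \<open>m * L\<close> to \<theta>: the factor by
      which the multidistance must shrink.\<close>
    define q where "q = 5 * (real m)\<^sup>2 * L * 16384"
    define N where "N = nat \<lceil>50 * real m ^ 3 * ln q\<rceil>"
    define k\<^sub>0 where "k\<^sub>0 = multidist m (\<lambda>_. \<mu>)"
    have \<theta>: "\<theta> > 0" using m by (simp add: \<theta>_def)
    have m3: "real m ^ 3 \<ge> 1" using m by simp
    then have m3': "0 < 50 * real m ^ 3" "1 < 50 * real m ^ 3" by linarith+
    have \<eta>: "0 < \<eta>" "\<eta> < 1" unfolding \<eta>_def divide_less_eq_1_pos[OF m3'(1)] zero_less_divide_iff using m3' by auto
    have q: "q > 0" "\<theta> * q = m * L" using m L by (auto simp: q_def \<theta>_def power2_eq_square)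
    have q1: "1 \<le> q"
    proof -
      have "(real m)\<^sup>2 \<ge> 4" using power_mono[of 2 "real m" 2] m by simp
      then have "4 * (1 / 32768) \<le> (real m)\<^sup>2 * L" using L by (intro mult_mono) auto
      then show ?thesis by (simp add: q_def)
    qed
    have N_ge: "50 * real m ^ 3 * ln q \<le> N" unfolding N_def by linarith
    have N_le: "real N \<le> 50 * real m ^ 3 * ln q + 1"
    proof -
      have "0 \<le> 50 * real m ^ 3 * ln q" using q1 by (intro mult_nonneg_nonneg) auto
      then show ?thesis unfolding N_def by linarith
    qed
    obtain n Y where n: "1 \<le> n" "n \<le> m ^ (3 * N)" and Y: "\<And>i. i < m \<Longrightarrow> set_pmf (Y i) \<subseteq> sumset_pow n A"
      and D: "multidist m Y \<le> max \<theta> ((1 - \<eta>) ^ N * k\<^sub>0)"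
      and R: "multidist m Y + \<eta> * (\<Sum>i<m. rd \<mu> (Y i)) \<le> k\<^sub>0 + \<eta> * (m * rd \<mu> \<mu>)"
      using multidist_iterate[OF m A(1), of \<mu> \<theta> N] tor \<theta> unfolding \<eta>_def k\<^sub>0_def set\<mu> by blast
    have fin: "finite (set_pmf (Y i))" if "i < m" for i
      using Y[OF that] finite_sumset_pow[OF A(1)] finite_subset by blast
    have k0: "k\<^sub>0 \<le> m * L"
    proof -
      have "k\<^sub>0 \<le> ent (neg \<mu>) - ent \<mu> + m * (ent (\<mu> + neg (neg \<mu>)) - ent (neg \<mu>))"
        unfolding k\<^sub>0_def by (rule multidist_const_le) (use fin\<mu> m in auto)
      also have "\<dots> \<le> m * L" using add fin\<mu> by (simp add: mult_left_mono)
      finally show ?thesis .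
    qed
    have "(1 - \<eta>) ^ N * k\<^sub>0 \<le> \<theta>"
    proof -
      have "(1 - \<eta>) ^ N \<le> exp (- \<eta>) ^ N" using \<eta> exp_ge_add_one_self[of "- \<eta>"] by (intro power_mono) auto
      also have "\<dots> = exp (- (\<eta> * N))" by (simp add: exp_of_nat_mult[symmetric] mult.commute)
      also have "\<dots> \<le> exp (- ln q)"
      proof -
        have "\<eta> * (50 * real m ^ 3 * ln q) \<le> \<eta> * N" using N_ge \<eta> by (intro mult_left_mono) auto
        moreover have "\<eta> * (50 * real m ^ 3 * ln q) = ln q" using m by (simp add: \<eta>_def)
        ultimately show ?thesis by simp
      qed
      also have "\<dots> = 1 / q" using q by (simp add: exp_minus field_simps)
      finally have "(1 - \<eta>) ^ N \<le> 1 / q" .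
      from mult_right_mono[OF this, of "m * L"] have "(1 - \<eta>) ^ N * (m * L) \<le> 1 / q * (m * L)" using L0 by simp
      moreover have "(1 - \<eta>) ^ N * k\<^sub>0 \<le> (1 - \<eta>) ^ N * (m * L)"
        using k0 \<eta> by (intro mult_left_mono) auto
      moreover have "1 / q * (m * L) = \<theta>" using q by (simp add: field_simps)
      ultimately show ?thesis by linarith
    qed
    then have D: "multidist m Y \<le> \<theta>" using D by simp
    have nonneg: "0 \<le> multidist m Y" by (rule multidist_nonneg[OF m fin])
    \<comment> \<open>Otherwise the distances alone would cost \<open>52 / 50 * m * L\<close>, while
      the initial potential is at most \<open>(1 + 1 / 200) * m * L\<close>.\<close>
    have "\<exists>i<m. rd \<mu> (Y i) \<le> 52 * real m ^ 3 * L"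
    proof (rule ccontr)
      assume "\<not> ?thesis"
      then have "(\<Sum>i<m. 52 * real m ^ 3 * L) \<le> (\<Sum>i<m. rd \<mu> (Y i))" by (intro sum_mono) (auto simp: not_le less_imp_le)
      from mult_left_mono[OF this, of \<eta>] \<eta>
      have "\<eta> * (m * (52 * real m ^ 3 * L)) \<le> \<eta> * (\<Sum>i<m. rd \<mu> (Y i))" by simp
      also have "\<dots> \<le> m * L + \<eta> * (m * (2 * L))"
      proof -
        have "\<eta> * (m * rd \<mu> \<mu>) \<le> \<eta> * (m * (2 * L))" using \<eta> r\<mu> by (intro mult_left_mono) auto
        then show ?thesis using R k0 nonneg by linarith
      qed
      finally have "\<eta> * (m * (52 * real m ^ 3 * L)) \<le> m * L + \<eta> * (m * (2 * L))" .
      moreover have "\<eta> * (m * (52 * real m ^ 3 * L)) = m * L * (52 / 50)" using m by (simp add: \<eta>_def)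
      moreover have "\<eta> \<le> 1 / 400"
      proof -
        have "real m ^ 3 \<ge> 8" using power_mono[of 2 "real m" 3] m by simp
        then show ?thesis by (simp add: \<eta>_def divide_le_eq)
      qed
      then have "\<eta> * (m * (2 * L)) \<le> 1 / 400 * (m * (2 * L))" using L0 by (intro mult_right_mono) auto
      ultimately have "m * L * (52 / 50) \<le> m * L + 1 / 400 * (m * (2 * L))" by linarith
      moreover have "0 < m * L" using m L by simp
      ultimately show False by linarith
    qed
    then obtain i where i: "i < m" "rd \<mu> (Y i) \<le> 52 * real m ^ 3 * L" by blast
    show ?thesis
    proof (rule that[of n "Y i"])
      have "real n \<le> real (m ^ (3 * N))" using n by (simp only: of_nat_le_iff)
      also have "\<dots> \<le> (2 + real m * L) powr (5202 * real m ^ 3 * ln (real m))"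
        by (rule step_count_bound[OF m L]) (use N_le in \<open>simp add: q_def\<close>)
      finally show "real n \<le> (2 + real m * ln K) powr (5202 * real m ^ 3 * ln (real m))" by (simp add: L_def)
      show "rd (pmf_of_set A) (Y i) \<le> 52 * real m ^ 3 * ln K + 1" using i by (simp add: \<mu>_def L_def)
      have "ent (\<Sum>i<m. Y i) - ent (Y i) \<le> (\<Sum>i<m. ent (\<Sum>i<m. Y i) - ent (Y i))"
        by (rule member_le_sum) (use i ent_X_le[where X = Y, OF m fin] in auto)
      also have "\<dots> = m * multidist m Y" by (rule sum_ent_gap[OF m fin])
      finally have "ent (\<Sum>i<m. Y i) - ent (Y i) \<le> m * multidist m Y" .
      moreover have "ent (Y i + neg (Y i)) \<le> ent (\<Sum>i<m. Y i) + 4 * multidist m Y"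
        by (rule ent_X_minus_X_le[OF m fin i(1)])
      moreover have "1 * multidist m Y \<le> real m * multidist m Y" using m nonneg by (intro mult_right_mono) auto
      moreover have "real m * multidist m Y \<le> real m * \<theta>" using D by (intro mult_left_mono) auto
      moreover have "5 * (real m * \<theta>) = 1 / 16384" using m by (simp add: \<theta>_def)
      ultimately show "rd (Y i) (Y i) \<le> 1 / 16384" by (simp add: rd_def)
    qed (use n Y i in auto)
  qed
qed

section \<open>Distributions of very small doubling\<close>

definition is_subgroup :: "'g::ab_group_add set \<Rightarrow> bool" where
  "is_subgroup H \<longleftrightarrow> 0 \<in> H \<and> (\<forall>x\<in>H. \<forall>y\<in>H. x + y \<in> H) \<and> (\<forall>x\<in>H. - x \<in> H)"

text \<open>\<open>almost_period \<nu> \<kappa> h\<close> bounds by \<open>\<kappa>\<close> the total variation distance between \<open>\<nu>\<close> and its translate by \<open>h\<close>.\<close>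

definition almost_period :: "'g::ab_group_add pmf \<Rightarrow> real \<Rightarrow> 'g \<Rightarrow> bool" where
  "almost_period \<nu> \<kappa> h \<longleftrightarrow> (\<forall>B. prob \<nu> {x. x + h \<in> B} \<le> prob \<nu> B + \<kappa>)"

lemma almost_period_add:
  assumes "almost_period \<nu> \<kappa> h" "almost_period \<nu> \<kappa>' h'"
  shows "almost_period \<nu> (\<kappa> + \<kappa>') (h + h')"
  unfolding almost_period_def
proof
  fix B
  have "prob \<nu> {x. x + (h + h') \<in> B} = prob \<nu> {x. x + h \<in> {y. y + h' \<in> B}}"
    by (simp add: add.assoc)
  moreover have "prob \<nu> {x. x + h \<in> {y. y + h' \<in> B}} \<le> prob \<nu> {y. y + h' \<in> B} + \<kappa>"
    using assms(1) unfolding almost_period_def by blast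
  moreover have "prob \<nu> {y. y + h' \<in> B} \<le> prob \<nu> B + \<kappa>'"
    using assms(2) unfolding almost_period_def by blast
  ultimately show "prob \<nu> {x. x + (h + h') \<in> B} \<le> prob \<nu> B + (\<kappa> + \<kappa>')"
    by linarith
qed

text \<open>Pinsker-type estimate, with the loss of a constant factor: compare \<open>p\<close> with the measure of
  density \<open>exp (\<lambda> 1\<^sub>B)\<close> with respect to \<open>q\<close>.\<close>

lemma prob_le_divergence:
  fixes p q :: "'a pmf"
  assumes fin: "finite (set_pmf p)" and supp: "set_pmf p \<subseteq> set_pmf q"
  defines "KL \<equiv> \<Sum>x\<in>set_pmf p. pmf p x * (ln (pmf p x) - ln (pmf q x))"
  shows "prob p B \<le> prob q B + 32 * KL + 1 / 32" "0 \<le> KL"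
proof -
  have main: "l * prob p B \<le> KL + (exp l - 1) * prob q B" if l: "l \<ge> 0" for l :: real
  proof -
    let ?i = "\<lambda>x. if x \<in> B then l else 0"
    have pB: "prob p B = (\<Sum>x\<in>set_pmf p. if x \<in> B then pmf p x else 0)"
      using fin by (simp add: measure_Int_set_pmf[of p B, symmetric] measure_measure_pmf_finite sum.inter_restrict[symmetric] Int_commute)
    have "l * prob p B - KL = (\<Sum>x\<in>set_pmf p. pmf p x * (ln (pmf q x) - ln (pmf p x) + ?i x))"
      unfolding pB KL_def sum_distrib_left sum_subtractf[symmetric] by (intro sum.cong) (auto simp: algebra_simps)
    also have "\<dots> \<le> (\<Sum>x\<in>set_pmf p. pmf q x * exp (?i x) - pmf p x)"
    proof (intro sum_mono)
      fix x assume x: "x \<in> set_pmf p"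
      then have pos: "pmf p x > 0" "pmf q x > 0" using supp by (auto simp: pmf_positive_iff)
      have "ln (pmf q x) - ln (pmf p x) + ?i x = ln (pmf q x * exp (?i x) / pmf p x)"
        using pos by (simp add: ln_mult ln_div)
      also have "\<dots> \<le> pmf q x * exp (?i x) / pmf p x - 1"
        using pos by (intro ln_le_minus_one) auto
      finally show "pmf p x * (ln (pmf q x) - ln (pmf p x) + ?i x) \<le> pmf q x * exp (?i x) - pmf p x"
        using pos by (simp add: field_simps)
    qed
    also have "\<dots> = (\<Sum>x\<in>set_pmf p. pmf q x) + (exp l - 1) * (\<Sum>x\<in>set_pmf p. if x \<in> B then pmf q x else 0) - 1"
      unfolding sum_subtractf sum_pmf_eq_1[OF fin order.refl] sum_distrib_left sum.distrib[symmetric]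
      by (intro arg_cong2[of _ _ _ _ "(-)"] sum.cong) (auto simp: algebra_simps)
    also have "(\<Sum>x\<in>set_pmf p. pmf q x) = prob q (set_pmf p)"
      using fin by (simp add: measure_measure_pmf_finite)
    also have "(\<Sum>x\<in>set_pmf p. if x \<in> B then pmf q x else 0) = prob q (set_pmf p \<inter> B)"
      using fin by (simp add: measure_measure_pmf_finite sum.inter_restrict)
    also have "prob q (set_pmf p) + (exp l - 1) * prob q (set_pmf p \<inter> B) - 1
        \<le> 1 + (exp l - 1) * prob q B - 1"
      using l by (intro add_mono diff_mono mult_left_mono measure_pmf.finite_measure_mono) auto
    finally show ?thesis by simp
  qed
  show "0 \<le> KL" using main[of 0] by simp
  \<comment> \<open>Exponent \<open>l = 1 / 32\<close>: dividing by \<open>l\<close> turns 33/1024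
    into \<open>1 + 1 / 32\<close>, whose excess over 1 is the additive error, and gives KL the
    factor 32.\<close>
  have "exp (1 / 32) - 1 \<le> (33 / 1024 :: real)" using exp_bound[of "1 / 32"] by (simp add: power2_eq_square)
  then have "(exp (1 / 32) - 1) * prob q B \<le> 33 / 1024 * prob q B"
    by (intro mult_right_mono) auto
  moreover have "1 / 32 * prob p B \<le> KL + (exp (1 / 32) - 1) * prob q B"
    by (rule main) simp
  moreover have "prob q B \<le> 1" by simp
  ultimately show "prob p B \<le> prob q B + 32 * KL + 1 / 32" by linarith
qed

lemma prob_compl: "prob p (- B) = 1 - prob p B"
  using measure_pmf.prob_compl[of B p] by (simp add: Compl_eq_Diff_UNIV)

section \<open>The subgroup of differences of typical points\<close>

context
  fixes \<nu> :: "'g::ab_group_add pmf" and Q KL Gd H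
  assumes fin: "finite (set_pmf \<nu>)" and small: "rd \<nu> \<nu> \<le> 1 / 16384"
  defines "Q \<equiv> \<nu> + neg \<nu>"
    and "KL \<equiv> \<lambda>a. \<Sum>x\<in>set_pmf \<nu>. pmf \<nu> x * (ln (pmf \<nu> x) - ln (pmf Q (x - a)))"
    and "Gd \<equiv> {a \<in> set_pmf \<nu>. (\<Sum>x\<in>set_pmf \<nu>. pmf \<nu> x * (ln (pmf \<nu> x) - ln (pmf (\<nu> + neg \<nu>) (x - a)))) \<le> 1 / 1024}"
    and "H \<equiv> {b - a | a b. a \<in> Gd \<and> b \<in> Gd}"
begin

text \<open>\<open>KL a\<close> is the divergence of the translate of \<nu> by \<open>-a\<close>
  from the law \<open>Q\<close> of the difference of two independent copies.\<close>

lemma KL_shift: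
  assumes a: "a \<in> set_pmf \<nu>"
  shows "0 \<le> KL a" "prob \<nu> {x. x - a \<in> B} \<le> prob Q B + 32 * KL a + 1 / 32"
proof -
  let ?p = "map_pmf (\<lambda>x. x - a) \<nu>"
  have inj: "inj (\<lambda>x. x - a)" by (auto simp: inj_on_def)
  have fp: "finite (set_pmf ?p)" using fin by simp
  have sub: "set_pmf ?p \<subseteq> set_pmf Q"
    using a by (force simp: Q_def set_plus_pmf set_neg)
  have "(\<Sum>x\<in>set_pmf ?p. pmf ?p x * (ln (pmf ?p x) - ln (pmf Q x))) = KL a"
    unfolding KL_def set_map_pmf by (subst sum.reindex) (auto simp: inj_on_def pmf_map_inj'[OF inj])
  then show "0 \<le> KL a" "prob \<nu> {x. x - a \<in> B} \<le> prob Q B + 32 * KL a + 1 / 32"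
    using prob_le_divergence(1)[OF fp sub, of B] prob_le_divergence(2)[OF fp sub] by (simp_all add: vimage_def)
qed

text \<open>For independent \<open>x\<close> and \<open>a\<close> of law \<nu>, both sides are the
  mutual information of \<open>x - a\<close> and \<open>a\<close>.\<close>

lemma expectation_KL: "(\<Sum>a\<in>set_pmf \<nu>. pmf \<nu> a * KL a) = rd \<nu> \<nu>"
proof -
  let ?S = "set_pmf \<nu>"
  have "ent Q = expect (pair_pmf \<nu> \<nu>) (\<lambda>w. - ln (pmf Q (fst w - snd w)))"
  proof -
    have Q: "Q = map_pmf (\<lambda>w. fst w - snd w) (pair_pmf \<nu> \<nu>)"
      by (simp add: Q_def plus_pmf_def neg_def pair_map_pmf2 map_pmf_comp)
    have "finite (set_pmf Q)" using fin by (simp add: Q_def)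
    then have "ent Q = expect Q (\<lambda>x. - ln (pmf Q x))" by (rule ent_expectation)
    also have "\<dots> = expect (map_pmf (\<lambda>w. fst w - snd w) (pair_pmf \<nu> \<nu>)) (\<lambda>x. - ln (pmf Q x))"
      by (subst (1) Q) simp
    finally show ?thesis by (simp only: integral_map_pmf)
  qed
  also have "\<dots> = (\<Sum>w\<in>?S \<times> ?S. pmf (pair_pmf \<nu> \<nu>) w * - ln (pmf Q (fst w - snd w)))"
  proof -
    have "finite (set_pmf (pair_pmf \<nu> \<nu>))" using fin by simp
    from expectation_finite[OF this] show ?thesis by (simp only: set_pair_pmf)
  qed
  also have "\<dots> = (\<Sum>x\<in>?S. \<Sum>a\<in>?S. pmf \<nu> x * pmf \<nu> a * - ln (pmf Q (x - a)))"
    unfolding sum.cartesian_product by (intro sum.cong) (auto simp: pmf_pair)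
  also have "\<dots> = (\<Sum>a\<in>?S. \<Sum>x\<in>?S. pmf \<nu> x * pmf \<nu> a * - ln (pmf Q (x - a)))"
    by (rule sum.swap)
  finally have Q: "ent Q = (\<Sum>a\<in>?S. \<Sum>x\<in>?S. pmf \<nu> x * pmf \<nu> a * - ln (pmf Q (x - a)))" .
  have "(\<Sum>a\<in>?S. pmf \<nu> a * KL a) = (\<Sum>a\<in>?S. pmf \<nu> a * (\<Sum>x\<in>?S. pmf \<nu> x * ln (pmf \<nu> x))
      + (\<Sum>x\<in>?S. pmf \<nu> x * pmf \<nu> a * - ln (pmf Q (x - a))))"
    unfolding KL_def sum_distrib_left sum.distrib[symmetric] by (intro sum.cong refl) (simp add: algebra_simps)
  also have "\<dots> = (\<Sum>x\<in>?S. pmf \<nu> x * ln (pmf \<nu> x)) + ent Q"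
    unfolding sum.distrib Q[symmetric] sum_distrib_right[symmetric] sum_pmf_eq_1[OF fin order.refl] by simp
  also have "(\<Sum>x\<in>?S. pmf \<nu> x * ln (pmf \<nu> x)) = - ent \<nu>"
    by (simp add: ent_def sum_negf)
  finally show ?thesis by (simp add: rd_def Q_def)
qed

lemma Gd_eq: "Gd = {a \<in> set_pmf \<nu>. KL a \<le> 1 / 1024}"
  by (simp add: Gd_def KL_def Q_def)

text \<open>Markov's inequality: \<open>1024 / 16384 = 1 / 16\<close>.\<close>

lemma prob_Gd: "15 / 16 \<le> prob \<nu> Gd"
proof -
  let ?S = "set_pmf \<nu>"
  have "(\<Sum>a\<in>?S. if a \<in> - Gd then pmf \<nu> a * (1 / 1024) else 0) \<le> (\<Sum>a\<in>?S. pmf \<nu> a * KL a)"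
  proof (intro sum_mono)
    fix a assume a: "a \<in> ?S"
    show "(if a \<in> - Gd then pmf \<nu> a * (1 / 1024) else 0) \<le> pmf \<nu> a * KL a"
    proof (cases "a \<in> Gd")
      case True
      then show ?thesis using KL_shift(1)[OF a] by simp
    next
      case False
      then have "1 / 1024 \<le> KL a" using a by (simp add: Gd_eq)
      then have "pmf \<nu> a * (1 / 1024) \<le> pmf \<nu> a * KL a" by (intro mult_left_mono) auto
      then show ?thesis using False by simp
    qed
  qed
  then have "(\<Sum>a\<in>?S. if a \<in> - Gd then pmf \<nu> a * (1 / 1024) else 0) \<le> 1 / 16384"
    unfolding expectation_KL using small by simp
  moreover have "(\<Sum>a\<in>?S. if a \<in> - Gd then pmf \<nu> a * (1 / 1024) else 0) = prob \<nu> (- Gd) * (1 / 1024)"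
  proof -
    have "prob \<nu> (- Gd) = prob \<nu> (?S \<inter> - Gd)"
      by (simp add: Int_commute measure_Int_set_pmf)
    also have "\<dots> = (\<Sum>a\<in>?S. if a \<in> - Gd then pmf \<nu> a else 0)"
      using fin by (simp add: measure_measure_pmf_finite sum.inter_restrict)
    finally have "prob \<nu> (- Gd) * (1 / 1024) = (\<Sum>a\<in>?S. if a \<in> - Gd then pmf \<nu> a else 0) * (1 / 1024)"
      by simp
    also have "\<dots> = (\<Sum>a\<in>?S. if a \<in> - Gd then pmf \<nu> a * (1 / 1024) else 0)"
      unfolding sum_distrib_right by (intro sum.cong) auto
    finally show ?thesis ..
  qed
  ultimately show ?thesis by (simp add: prob_compl)
qed

text \<open>The error is \<open>32 / 1024 + 1 / 32\<close>; applying the one-sided bound to the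
  complement of \<open>B\<close> supplies the other side. All translates of \<nu> by typical points
  are thus close to the same \<open>Q\<close>, hence to each other.\<close>

lemma Gd_close:
  assumes "a \<in> Gd"
  shows "\<bar>prob \<nu> {x. x - a \<in> B} - prob Q B\<bar> \<le> 1 / 16"
proof -
  have a: "a \<in> set_pmf \<nu>" "KL a \<le> 1 / 1024" using assms by (auto simp: Gd_eq)
  have *: "{x. x - a \<in> - B} = - {x. x - a \<in> B}" by auto
  have "1 - prob \<nu> {x. x - a \<in> B} \<le> 1 - prob Q B + 32 * KL a + 1 / 32"
    using KL_shift(2)[OF a(1), of "- B"] unfolding * prob_compl .
  then show ?thesis
    unfolding abs_le_iff using KL_shift(2)[OF a(1), of B] a(2) by linarith
qed

lemma H_almost_period:
  assumes "h \<in> H"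
  shows "almost_period \<nu> (1 / 8) h"
proof -
  obtain a b where ab: "h = b - a" "a \<in> Gd" "b \<in> Gd" using assms by (auto simp: H_def)
  show ?thesis unfolding almost_period_def
  proof
    fix B
    define B' where "B' = {y. y + b \<in> B}"
    have "{x. x + h \<in> B} = {x. x - a \<in> B'}" "B = {x. x - b \<in> B'}"
      by (auto simp: ab B'_def algebra_simps)
    then have "prob \<nu> {x. x + h \<in> B} = prob \<nu> {x. x - a \<in> B'}"
        "prob \<nu> B = prob \<nu> {x. x - b \<in> B'}" by simp_all
    then show "prob \<nu> {x. x + h \<in> B} \<le> prob \<nu> B + 1 / 8"
      using Gd_close[OF ab(2), of B'] Gd_close[OF ab(3), of B'] by linarith
  qed
qed

text \<open>A gap phenomenon: the sum of two elements of \<open>H\<close> is an almost period with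
  the worse error 1/4, but this still forces \<open>Gd\<close> to meet its own translate because
  \<open>1 / 16 + 1 / 16 + 1 / 4 < 1\<close>. So the sum is again a difference of typical
  points.\<close>

lemma H_subgroup: "is_subgroup H"
proof -
  have "Gd \<noteq> {}" using prob_Gd by auto
  then have "0 \<in> H" by (force simp: H_def)
  moreover have "- h \<in> H" if h: "h \<in> H" for h
  proof -
    obtain a b where "h = b - a" "a \<in> Gd" "b \<in> Gd" using h by (auto simp: H_def)
    then show ?thesis unfolding H_def by (intro CollectI exI[of _ b] exI[of _ a]) auto
  qed
  moreover have "h + h' \<in> H" if h: "h \<in> H" "h' \<in> H" for h h'
  proof -
    have "almost_period \<nu> (1 / 8 + 1 / 8) (h + h')" using h by (intro almost_period_add H_almost_period)
    then have "almost_period \<nu> (1 / 4) (h + h')" by simp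
    then have "prob \<nu> {x. x + (h + h') \<in> - Gd} \<le> prob \<nu> (- Gd) + 1 / 4"
      unfolding almost_period_def by blast
    moreover have "prob \<nu> (- Gd \<union> {x. x + (h + h') \<in> - Gd})
        \<le> prob \<nu> (- Gd) + prob \<nu> {x. x + (h + h') \<in> - Gd}"
      by (rule measure_Un_le) auto
    ultimately have "prob \<nu> (- Gd \<union> {x. x + (h + h') \<in> - Gd}) < 1"
      using prob_Gd by (simp add: prob_compl)
    then have "- Gd \<union> {x. x + (h + h') \<in> - Gd} \<noteq> UNIV" by auto
    then obtain x where "x \<in> Gd" "x + (h + h') \<in> Gd" by auto
    then show ?thesis unfolding H_def by (intro CollectI exI[of _ x] exI[of _ "x + (h + h')"]) auto
  qed
  ultimately show ?thesis by (simp add: is_subgroup_def)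
qed

lemma finite_H: "finite H" and H_sub: "H \<subseteq> {x - y | x y. x \<in> set_pmf \<nu> \<and> y \<in> set_pmf \<nu>}"
proof -
  show sub: "H \<subseteq> {x - y | x y. x \<in> set_pmf \<nu> \<and> y \<in> set_pmf \<nu>}" by (auto simp: H_def Gd_eq)
  have "{x - y | x y. x \<in> set_pmf \<nu> \<and> y \<in> set_pmf \<nu>} = (\<lambda>z. fst z - snd z) ` (set_pmf \<nu> \<times> set_pmf \<nu>)" by force
  then have "finite {x - y | x y. x \<in> set_pmf \<nu> \<and> y \<in> set_pmf \<nu>}" using fin by simp
  then show "finite H" by (rule finite_subset[OF sub])
qed

text \<open>Let \<open>B\<close> be the set of heavy points. Averaged over the translates by
  \<open>H\<close>, the mass of \<open>B\<close> is at least \<open>prob \<nu> B - 1 / 8\<close> by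
  almost periodicity, and at most \<open>card B / card H\<close>, which is at most
  \<open>prob \<nu> B / 2\<close> by heaviness.\<close>

lemma prob_heavy: "prob \<nu> {x. pmf \<nu> x > 2 / card H} \<le> 1 / 4"
proof -
  define B where "B = {x \<in> set_pmf \<nu>. pmf \<nu> x > 2 / card H}"
  have finB: "finite B" using fin by (simp add: B_def)
  have "{x. pmf \<nu> x > 2 / card H} \<inter> set_pmf \<nu> = B" by (auto simp: B_def)
  then have PB: "prob \<nu> {x. pmf \<nu> x > 2 / card H} = prob \<nu> B"
    by (metis measure_Int_set_pmf)
  have c: "card H > 0" using finite_H H_subgroup by (auto simp: card_gt_0_iff is_subgroup_def)
  have "card B * (2 / card H) = (\<Sum>x\<in>B. 2 / card H)" by simp
  also have "\<dots> \<le> (\<Sum>x\<in>B. pmf \<nu> x)" by (intro sum_mono) (auto simp: B_def)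
  also have "\<dots> = prob \<nu> B" using finB by (simp add: measure_measure_pmf_finite)
  finally have cB: "real (card B) \<le> card H * prob \<nu> B / 2" using c by (simp add: field_simps)
  have "card H * (prob \<nu> B - 1 / 8) = (\<Sum>h\<in>H. prob \<nu> B - 1 / 8)" by simp
  also have "\<dots> \<le> (\<Sum>h\<in>H. prob \<nu> {x. x + h \<in> B})"
  proof (intro sum_mono)
    fix h assume "h \<in> H"
    then have "- h \<in> H" using H_subgroup by (auto simp: is_subgroup_def)
    from H_almost_period[OF this] have "prob \<nu> {x. x + - h \<in> {y. y + h \<in> B}} \<le> prob \<nu> {y. y + h \<in> B} + 1 / 8"
      unfolding almost_period_def by blast
    then show "prob \<nu> B - 1 / 8 \<le> prob \<nu> {x. x + h \<in> B}" by simp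
  qed
  also have "\<dots> = (\<Sum>h\<in>H. \<Sum>b\<in>B. pmf \<nu> (b - h))"
  proof (intro sum.cong refl)
    fix h
    have "{x. x + h \<in> B} = (\<lambda>b. b - h) ` B"
    proof (intro equalityI subsetI)
      fix x assume "x \<in> {x. x + h \<in> B}"
      then show "x \<in> (\<lambda>b. b - h) ` B" by (intro image_eqI[of _ _ "x + h"]) auto
    qed auto
    then show "prob \<nu> {x. x + h \<in> B} = (\<Sum>b\<in>B. pmf \<nu> (b - h))"
      using finB by (simp add: measure_measure_pmf_finite sum.reindex inj_on_def)
  qed
  also have "\<dots> = (\<Sum>b\<in>B. \<Sum>h\<in>H. pmf \<nu> (b - h))" by (rule sum.swap)
  also have "\<dots> \<le> (\<Sum>b\<in>B. 1)"
  proof (intro sum_mono)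
    fix b
    have "(\<Sum>h\<in>H. pmf \<nu> (b - h)) = prob \<nu> ((\<lambda>h. b - h) ` H)"
      using finite_H by (simp add: measure_measure_pmf_finite sum.reindex inj_on_def)
    then show "(\<Sum>h\<in>H. pmf \<nu> (b - h)) \<le> 1" by simp
  qed
  finally have "card H * (prob \<nu> B - 1 / 8) \<le> card B" by simp
  also have "\<dots> \<le> card H * (prob \<nu> B / 2)" using cB by simp
  finally have "prob \<nu> B - 1 / 8 \<le> prob \<nu> B / 2" using c by (simp add: mult_le_cancel_left)
  then show ?thesis unfolding PB by simp
qed

text \<open>\<open>Gd\<close> lies in the single coset \<open>a + H\<close>, and removing the heavy
  points leaves \<open>15 / 16 - 1 / 4\<close>.\<close>

lemma coset_concentration:
  obtains a where "1 / 2 \<le> prob \<nu> {x. x - a \<in> H \<and> pmf \<nu> x \<le> 2 / card H}"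
proof -
  have "Gd \<noteq> {}" using prob_Gd by auto
  then obtain a where a: "a \<in> Gd" by auto
  have "prob \<nu> Gd \<le> prob \<nu> ({x. x - a \<in> H \<and> pmf \<nu> x \<le> 2 / card H} \<union> {x. pmf \<nu> x > 2 / card H})"
    using a by (intro measure_pmf.finite_measure_mono) (auto simp: H_def not_le)
  also have "\<dots> \<le> prob \<nu> {x. x - a \<in> H \<and> pmf \<nu> x \<le> 2 / card H} + prob \<nu> {x. pmf \<nu> x > 2 / card H}"
    by (rule measure_Un_le) auto
  finally show ?thesis using that[of a] prob_Gd prob_heavy by linarith
qed

end

lemma small_doubling_subgroup:
  fixes \<nu> :: "'g::ab_group_add pmf"
  assumes fin: "finite (set_pmf \<nu>)" and small: "rd \<nu> \<nu> \<le> 1 / 16384"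
  obtains H a where "is_subgroup H" "finite H" "H \<subseteq> {x - y | x y. x \<in> set_pmf \<nu> \<and> y \<in> set_pmf \<nu>}"
    "1 / 2 \<le> prob \<nu> {x. x - a \<in> H \<and> pmf \<nu> x \<le> 2 / card H}"
  by (rule coset_concentration[OF fin small])
    (rule that[OF H_subgroup[OF fin small] finite_H[OF fin small] H_sub[OF fin small]])

text \<open>Revealing whether \<open>x\<close> lies in \<open>E\<close> is one bit and raises the
  average distance by at most \<open>ln 2 / 2\<close>. Distances are nonnegative and
  \<open>E\<close> has mass at least 1/2, so the distance given \<open>E\<close> is at most twice
  the average.\<close>

lemma rd_cond_le:
  fixes \<mu> \<nu> :: "'g::ab_group_add pmf"
  assumes fin: "finite (set_pmf \<mu>)" "finite (set_pmf \<nu>)" and E: "1 / 2 \<le> prob \<nu> E"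
  shows "rd \<mu> (cond_pmf \<nu> E) \<le> 2 * rd \<mu> \<nu> + ln 2"
proof -
  define J where "J = map_pmf (\<lambda>x. (x, x \<in> E)) \<nu>"
  define \<beta> where "\<beta> = map_pmf snd J"
  have finJ: "finite (set_pmf J)" using fin by (simp add: J_def)
  have fin\<beta>: "finite (set_pmf \<beta>)" by simp
  have entJ: "ent J = ent \<nu>" unfolding J_def using fin by (intro ent_map_inj) (auto simp: inj_on_def)
  have ent\<beta>: "ent \<beta> \<le> ln 2"
    using ent_le_ln_card[of "UNIV :: bool set" \<beta>, OF finite subset_UNIV] by (simp only: card_UNIV_bool of_nat_numeral)
  have fst: "map_pmf fst J = \<nu>" by (simp add: J_def map_pmf_comp)
  have finK: "finite (set_pmf (kern J y))" if "y \<in> set_pmf \<beta>" for y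
    using that finite_set_kern(1)[OF finJ] by (simp add: \<beta>_def)
  have "expect \<beta> (\<lambda>y. rd \<mu> (kern J y))
      = expect \<beta> (\<lambda>y. ent (\<mu> + neg (kern J y))) - (ent \<mu> + expect \<beta> (\<lambda>y. ent (kern J y))) / 2"
    by (simp add: rd_def add_divide_distrib diff_diff_eq)
  also have "\<dots> \<le> ent (\<mu> + neg \<nu>) - (ent \<mu> + (ent \<nu> - ln 2)) / 2"
    using expectation_ent_plus_kern_le[OF finJ fin(1)] expectation_ent_kern[OF finJ] ent\<beta>
    unfolding \<beta>_def[symmetric] fst entJ by (intro diff_mono divide_right_mono) auto
  finally have 1: "expect \<beta> (\<lambda>y. rd \<mu> (kern J y)) \<le> rd \<mu> \<nu> + ln 2 / 2"
    by (simp add: rd_def field_simps)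
  have pT: "pmf \<beta> True = prob \<nu> E"
    by (simp add: \<beta>_def J_def map_pmf_comp pmf_map vimage_def)
  then have T: "True \<in> set_pmf \<beta>" using E by (auto simp: set_pmf_iff)
  have "1 / 2 * rd \<mu> (kern J True) \<le> pmf \<beta> True * rd \<mu> (kern J True)"
    unfolding pT using E fin finK[OF T] by (intro mult_right_mono rd_ent_diff) auto
  also have "\<dots> \<le> (\<Sum>y\<in>set_pmf \<beta>. pmf \<beta> y * rd \<mu> (kern J y))"
    using T fin finK by (intro member_le_sum mult_nonneg_nonneg rd_ent_diff) auto
  also have "\<dots> = expect \<beta> (\<lambda>y. rd \<mu> (kern J y))"
    by (rule expectation_finite[OF fin\<beta>, symmetric])
  finally have "rd \<mu> (kern J True) \<le> 2 * rd \<mu> \<nu> + ln 2" using 1 by linarith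
  moreover have "kern J True = cond_pmf \<nu> E"
  proof -
    have "set_pmf \<nu> \<inter> (\<lambda>x. (x, x \<in> E)) -` {z. snd z = True} \<noteq> {}"
      using T by (auto simp: \<beta>_def J_def)
    from cond_map_pmf[OF this] show ?thesis by (simp add: kern_def J_def map_pmf_comp vimage_def)
  qed
  ultimately show ?thesis by simp
qed

section \<open>From distributions to sets\<close>

lemma ent_ge_of_pmf_le:
  assumes fin: "finite (set_pmf \<mu>)" and c: "c > 0" and le: "\<And>x. x \<in> set_pmf \<mu> \<Longrightarrow> pmf \<mu> x \<le> c"
  shows "- ln c \<le> ent \<mu>"
proof -
  have "- ln c = (\<Sum>x\<in>set_pmf \<mu>. pmf \<mu> x * - ln c)"
    unfolding sum_distrib_right[symmetric] sum_pmf_eq_1[OF fin order.refl] by simp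
  also have "\<dots> \<le> ent \<mu>"
    unfolding ent_def using le c by (intro sum_mono mult_left_mono) (auto simp: pmf_positive_iff)
  finally show ?thesis .
qed

text \<open>Take \<open>T\<close> of maximal size with the translates \<open>t + B\<close> pairwise
  disjoint; injectivity of the sum map on \<open>T \<times> B\<close> expresses the disjointness.
  Any further \<open>a + B\<close> then meets some \<open>t + B\<close>.\<close>

lemma ruzsa_covering:
  fixes A B :: "'g::ab_group_add set"
  assumes A: "finite A" and B: "finite B" "B \<noteq> {}"
  obtains T where "T \<subseteq> A" "card T * card B \<le> card {a + b | a b. a \<in> A \<and> b \<in> B}"
    "\<And>a. a \<in> A \<Longrightarrow> \<exists>t\<in>T. \<exists>b\<in>B. \<exists>b'\<in>B. a = t + (b - b')"
proof -
  let ?f = "\<lambda>z :: 'g \<times> 'g. fst z + snd z"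
  define \<T> where "\<T> = {T. T \<subseteq> A \<and> inj_on ?f (T \<times> B)}"
  have "\<T> \<subseteq> Pow A" by (auto simp: \<T>_def)
  then have "finite \<T>" using A by (simp add: finite_subset)
  moreover have "{} \<in> \<T>" by (simp add: \<T>_def)
  ultimately obtain T where T: "T \<in> \<T>" "\<And>T'. T' \<in> \<T> \<Longrightarrow> card T' \<le> card T"
    using Max_in[of "card ` \<T>"] Max_ge[of "card ` \<T>"] by (metis (no_types, lifting) empty_iff finite_imageI image_iff image_is_empty)
  have TA: "T \<subseteq> A" and inj: "inj_on ?f (T \<times> B)" using T(1) by (auto simp: \<T>_def)
  have finT: "finite T" using TA A finite_subset by blast
  show ?thesis
  proof (rule that[OF TA])
    have AB: "{a + b | a b. a \<in> A \<and> b \<in> B} = ?f ` (A \<times> B)" by force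
    have "card T * card B = card (?f ` (T \<times> B))" by (simp add: card_image[OF inj] card_cartesian_product)
    also have "\<dots> \<le> card (?f ` (A \<times> B))" using A B TA by (intro card_mono) auto
    finally show "card T * card B \<le> card {a + b | a b. a \<in> A \<and> b \<in> B}" unfolding AB .
    fix a assume a: "a \<in> A"
    show "\<exists>t\<in>T. \<exists>b\<in>B. \<exists>b'\<in>B. a = t + (b - b')"
    proof (cases "a \<in> T")
      case True
      obtain b where "b \<in> B" using B by auto
      then show ?thesis using True by (intro bexI[of _ a] bexI[of _ b]) auto
    next
      case False
      have "insert a T \<notin> \<T>" using T(2)[of "insert a T"] False finT by auto
      then have "\<not> inj_on ?f (insert a T \<times> B)" using a TA by (auto simp: \<T>_def)
      then obtain t b t' b' where 1: "t \<in> insert a T" "t' \<in> insert a T" "b \<in> B" "b' \<in> B"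
        and 2: "t + b = t' + b'" "(t, b) \<noteq> (t', b')" by (auto simp: inj_on_def)
      have "\<not> (t \<in> T \<and> t' \<in> T)"
        using inj_onD[OF inj, of "(t, b)" "(t', b')"] 1 2 by auto
      moreover have "t \<noteq> t'" using 2 by auto
      ultimately consider "t = a" "t' \<in> T" | "t' = a" "t \<in> T" using 1 by auto
      then show ?thesis
      proof cases
        case 1
        then have "a = t' + (b' - b)" using 2 by (simp add: algebra_simps)
        then show ?thesis using 1 \<open>b \<in> B\<close> \<open>b' \<in> B\<close> by blast
      next
        case 2
        then have "a = t + (b - b')" using \<open>t + b = t' + b'\<close> by (simp add: algebra_simps)
        then show ?thesis using 2 \<open>b \<in> B\<close> \<open>b' \<in> B\<close> by blast
      qed
    qed
  qed
qed

lemma subgroup_adjoin: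
  fixes H :: "'g::ab_group_add set"
  assumes H: "is_subgroup H" and m: "m > 0" and g: "smul m g = 0"
  defines "H' \<equiv> (\<lambda>z. smul (fst z) g + snd z) ` ({..<m} \<times> H)"
  shows "is_subgroup H'" "H \<subseteq> H'" "g \<in> H'"
proof -
  have mem: "smul i g + h \<in> H'" if "h \<in> H" for i h
  proof -
    have "smul i g + h = smul (i mod m) g + h" by (simp add: smul_mod[OF g])
    then show ?thesis unfolding H'_def using that m by (intro image_eqI[of _ _ "(i mod m, h)"]) auto
  qed
  have zero: "0 \<in> H" using H by (simp add: is_subgroup_def)
  show "H \<subseteq> H'" using mem[of _ 0] by auto
  show "g \<in> H'" using mem[OF zero, of 1] by (simp add: smul_Suc)
  have "x + y \<in> H'" if xy: "x \<in> H'" "y \<in> H'" for x y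
  proof -
    obtain i h j h' where "x = smul i g + h" "y = smul j g + h'" "h \<in> H" "h' \<in> H"
      using xy by (auto simp: H'_def)
    then have "x + y = smul (i + j) g + (h + h')" "h + h' \<in> H"
      using H by (auto simp: smul_add_left is_subgroup_def algebra_simps)
    then show ?thesis using mem by simp
  qed
  moreover have "- x \<in> H'" if x: "x \<in> H'" for x
  proof -
    obtain i h where ih: "x = smul i g + h" "i < m" "h \<in> H" using x by (auto simp: H'_def)
    have "smul i g + smul (m - i) g = 0" using ih(2) g smul_add_left[of i "m - i" g] by simp
    then have "- x = smul (m - i) g + - h" unfolding ih(1) by (simp add: add_eq_0_iff)
    moreover have "- h \<in> H" using H ih by (auto simp: is_subgroup_def)
    ultimately show ?thesis using mem[of "- h" "m - i"] by simp
  qed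
  moreover have "0 \<in> H'" using mem[OF zero, of 0] by simp
  ultimately show "is_subgroup H'" by (simp add: is_subgroup_def)
qed

text \<open>A largest subgroup of size at most \<open>N\<close>: adjoining one more element
  multiplies the size by at most \<open>m\<close>, by torsion, and must exceed \<open>N\<close>.
  This is how \<open>card H \<le> card A\<close> is arranged.\<close>

lemma subgroup_of_bounded_size:
  fixes H :: "'g::ab_group_add set"
  assumes H: "is_subgroup H" "finite H" and m: "m > 0" and tor: "\<And>x. x \<in> H \<Longrightarrow> smul m x = 0" and N: "1 \<le> N"
  obtains H' where "is_subgroup H'" "H' \<subseteq> H" "card H' \<le> N" "H' = H \<or> N \<le> m * card H'"
proof -
  define \<H> where "\<H> = {H'. is_subgroup H' \<and> H' \<subseteq> H \<and> card H' \<le> N}"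
  have "\<H> \<subseteq> Pow H" by (auto simp: \<H>_def)
  then have "finite \<H>" using H by (simp add: finite_subset)
  moreover have "{0} \<in> \<H>" using H N by (auto simp: \<H>_def is_subgroup_def)
  ultimately obtain H' where H': "H' \<in> \<H>" and max: "\<And>H''. H'' \<in> \<H> \<Longrightarrow> card H'' \<le> card H'"
    using Max_in[of "card ` \<H>"] Max_ge[of "card ` \<H>"] by (metis (no_types, lifting) empty_iff finite_imageI image_iff image_is_empty)
  have sub: "is_subgroup H'" "H' \<subseteq> H" "card H' \<le> N" using H' by (auto simp: \<H>_def)
  have "N \<le> m * card H'" if ne: "H' \<noteq> H"
  proof -
    obtain g where g: "g \<in> H" "g \<notin> H'" using sub ne by auto
    define H'' where "H'' = (\<lambda>z. smul (fst z) g + snd z) ` ({..<m} \<times> H')"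
    note adj = subgroup_adjoin[OF sub(1) m tor[OF g(1)], folded H''_def]
    have finH': "finite H'" using sub H finite_subset by blast
    have finH'': "finite H''" unfolding H''_def using finH' by simp
    have smul_H: "smul i g \<in> H" for i
      using H(1) g by (induction i) (auto simp: smul_Suc is_subgroup_def)
    have "H'' \<subseteq> H" using smul_H sub(2) H(1) by (auto simp: H''_def is_subgroup_def)
    moreover have "card H' < card H''"
      using adj g finH'' by (intro psubset_card_mono) auto
    ultimately have "N < card H''" using max[of H''] adj(1) by (force simp: \<H>_def)
    also have "card H'' \<le> card ({..<m} \<times> H')" unfolding H''_def using finH' by (intro card_image_le) auto
    finally show ?thesis by (simp add: card_cartesian_product)
  qed
  then show ?thesis using that[OF sub] by blast
qed

text \<open>\<nu> is nearly uniform on a coset of \<open>H\<close>. If \<open>A\<close> were thinly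
  spread over the cosets, the difference of the two laws would have no large atom, hence too much
  entropy for the given distance.\<close>

lemma large_coset_intersection:
  fixes A H :: "'g::ab_group_add set" and \<nu> :: "'g pmf"
  assumes A: "finite A" "A \<noteq> {}" and H: "finite H" "H \<noteq> {}"
    and fin: "finite (set_pmf \<nu>)" and supp: "\<And>x. x \<in> set_pmf \<nu> \<Longrightarrow> x - a\<^sub>0 \<in> H"
    and le: "\<And>x. x \<in> set_pmf \<nu> \<Longrightarrow> pmf \<nu> x \<le> 4 / card H" and r: "rd (pmf_of_set A) \<nu> \<le> r"
  shows "\<exists>x. card A \<le> 8 * exp (2 * r) * card {a \<in> A. a - x \<in> H}" "card H \<le> 4 * exp (2 * r) * card A"
proof -
  define \<mu> where "\<mu> = pmf_of_set A"
  have fin\<mu>: "finite (set_pmf \<mu>)" and set\<mu>: "set_pmf \<mu> = A" using A by (auto simp: \<mu>_def)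
  have cA: "card A > 0" and cH: "card H > 0" using A H by (auto simp: card_gt_0_iff)
  have e\<mu>: "ent \<mu> = ln (card A)" unfolding \<mu>_def using A by (rule ent_pmf_of_set)
  have "- ln (4 / card H) \<le> ent \<nu>" using cH le by (intro ent_ge_of_pmf_le[OF fin]) auto
  then have lower: "ln (card H) - ln 4 \<le> ent \<nu>" using cH by (simp add: ln_div)
  have upper: "ent \<nu> \<le> ln (card H)"
  proof -
    have "set_pmf \<nu> \<subseteq> (\<lambda>h. h + a\<^sub>0) ` H"
    proof
      fix x assume "x \<in> set_pmf \<nu>"
      then show "x \<in> (\<lambda>h. h + a\<^sub>0) ` H" using supp by (intro image_eqI[of _ _ "x - a\<^sub>0"]) auto
    qed
    from ent_le_ln_card[OF _ this] H show ?thesis by (simp add: card_image)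
  qed
  have diff: "\<bar>ln (card A) - ent \<nu>\<bar> \<le> 2 * r"
    using rd_ent_diff(1)[OF fin\<mu> fin] r unfolding e\<mu> \<mu>_def[symmetric] by linarith
  have "ln (card H) \<le> ln (4 * exp (2 * r) * card A)"
    using lower diff cA by (simp add: ln_mult)
  then show "card H \<le> 4 * exp (2 * r) * card A" using cA cH by (subst (asm) ln_le_cancel_iff) auto
  show "\<exists>x. card A \<le> 8 * exp (2 * r) * card {a \<in> A. a - x \<in> H}"
  proof (rule ccontr)
    assume "\<not> ?thesis"
    then have small: "8 * exp (2 * r) * card {a \<in> A. a - x \<in> H} < card A" for x by (simp add: not_le)
    let ?D = "\<mu> + neg \<nu>" and ?S = "set_pmf \<nu>"
    \<comment> \<open>The atom bound \<open>(1 / card A) * (4 / card H)\<close> times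
      \<open>card A / (8 * exp (2 * r))\<close>. The entropy is then at least
      \<open>ln (card H) + 2 * r + ln 2\<close>, while the distance permits only
      \<open>ln (card H) + 2 * r\<close>.\<close>
    define c where "c = 1 / (2 * exp (2 * r) * card H)"
    have D: "?D = map_pmf (\<lambda>w. fst w - snd w) (pair_pmf \<mu> \<nu>)"
      by (simp add: plus_pmf_def neg_def pair_map_pmf2 map_pmf_comp)
    have fin2: "finite (set_pmf (pair_pmf \<mu> \<nu>))" using fin fin\<mu> by simp
    have "pmf ?D z \<le> c" for z
    proof -
      have "pmf ?D z = (\<Sum>w\<in>A \<times> ?S. if fst w - snd w = z then pmf (pair_pmf \<mu> \<nu>) w else 0)"
        unfolding D pmf_map_sum[OF fin2] set_pair_pmf set\<mu> ..
      also have "\<dots> = (\<Sum>a\<in>A. \<Sum>y\<in>?S. if a - y = z then pmf \<mu> a * pmf \<nu> y else 0)"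
        unfolding sum.cartesian_product by (intro sum.cong) (auto simp: pmf_pair)
      also have "\<dots> \<le> (\<Sum>a\<in>A. \<Sum>y\<in>?S. if y = a - z then 1 / card A * (4 / card H) else 0)"
      proof (intro sum_mono)
        fix a y assume "a \<in> A" "y \<in> ?S"
        moreover have "a - y = z \<longleftrightarrow> y = a - z" by (auto simp: algebra_simps)
        moreover have "pmf \<mu> a * pmf \<nu> y \<le> 1 / card A * (4 / card H)"
          using A le[OF \<open>y \<in> ?S\<close>] \<open>a \<in> A\<close> by (intro mult_mono) (auto simp: \<mu>_def)
        ultimately show "(if a - y = z then pmf \<mu> a * pmf \<nu> y else 0) \<le> (if y = a - z then 1 / card A * (4 / card H) else 0)"
          by auto
      qed
      also have "\<dots> = (\<Sum>a\<in>A. if a - z \<in> ?S then 1 / card A * (4 / card H) else 0)"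
        using fin by (intro sum.cong refl) simp
      also have "\<dots> \<le> (\<Sum>a\<in>A. if a - (z + a\<^sub>0) \<in> H then 1 / card A * (4 / card H) else 0)"
      proof (intro sum_mono)
        fix a
        have "a - (z + a\<^sub>0) \<in> H" if "a - z \<in> ?S" using supp[OF that] by (simp add: diff_diff_eq)
        then show "(if a - z \<in> ?S then 1 / card A * (4 / card H) else 0)
            \<le> (if a - (z + a\<^sub>0) \<in> H then 1 / card A * (4 / card H) else 0)" by auto
      qed
      also have "\<dots> = card {a \<in> A. a - (z + a\<^sub>0) \<in> H} * (1 / card A * (4 / card H))"
        using A by (subst sum.inter_filter[symmetric]) auto
      also have "\<dots> \<le> card A / (8 * exp (2 * r)) * (1 / card A * (4 / card H))"
        using small[of "z + a\<^sub>0"] by (intro mult_right_mono) (auto simp: field_simps)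
      also have "\<dots> = c" using cA by (simp add: c_def field_simps)
      finally show ?thesis .
    qed
    then have "- ln c \<le> ent ?D" using cH fin fin\<mu> by (intro ent_ge_of_pmf_le) (auto simp: c_def)
    moreover have "- ln c = ln 2 + 2 * r + ln (card H)" using cH by (simp add: c_def ln_div ln_mult)
    moreover have "ent ?D \<le> (ln (card A) + ent \<nu>) / 2 + r" using r e\<mu> by (simp add: rd_def \<mu>_def[symmetric])
    moreover have "ln (2::real) > 0" by simp
    moreover have "ln (real (card A)) \<le> ent \<nu> + 2 * r" using diff by linarith
    ultimately show False using upper by argo
  qed
qed

lemma final_constant:
  fixes m :: nat and L r :: real
  assumes m: "2 \<le> m" and L: "L \<ge> 0" and r: "r = 2 * (52 * real m ^ 3 * L + 1) + ln 2"
  shows "32 * real m * exp L * exp (4 * r) \<le> (2 * exp L) powr (5202 * real m ^ 3)"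
proof -
  have m3: "1 \<le> real m ^ 3" using m by simp
  have l2: "1 / 2 \<le> ln (2::real)" "ln (2::real) \<le> 1"
    using ln_2_less_1 ln_ge_iff[of 2 "1 / 2", THEN iffD2, OF _ exp_half_le2] by linarith+
  have lm: "ln (real m) \<le> real m ^ 3"
  proof -
    have "ln (real m) \<le> real m - 1" using m by (intro ln_le_minus_one) auto
    also have "\<dots> \<le> real m ^ 1" by simp
    also have "\<dots> \<le> real m ^ 3" using m by (intro power_increasing) auto
    finally show ?thesis .
  qed
  have "ln (32::real) = 5 * ln 2" using ln_realpow[of 2 5] by simp
  then have l32: "ln (32::real) \<le> 5" using l2 by linarith
  have "32 * real m * exp L * exp (4 * r) = exp (ln 32 + ln (real m) + L + 4 * r)"
    using m by (simp add: exp_add)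
  also have "\<dots> \<le> exp (5202 * real m ^ 3 * (ln 2 + L))"
  proof (subst exp_le_cancel_iff)
    have "L \<le> real m ^ 3 * L" using mult_right_mono[OF m3 L] by simp
    moreover have "real m ^ 3 * (1 / 2) \<le> real m ^ 3 * ln 2" using l2 by (intro mult_left_mono) auto
    moreover have "0 \<le> real m ^ 3 * L" using L by simp
    moreover have "4 * r = 416 * (real m ^ 3 * L) + 8 + 4 * ln 2" by (simp add: r)
    moreover have "5202 * real m ^ 3 * (ln 2 + L) = 5202 * (real m ^ 3 * ln 2) + 5202 * (real m ^ 3 * L)"
      by (simp add: algebra_simps)
    ultimately show "ln 32 + ln (real m) + L + 4 * r \<le> 5202 * real m ^ 3 * (ln 2 + L)"
      using m3 l2 lm l32 by linarith
  qed
  also have "\<dots> = (2 * exp L) powr (5202 * real m ^ 3)"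
    by (simp add: powr_def ln_mult)
  finally show ?thesis .
qed

lemma smul_minus: "smul n (- x) = - smul n x"
  by (simp add: smul_def sum_negf)

text \<open>Torsion is asked of the elements of \<open>A\<close> alone, because the additive group
  to which this is applied is a product over all abelian groups. Cosets of \<open>H\<close> are
  counted as the product of two coverings: of \<open>A\<close> by cosets of
  \<open>H\<^sub>0\<close>, and of \<open>H\<^sub>0\<close> by cosets of \<open>H\<close>.\<close>

theorem marton_additive:
  fixes A :: "'g::ab_group_add set" and K :: real
  assumes m: "2 \<le> m" and A: "finite A" "A \<noteq> {}" and tor: "\<And>x. x \<in> A \<Longrightarrow> smul m x = 0"
    and K: "real (card {x + y | x y. x \<in> A \<and> y \<in> A}) \<le> K * card A"
  obtains n H where "1 \<le> n" "real n \<le> (2 + real m * ln K) powr (5202 * real m ^ 3 * ln (real m))"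
    "is_subgroup H" "finite H" "card H \<le> card A"
    "H \<subseteq> {x - y | x y. x \<in> sumset_pow n A \<and> y \<in> sumset_pow n A}"
    "real (card ((\<lambda>a. (\<lambda>h. a + h) ` H) ` A)) \<le> (2 * K) powr (5202 * real m ^ 3)"
proof -
  obtain n \<nu> where n: "1 \<le> n" "real n \<le> (2 + real m * ln K) powr (5202 * real m ^ 3 * ln (real m))"
    and \<nu>: "set_pmf \<nu> \<subseteq> sumset_pow n A" "rd \<nu> \<nu> \<le> 1 / 16384" "rd (pmf_of_set A) \<nu> \<le> 52 * real m ^ 3 * ln K + 1"
    by (rule entropic_approximation[OF m A tor K])
  have cA: "card A > 0" using A by (simp add: card_gt_0_iff)
  have K0: "K > 0" by (rule ent_pmf_of_set_add(2)[OF A K])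
  have L: "ln K \<ge> 0"
  proof -
    have "1 * real (card A) \<le> K * card A" using card_le_sumset[OF A] K by linarith
    then have "1 \<le> K" using cA by (simp add: mult_le_cancel_right)
    then show ?thesis by simp
  qed
  have fin\<nu>: "finite (set_pmf \<nu>)" using \<nu>(1) finite_sumset_pow[OF A(1)] finite_subset by blast
  define r where "r = 2 * (52 * real m ^ 3 * ln K + 1) + ln 2"
  obtain H\<^sub>0 a\<^sub>0 where H\<^sub>0: "is_subgroup H\<^sub>0" "finite H\<^sub>0" "H\<^sub>0 \<subseteq> {x - y | x y. x \<in> set_pmf \<nu> \<and> y \<in> set_pmf \<nu>}"
    and a\<^sub>0: "1 / 2 \<le> prob \<nu> {x. x - a\<^sub>0 \<in> H\<^sub>0 \<and> pmf \<nu> x \<le> 2 / card H\<^sub>0}"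
    by (rule small_doubling_subgroup[OF fin\<nu> \<nu>(2)])
  define E where "E = {x. x - a\<^sub>0 \<in> H\<^sub>0 \<and> pmf \<nu> x \<le> 2 / card H\<^sub>0}"
  define \<nu>' where "\<nu>' = cond_pmf \<nu> E"
  have E: "1 / 2 \<le> prob \<nu> E" using a\<^sub>0 by (simp add: E_def)
  then have E': "set_pmf \<nu> \<inter> E \<noteq> {}" using measure_pmf_zero_iff[of \<nu> E] by auto
  have set\<nu>': "set_pmf \<nu>' = set_pmf \<nu> \<inter> E" unfolding \<nu>'_def by (rule set_cond_pmf[OF E'])
  have finA: "finite (set_pmf (pmf_of_set A))" using A by simp
  have r: "rd (pmf_of_set A) \<nu>' \<le> r"
    unfolding \<nu>'_def r_def by (rule order.trans[OF rd_cond_le[OF finA fin\<nu> E]]) (use \<nu>(3) in simp)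
  have H\<^sub>0ne: "H\<^sub>0 \<noteq> {}" using H\<^sub>0(1) by (auto simp: is_subgroup_def)
  \<comment> \<open>Conditioning on an event of probability at least 1/2 at most doubles the
    masses.\<close>
  have le: "pmf \<nu>' x \<le> 4 / card H\<^sub>0" if "x \<in> set_pmf \<nu>'" for x
  proof -
    have x: "x \<in> E" using that set\<nu>' by auto
    then have "pmf \<nu>' x = pmf \<nu> x / prob \<nu> E" unfolding \<nu>'_def by (simp add: pmf_cond[OF E'])
    also have "\<dots> \<le> (2 / card H\<^sub>0) / (1 / 2)" using x E by (intro frac_le) (auto simp: E_def)
    finally show ?thesis by simp
  qed
  have big: "\<exists>x. card A \<le> 8 * exp (2 * r) * card {a \<in> A. a - x \<in> H\<^sub>0}" and cH\<^sub>0: "card H\<^sub>0 \<le> 4 * exp (2 * r) * card A"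
  proof -
    have fin': "finite (set_pmf \<nu>')" using fin\<nu> by (simp add: set\<nu>')
    have "x - a\<^sub>0 \<in> H\<^sub>0" if "x \<in> set_pmf \<nu>'" for x using that by (simp add: set\<nu>' E_def)
    note large_coset_intersection[OF A H\<^sub>0(2) H\<^sub>0ne fin' this le r]
    then show "\<exists>x. card A \<le> 8 * exp (2 * r) * card {a \<in> A. a - x \<in> H\<^sub>0}" "card H\<^sub>0 \<le> 4 * exp (2 * r) * card A"
      by blast+
  qed
  obtain x where x: "card A \<le> 8 * exp (2 * r) * card {a \<in> A. a - x \<in> H\<^sub>0}" using big by blast
  define A' where "A' = {a \<in> A. a - x \<in> H\<^sub>0}"
  have "card A' > 0" using x cA unfolding A'_def[symmetric] by (intro Nat.gr0I) auto
  then have A': "finite A'" "A' \<noteq> {}" "card A' > 0" by (auto simp: card_gt_0_iff)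
  \<comment> \<open>Covering by the large piece \<open>A'\<close>, which lies in one coset of
    \<open>H\<^sub>0\<close>, so that \<open>A' - A'\<close> lies in \<open>H\<^sub>0\<close>; the
    sumset \<open>A + A'\<close> is part of \<open>A + A\<close>.\<close>
  obtain T where T: "T \<subseteq> A" "card T * card A' \<le> card {a + b | a b. a \<in> A \<and> b \<in> A'}"
    "\<And>a. a \<in> A \<Longrightarrow> \<exists>t\<in>T. \<exists>b\<in>A'. \<exists>b'\<in>A'. a = t + (b - b')"
    using ruzsa_covering[OF A(1) A'(1,2)] by blast
  have H\<^sub>0_minus: "a - b \<in> H\<^sub>0" if "a \<in> H\<^sub>0" "b \<in> H\<^sub>0" for a b
    using that H\<^sub>0(1) unfolding is_subgroup_def by (metis diff_conv_add_uminus)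
  have T': "\<exists>t\<in>T. a - t \<in> H\<^sub>0" if a: "a \<in> A" for a
  proof -
    obtain t b b' where "t \<in> T" "b \<in> A'" "b' \<in> A'" "a = t + (b - b')" using T(3)[OF a] by blast
    moreover from this have "(b - x) - (b' - x) \<in> H\<^sub>0" by (auto simp only: A'_def mem_Collect_eq intro: H\<^sub>0_minus)
    ultimately show ?thesis by (intro bexI[of _ t]) auto
  qed
  have cT: "real (card T) \<le> 8 * exp (2 * r) * K"
  proof -
    have "{x + y | x y. x \<in> A \<and> y \<in> A} = (\<lambda>z. fst z + snd z) ` (A \<times> A)" by force
    then have "finite {x + y | x y. x \<in> A \<and> y \<in> A}" using A by simp
    then have "card {a + b | a b. a \<in> A \<and> b \<in> A'} \<le> card {x + y | x y. x \<in> A \<and> y \<in> A}"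
      by (rule card_mono) (auto simp: A'_def)
    then have "real (card T * card A') \<le> K * card A" using T(2) K by linarith
    also have "\<dots> \<le> K * (8 * exp (2 * r) * card A')"
      using x K0 unfolding A'_def[symmetric] by (intro mult_left_mono) auto
    finally have "real (card T) * card A' \<le> (8 * exp (2 * r) * K) * card A'" by (simp add: mult_ac)
    then show ?thesis using A'(3) by (simp add: mult_le_cancel_right)
  qed
  have tor\<^sub>0: "smul m h = 0" if h: "h \<in> H\<^sub>0" for h
  proof -
    obtain x y where xy: "h = x - y" "x \<in> sumset_pow n A" "y \<in> sumset_pow n A" using H\<^sub>0(3) \<nu>(1) h by blast
    have "smul m (x + - y) = smul m x + - smul m y" by (simp only: smul_add smul_minus)
    then show ?thesis using xy sumset_pow_torsion[OF tor] by simp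
  qed
  have m0: "m > 0" and cA1: "1 \<le> card A" using m cA by auto
  obtain H where H: "is_subgroup H" "H \<subseteq> H\<^sub>0" "card H \<le> card A" "H = H\<^sub>0 \<or> card A \<le> m * card H"
    by (rule subgroup_of_bounded_size[OF H\<^sub>0(1,2) m0 tor\<^sub>0 cA1])
  have finH: "finite H" using H(2) H\<^sub>0(2) finite_subset by blast
  have Hne: "H \<noteq> {}" using H(1) by (auto simp: is_subgroup_def)
  have cH: "card H > 0" using finH Hne by (simp add: card_gt_0_iff)
  obtain S where S: "S \<subseteq> H\<^sub>0" "card S * card H \<le> card {a + b | a b. a \<in> H\<^sub>0 \<and> b \<in> H}"
    "\<And>a. a \<in> H\<^sub>0 \<Longrightarrow> \<exists>t\<in>S. \<exists>b\<in>H. \<exists>b'\<in>H. a = t + (b - b')"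
    using ruzsa_covering[OF H\<^sub>0(2) finH Hne] by blast
  have H_minus: "a - b \<in> H" if "a \<in> H" "b \<in> H" for a b
    using that H(1) unfolding is_subgroup_def by (metis diff_conv_add_uminus)
  have S': "\<exists>s\<in>S. a - s \<in> H" if a: "a \<in> H\<^sub>0" for a
  proof -
    obtain s b b' where "s \<in> S" "b \<in> H" "b' \<in> H" "a = s + (b - b')" using S(3)[OF a] by blast
    then show ?thesis using H_minus[of b b'] by (intro bexI[of _ s]) auto
  qed
  \<comment> \<open>Either \<open>H\<close> is all of \<open>H\<^sub>0\<close>, or its index is
    controlled by \<open>card H\<^sub>0 \<le> 4 * exp (2 * r) * card A\<close> together with
    \<open>card A \<le> m * card H\<close>.\<close>
  have cS: "real (card S) \<le> 4 * exp (2 * r) * real m"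
  proof -
    have "card {a + b | a b. a \<in> H\<^sub>0 \<and> b \<in> H} \<le> card H\<^sub>0"
      using H\<^sub>0(1,2) H(2) by (intro card_mono) (auto simp: is_subgroup_def)
    then have c: "card S * card H \<le> card H\<^sub>0" using S(2) by linarith
    show ?thesis
    proof (cases "H = H\<^sub>0")
      case True
      then have "card S \<le> 1" using c cH by simp
      then have "real (card S) \<le> 1" by simp
      also have "\<dots> \<le> 4 * exp (2 * r) * real m"
      proof -
        have "0 \<le> r" unfolding r_def using L by (intro add_nonneg_nonneg mult_nonneg_nonneg) auto
        then have "1 \<le> exp (2 * r)" by simp
        then have "1 * 1 \<le> exp (2 * r) * real m" using m by (intro mult_mono) auto
        then show ?thesis by simp
      qed
      finally show ?thesis .
    next
      case False
      then have mH: "real (card A) \<le> real m * card H" using H(4) by (metis of_nat_le_iff of_nat_mult)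
      have "real (card S) * card H \<le> card H\<^sub>0" using c by (metis of_nat_le_iff of_nat_mult)
      also have "\<dots> \<le> 4 * exp (2 * r) * (real m * card H)"
        by (rule order.trans[OF cH\<^sub>0], rule mult_left_mono[OF mH]) simp
      finally show ?thesis using cH by (simp add: mult.assoc[symmetric] mult_le_cancel_right)
    qed
  qed
  have cosets: "(\<lambda>a. (\<lambda>h. a + h) ` H) ` A \<subseteq> (\<lambda>z. (\<lambda>h. (fst z + snd z) + h) ` H) ` (T \<times> S)"
  proof
    fix C assume "C \<in> (\<lambda>a. (\<lambda>h. a + h) ` H) ` A"
    then obtain a where a: "a \<in> A" "C = (\<lambda>h. a + h) ` H" by auto
    obtain t where t: "t \<in> T" "a - t \<in> H\<^sub>0" using T'[OF a(1)] by blast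
    obtain s where s: "s \<in> S" "a - t - s \<in> H" using S'[OF t(2)] by blast
    have "(\<lambda>h. a + h) ` H = (\<lambda>h. (t + s) + h) ` H"
    proof (intro equalityI subsetI)
      fix y assume "y \<in> (\<lambda>h. a + h) ` H"
      then obtain h where h: "h \<in> H" "y = a + h" by auto
      have "(a - t - s) + h \<in> H" using H(1) s h by (auto simp: is_subgroup_def)
      then show "y \<in> (\<lambda>h. (t + s) + h) ` H" using h by (intro image_eqI[of _ _ "(a - t - s) + h"]) auto
    next
      fix y assume "y \<in> (\<lambda>h. (t + s) + h) ` H"
      then obtain h where h: "h \<in> H" "y = (t + s) + h" by auto
      have "h - (a - t - s) \<in> H" using H_minus h s by auto
      then show "y \<in> (\<lambda>h. a + h) ` H" using h by (intro image_eqI[of _ _ "h - (a - t - s)"]) (auto simp: algebra_simps)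
    qed
    then show "C \<in> (\<lambda>z. (\<lambda>h. (fst z + snd z) + h) ` H) ` (T \<times> S)"
      using a t s by (intro image_eqI[of _ _ "(t, s)"]) auto
  qed
  have finTS: "finite (T \<times> S)" using T(1) S(1) A(1) H\<^sub>0(2) finite_subset by blast
  have "card ((\<lambda>a. (\<lambda>h. a + h) ` H) ` A) \<le> card ((\<lambda>z. (\<lambda>h. (fst z + snd z) + h) ` H) ` (T \<times> S))"
    using finTS by (intro card_mono cosets) auto
  also have "\<dots> \<le> card (T \<times> S)" using finTS by (rule card_image_le)
  finally have "real (card ((\<lambda>a. (\<lambda>h. a + h) ` H) ` A)) \<le> real (card T) * real (card S)"
    by (simp add: card_cartesian_product flip: of_nat_mult)
  also have "\<dots> \<le> (8 * exp (2 * r) * K) * (4 * exp (2 * r) * real m)"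
    using cT cS K0 by (intro mult_mono) auto
  also have "\<dots> = 32 * real m * exp (ln K) * exp (4 * r)"
    using K0 exp_add[of "2 * r" "2 * r"] by simp
  also have "\<dots> \<le> (2 * exp (ln K)) powr (5202 * real m ^ 3)"
    by (rule final_constant[OF m L r_def])
  finally have bound: "real (card ((\<lambda>a. (\<lambda>h. a + h) ` H) ` A)) \<le> (2 * K) powr (5202 * real m ^ 3)"
    using K0 by simp
  show ?thesis
  proof (rule that[OF n H(1) finH H(3) _ bound])
    show "H \<subseteq> {x - y | x y. x \<in> sumset_pow n A \<and> y \<in> sumset_pow n A}"
      using H(2) H\<^sub>0(3) \<nu>(1) by blast
  qed
qed

section \<open>Transfer to groups with a carrier\<close>

text \<open>The product of all abelian groups with carrier in \<open>'a\<close>: a type of class \<open>ab_group_add\<close> that contains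
  a copy of each of them.\<close>

typedef 'a group_product = "{f :: 'a monoid \<Rightarrow> 'a. \<forall>M. if comm_group M then f M \<in> carrier M else f M = undefined}"
  by (rule exI[of _ "\<lambda>M. if comm_group M then \<one>\<^bsub>M\<^esub> else undefined"])
    (auto intro: monoid.one_closed comm_group.axioms group.is_monoid dest: comm_group.axioms(2))

setup_lifting type_definition_group_product

lemma comm_group_imp_group: "comm_group M \<Longrightarrow> group M"
  by (rule comm_group.axioms(2))

instantiation group_product :: (type) ab_group_add
begin

lift_definition zero_group_product :: "'a group_product" is "\<lambda>M. if comm_group M then \<one>\<^bsub>M\<^esub> else undefined"
  by (auto intro: monoid.one_closed group.is_monoid comm_group_imp_group)

lift_definition plus_group_product :: "'a group_product \<Rightarrow> 'a group_product \<Rightarrow> 'a group_product"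
  is "\<lambda>f g M. if comm_group M then f M \<otimes>\<^bsub>M\<^esub> g M else undefined"
  by (auto intro!: monoid.m_closed group.is_monoid comm_group_imp_group split: if_splits)

lift_definition uminus_group_product :: "'a group_product \<Rightarrow> 'a group_product"
  is "\<lambda>f M. if comm_group M then inv\<^bsub>M\<^esub> f M else undefined"
  by (auto intro!: group.inv_closed comm_group_imp_group split: if_splits)

definition minus_group_product :: "'a group_product \<Rightarrow> 'a group_product \<Rightarrow> 'a group_product" where
  "minus_group_product f g = f + - g"

instance
proof
  fix a b c :: "'a group_product"
  show "a + b + c = a + (b + c)"
    by transfer (auto simp: fun_eq_iff intro!: monoid.m_assoc group.is_monoid comm_group_imp_group split: if_splits)
  show "a + b = b + a"
    by transfer (auto simp: fun_eq_iff intro!: comm_monoid.m_comm comm_group.axioms(1) split: if_splits)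
  show "0 + a = a"
    by transfer (auto simp: fun_eq_iff intro!: monoid.l_one group.is_monoid comm_group_imp_group split: if_splits)
  show "- a + a = 0"
    by transfer (auto simp: fun_eq_iff intro!: group.l_inv comm_group_imp_group split: if_splits)
  show "a - b = a + - b" by (rule minus_group_product_def)
qed

end

text \<open>The conclusion of \<open>valid_constant\<close> for one group and one set, named so that
  it can be transported along homomorphisms.\<close>

definition structured :: "('a, 'b) monoid_scheme \<Rightarrow> nat \<Rightarrow> 'a set \<Rightarrow> real \<Rightarrow> real \<Rightarrow> bool" where
  "structured G m A K C \<longleftrightarrow>
    (\<exists>H. subgroup H G \<and> finite H \<and> card H \<le> card A \<and>
       covered_by_cosets G H A ((2 * K) powr (C * real m ^ 3)) \<and>
       (\<exists>l::nat. 0 < l \<and> real l \<le> C * (2 + real m * ln K) powr (C * real m ^ 3 * ln (real m)) \<and>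
          H \<subseteq> set_diff_mult G (iter_sumset G l A) (iter_sumset G l A)))"

lemma set_mult_memI: "x \<in> X \<Longrightarrow> y \<in> Y \<Longrightarrow> x \<otimes>\<^bsub>G\<^esub> y \<in> X <#>\<^bsub>G\<^esub> Y"
  unfolding set_mult_def by blast

lemma set_mult_memE:
  assumes "z \<in> X <#>\<^bsub>G\<^esub> Y"
  obtains x y where "x \<in> X" "y \<in> Y" "z = x \<otimes>\<^bsub>G\<^esub> y"
  using assms unfolding set_mult_def by blast

lemma hom_set_mult:
  assumes h: "h \<in> hom G' G" and X: "X \<subseteq> carrier G'" "Y \<subseteq> carrier G'"
  shows "h ` (X <#>\<^bsub>G'\<^esub> Y) = h ` X <#>\<^bsub>G\<^esub> h ` Y"
proof (intro equalityI subsetI)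
  fix z assume "z \<in> h ` (X <#>\<^bsub>G'\<^esub> Y)"
  then obtain x y where xy: "x \<in> X" "y \<in> Y" "z = h (x \<otimes>\<^bsub>G'\<^esub> y)" by (auto elim!: set_mult_memE)
  have "h (x \<otimes>\<^bsub>G'\<^esub> y) = h x \<otimes>\<^bsub>G\<^esub> h y" using hom_mult[OF h] X xy by blast
  then show "z \<in> h ` X <#>\<^bsub>G\<^esub> h ` Y" using xy by (auto intro: set_mult_memI)
next
  fix z assume "z \<in> h ` X <#>\<^bsub>G\<^esub> h ` Y"
  then obtain x y where xy: "x \<in> X" "y \<in> Y" "z = h x \<otimes>\<^bsub>G\<^esub> h y" by (auto elim!: set_mult_memE)
  have "h (x \<otimes>\<^bsub>G'\<^esub> y) = h x \<otimes>\<^bsub>G\<^esub> h y" using hom_mult[OF h] X xy by blast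
  then have "z = h (x \<otimes>\<^bsub>G'\<^esub> y)" using xy by simp
  then show "z \<in> h ` (X <#>\<^bsub>G'\<^esub> Y)" using xy by (auto intro: set_mult_memI)
qed

lemma finite_set_mult: "finite X \<Longrightarrow> finite Y \<Longrightarrow> finite (X <#>\<^bsub>G\<^esub> Y)"
  by (simp add: set_mult_def)

context
  fixes G :: "'a monoid"
  assumes G: "comm_group G"
begin

interpretation comm_group G by (rule G)

text \<open>The embedding into coordinate \<open>G\<close>. Elements outside the carrier go to the
  identity, which keeps the map total.\<close>

lift_definition emb :: "'a \<Rightarrow> 'a group_product" is
  "\<lambda>x M. if comm_group M then (if M = G \<and> x \<in> carrier G then x else \<one>\<^bsub>M\<^esub>) else undefined"
  by (auto intro: monoid.one_closed group.is_monoid comm_group_imp_group)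

lift_definition proj :: "'a group_product \<Rightarrow> 'a" is "\<lambda>f. f G" .

lemma proj_closed: "proj f \<in> carrier G"
  using G by transfer (auto split: if_splits)

lemma proj_add: "proj (f + g) = proj f \<otimes>\<^bsub>G\<^esub> proj g"
  using G by transfer auto

lemma proj_zero: "proj 0 = \<one>\<^bsub>G\<^esub>"
  using G by transfer auto

lemma proj_minus: "proj (- f) = inv\<^bsub>G\<^esub> proj f"
  using G by transfer auto

lemma proj_emb: "x \<in> carrier G \<Longrightarrow> proj (emb x) = x"
  using G by transfer auto

lemma emb_one: "emb \<one>\<^bsub>G\<^esub> = 0"
  by transfer (auto simp: fun_eq_iff)

lemma emb_mult: "x \<in> carrier G \<Longrightarrow> y \<in> carrier G \<Longrightarrow> emb (x \<otimes>\<^bsub>G\<^esub> y) = emb x + emb y"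
  by transfer (auto simp: fun_eq_iff intro!: monoid.l_one[symmetric] monoid.one_closed group.is_monoid comm_group_imp_group)

lemma emb_pow: "x \<in> carrier G \<Longrightarrow> emb (x [^]\<^bsub>G\<^esub> (n::nat)) = smul n (emb x)"
  by (induction n) (simp_all add: emb_one emb_mult smul_Suc)

lemma subgroup_proj:
  assumes "is_subgroup H"
  shows "subgroup (proj ` H) G"
proof (rule subgroupI)
  show "proj ` H \<noteq> {}" using assms by (auto simp: is_subgroup_def)
  show "inv\<^bsub>G\<^esub> a \<in> proj ` H" if "a \<in> proj ` H" for a
    using that assms by (auto simp: is_subgroup_def simp flip: proj_minus)
  show "a \<otimes>\<^bsub>G\<^esub> b \<in> proj ` H" if "a \<in> proj ` H" "b \<in> proj ` H" for a b
    using that assms by (auto simp: is_subgroup_def simp flip: proj_add)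
qed (auto simp: proj_closed)

lemma proj_sum_mem: "(\<And>i. i < n \<Longrightarrow> f i \<in> emb ` A) \<Longrightarrow> A \<subseteq> carrier G \<Longrightarrow> proj (\<Sum>i<n. f i) \<in> iter_sumset G n A"
proof (induction n)
  case 0
  then show ?case by (simp add: proj_zero)
next
  case (Suc n)
  have "f n \<in> emb ` A" using Suc.prems by auto
  then have "proj (f n) \<in> A" using Suc.prems(2) by (auto simp: proj_emb subset_eq)
  moreover have "proj (\<Sum>i<n. f i) \<in> iter_sumset G n A" using Suc by auto
  ultimately show ?case by (auto simp: proj_add set_mult_def)
qed

text \<open>The additive theorem is applied to the image of \<open>A\<close> in the product, and the
  subgroup found there is pushed down by \<open>proj\<close>, a homomorphism on the whole product.
  Projection can only decrease sizes and numbers of cosets.\<close>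

lemma structured_comm_group:
  assumes m: "2 \<le> m" and tor: "has_torsion G m" and A: "A \<subseteq> carrier G" "finite A" "A \<noteq> {}"
    and K: "real (card (A <#>\<^bsub>G\<^esub> A)) \<le> K * real (card A)"
  shows "structured G m A K 5202"
proof -
  define B where "B = emb ` A"
  have projB: "proj ` B = A"
    unfolding B_def image_image using A(1) by (auto simp: proj_emb subset_eq)
  have B: "finite B" "B \<noteq> {}" using A by (auto simp: B_def)
  have cB: "card B = card A"
    using card_image_le[OF A(2), of emb] card_image_le[OF B(1), of proj] unfolding projB by (simp add: B_def)
  have "{x + y | x y. x \<in> B \<and> y \<in> B} \<subseteq> emb ` (A <#>\<^bsub>G\<^esub> A)"
    using A(1) by (auto simp: B_def emb_mult[symmetric] subset_eq intro!: imageI set_mult_memI)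
  moreover have fin: "finite (A <#>\<^bsub>G\<^esub> A)" using A by (simp add: finite_set_mult)
  ultimately have "card {x + y | x y. x \<in> B \<and> y \<in> B} \<le> card (emb ` (A <#>\<^bsub>G\<^esub> A))"
    by (intro card_mono) auto
  also have "\<dots> \<le> card (A <#>\<^bsub>G\<^esub> A)" by (rule card_image_le[OF fin])
  finally have K': "real (card {x + y | x y. x \<in> B \<and> y \<in> B}) \<le> K * card B"
    using K unfolding cB by linarith
  have torB: "smul m x = 0" if "x \<in> B" for x
    using that A(1) tor by (auto simp: B_def has_torsion_def subset_eq emb_one simp flip: emb_pow)
  obtain n H where n: "1 \<le> n" "real n \<le> (2 + real m * ln K) powr (5202 * real m ^ 3 * ln (real m))"
    and H: "is_subgroup H" "finite H" "card H \<le> card B"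
      "H \<subseteq> {x - y | x y. x \<in> sumset_pow n B \<and> y \<in> sumset_pow n B}"
      "real (card ((\<lambda>a. (\<lambda>h. a + h) ` H) ` B)) \<le> (2 * K) powr (5202 * real m ^ 3)"
    by (rule marton_additive[OF m B torB K'])
  let ?H = "proj ` H"
  have sub: "subgroup ?H G" by (rule subgroup_proj[OF H(1)])
  have "card ?H \<le> card A" using card_image_le[OF H(2), of proj] H(3) cB by simp
  moreover have "covered_by_cosets G ?H A ((2 * K) powr (5202 * real m ^ 3))"
    unfolding covered_by_cosets_def
  proof (intro exI conjI)
    let ?F = "(\<lambda>a. ?H #>\<^bsub>G\<^esub> a) ` A"
    show "?F \<subseteq> rcosets\<^bsub>G\<^esub> ?H" using A(1) by (auto simp: RCOSETS_def)
    show "finite ?F" using A by simp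
    \<comment> \<open>The translates \<open>b + H\<close> become right cosets by
      commutativity.\<close>
    have img: "proj ` ((\<lambda>h. b + h) ` H) = ?H #>\<^bsub>G\<^esub> proj b" for b
      by (auto simp: r_coset_def image_image proj_add[symmetric] add.commute[of b])
    have "?F = (\<lambda>C. proj ` C) ` ((\<lambda>a. (\<lambda>h. a + h) ` H) ` B)"
      unfolding image_image[of "\<lambda>C. proj ` C"] img by (subst projB[symmetric]) (simp add: image_image)
    then have "card ?F \<le> card ((\<lambda>a. (\<lambda>h. a + h) ` H) ` B)" using B by (simp add: card_image_le)
    then show "real (card ?F) \<le> (2 * K) powr (5202 * real m ^ 3)" using H(5) by linarith
    show "A \<subseteq> \<Union>?F" using rcos_self[OF _ sub] A(1) by blast
  qed
  moreover have "?H \<subseteq> set_diff_mult G (iter_sumset G n A) (iter_sumset G n A)"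
  proof
    fix x assume "x \<in> ?H"
    then obtain y z where yz: "x = proj (y - z)" "y \<in> sumset_pow n B" "z \<in> sumset_pow n B" using H(4) by blast
    have mem: "proj u \<in> iter_sumset G n A" if u: "u \<in> sumset_pow n B" for u
    proof -
      obtain f where "u = (\<Sum>i<n. f i)" "\<forall>i<n. f i \<in> B" using u by (auto simp: sumset_pow_def)
      then show ?thesis using A(1) unfolding B_def by (auto intro!: proj_sum_mem)
    qed
    have "x = proj y \<otimes>\<^bsub>G\<^esub> inv\<^bsub>G\<^esub> proj z"
      unfolding yz(1) diff_conv_add_uminus proj_add proj_minus ..
    then show "x \<in> set_diff_mult G (iter_sumset G n A) (iter_sumset G n A)"
      using mem[OF yz(2)] mem[OF yz(3)] by (auto simp: set_diff_mult_def set_mult_def SET_INV_def)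
  qed
  moreover have "real n \<le> 5202 * (2 + real m * ln K) powr (5202 * real m ^ 3 * ln (real m))"
    using n(2) powr_ge_zero[of "2 + real m * ln K" "5202 * real m ^ 3 * ln (real m)"] by linarith
  ultimately show ?thesis
    unfolding structured_def using sub H(2) n(1) by (intro exI[of _ ?H] conjI exI[of _ n]) auto
qed

text \<open>The elements of \<open>A\<close> are adjoined one at a time in the product group;
  torsion keeps the subgroup finite at each stage.\<close>

lemma finite_subgroup_containing:
  assumes m: "2 \<le> m" and tor: "has_torsion G m" and A: "A \<subseteq> carrier G" "finite A"
  obtains S where "subgroup S G" "finite S" "A \<subseteq> S"
proof -
  have "\<exists>S. is_subgroup S \<and> finite S \<and> emb ` A \<subseteq> S"
    using A(2,1)
  proof (induction A rule: finite_induct)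
    case empty
    show ?case by (rule exI[of _ "{0}"]) (auto simp: is_subgroup_def)
  next
    case (insert x A)
    then obtain S where S: "is_subgroup S" "finite S" "emb ` A \<subseteq> S" by auto
    have "smul m (emb x) = 0" using insert.prems tor by (auto simp: has_torsion_def emb_one simp flip: emb_pow)
    note adj = subgroup_adjoin[OF S(1) _ this]
    show ?case
      by (rule exI[of _ "(\<lambda>z. smul (fst z) (emb x) + snd z) ` ({..<m} \<times> S)"]) (use adj S m in auto)
  qed
  then obtain S where S: "is_subgroup S" "finite S" "emb ` A \<subseteq> S" by blast
  have "A \<subseteq> proj ` S"
  proof
    fix x assume x: "x \<in> A"
    then have "emb x \<in> S" using S(3) by auto
    then show "x \<in> proj ` S" using x A(1) by (intro image_eqI[of _ _ "emb x"]) (auto simp: proj_emb subset_eq)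
  qed
  then show ?thesis using that[OF subgroup_proj[OF S(1)]] S(2) by auto
qed

end

text \<open>Injectivity is needed for the sizes of \<open>H\<close> and \<open>A\<close> to be
  compared after mapping; iterated sumsets and cosets are preserved by any homomorphism.\<close>

lemma structured_hom:
  assumes G: "comm_group G" and G': "comm_group G'" and h: "h \<in> hom G' G" and inj: "inj_on h (carrier G')"
    and A: "A \<subseteq> carrier G'" and str: "structured G' m A K C"
  shows "structured G m (h ` A) K C"
proof -
  interpret G: comm_group G by (rule G)
  interpret G': comm_group G' by (rule G')
  interpret h: group_hom G' G h by unfold_locales (rule h)
  obtain H l where H: "subgroup H G'" "finite H" "card H \<le> card A"
      "covered_by_cosets G' H A ((2 * K) powr (C * real m ^ 3))"
    and l: "0 < l" "real l \<le> C * (2 + real m * ln K) powr (C * real m ^ 3 * ln (real m))"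
      "H \<subseteq> set_diff_mult G' (iter_sumset G' l A) (iter_sumset G' l A)"
    using str unfolding structured_def by blast
  have HG: "H \<subseteq> carrier G'" by (rule subgroup.subset[OF H(1)])
  note mult = hom_set_mult[OF h]
  have iter_sub: "iter_sumset G' n A \<subseteq> carrier G'" for n
    by (induction n) (use A in \<open>auto simp: G'.set_mult_closed\<close>)
  have iter: "h ` iter_sumset G' n A = iter_sumset G n (h ` A)" for n
    by (induction n) (simp_all add: mult iter_sub A)
  have inv: "h ` (set_inv\<^bsub>G'\<^esub> X) = set_inv\<^bsub>G\<^esub> (h ` X)" if X: "X \<subseteq> carrier G'" for X
    using X by (auto simp: SET_INV_def image_iff subset_eq)
  have inv_sub: "set_inv\<^bsub>G'\<^esub> X \<subseteq> carrier G'" if "X \<subseteq> carrier G'" for X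
    using that by (auto simp: SET_INV_def)
  have "subgroup (h ` H) G" by (rule h.subgroup_img_is_subgroup[OF H(1)])
  moreover have "card (h ` H) \<le> card (h ` A)"
    using H(3) HG A inj by (simp add: card_image inj_on_subset)
  moreover have "covered_by_cosets G (h ` H) (h ` A) ((2 * K) powr (C * real m ^ 3))"
  proof -
    obtain F where F: "F \<subseteq> rcosets\<^bsub>G'\<^esub> H" "finite F" "real (card F) \<le> (2 * K) powr (C * real m ^ 3)" "A \<subseteq> \<Union>F"
      using H(4) unfolding covered_by_cosets_def by blast
    have coset: "h ` (H #>\<^bsub>G'\<^esub> x) = h ` H #>\<^bsub>G\<^esub> h x" if "x \<in> carrier G'" for x
      using mult[OF HG, of "{x}"] that by (simp add: r_coset_eq_set_mult)
    show ?thesis unfolding covered_by_cosets_def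
    proof (intro exI conjI)
      show "(`) h ` F \<subseteq> rcosets\<^bsub>G\<^esub> (h ` H)"
      proof
        fix Y assume "Y \<in> (`) h ` F"
        then obtain x where "x \<in> carrier G'" "Y = h ` (H #>\<^bsub>G'\<^esub> x)" using F(1) by (auto simp: RCOSETS_def)
        then show "Y \<in> rcosets\<^bsub>G\<^esub> (h ` H)" unfolding coset[OF \<open>x \<in> carrier G'\<close>] RCOSETS_def by auto
      qed
      show "finite ((`) h ` F)" using F(2) by simp
      show "real (card ((`) h ` F)) \<le> (2 * K) powr (C * real m ^ 3)"
        using F(3) card_image_le[OF F(2), of "(`) h"] by linarith
      show "h ` A \<subseteq> \<Union> ((`) h ` F)" using F(4) by blast
    qed
  qed
  moreover have "h ` H \<subseteq> set_diff_mult G (iter_sumset G l (h ` A)) (iter_sumset G l (h ` A))"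
  proof -
    have "h ` H \<subseteq> h ` (set_diff_mult G' (iter_sumset G' l A) (iter_sumset G' l A))" using l(3) by (rule image_mono)
    then show ?thesis by (simp add: set_diff_mult_def mult inv inv_sub iter_sub iter)
  qed
  ultimately show ?thesis
    unfolding structured_def using H(2) l by (intro exI[of _ "h ` H"] conjI exI[of _ l]) auto
qed

text \<open>Transport of structure along a bijection, which realises a finite subgroup on an initial
  segment of the natural numbers.\<close>

lemma subgroup_copy:
  fixes G :: "('a, 'b) monoid_scheme" and h :: "'c \<Rightarrow> 'a"
  assumes G: "comm_group G" and S: "subgroup S G" and h: "bij_betw h B S"
  defines "G' \<equiv> \<lparr>carrier = B, monoid.mult = \<lambda>x y. inv_into B h (h x \<otimes>\<^bsub>G\<^esub> h y), monoid.one = inv_into B h \<one>\<^bsub>G\<^esub>\<rparr>"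
  shows "comm_group G'" "h \<in> hom G' G"
proof -
  interpret G: comm_group G by (rule G)
  interpret S: subgroup S G by (rule S)
  have hS: "h x \<in> S" if "x \<in> B" for x using bij_betwE[OF h] that by auto
  have hG: "h x \<in> carrier G" if "x \<in> B" for x using hS[OF that] by auto
  have inv: "h (inv_into B h s) = s" "inv_into B h s \<in> B" if "s \<in> S" for s
    using h that by (auto simp: bij_betw_def f_inv_into_f inv_into_into)
  have eqI: "x = y" if "x \<in> B" "y \<in> B" "h x = h y" for x y
    using h that by (auto simp: bij_betw_def inj_on_def)
  show "comm_group G'"
  proof (rule comm_groupI)
    fix x y z assume xyz: "x \<in> carrier G'" "y \<in> carrier G'" "z \<in> carrier G'"
    then have B: "x \<in> B" "y \<in> B" "z \<in> B" by (auto simp: G'_def)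
    show "x \<otimes>\<^bsub>G'\<^esub> y \<otimes>\<^bsub>G'\<^esub> z = x \<otimes>\<^bsub>G'\<^esub> (y \<otimes>\<^bsub>G'\<^esub> z)"
      unfolding G'_def using B by (simp add: inv hS hG G.m_assoc)
  next
    fix x y assume "x \<in> carrier G'" "y \<in> carrier G'"
    then have B: "x \<in> B" "y \<in> B" by (auto simp: G'_def)
    show "x \<otimes>\<^bsub>G'\<^esub> y \<in> carrier G'" unfolding G'_def using B by (simp add: inv hS)
    show "x \<otimes>\<^bsub>G'\<^esub> y = y \<otimes>\<^bsub>G'\<^esub> x" unfolding G'_def using B by (simp add: hG G.m_comm)
  next
    show "\<one>\<^bsub>G'\<^esub> \<in> carrier G'" unfolding G'_def by (simp add: inv)
  next
    fix x assume "x \<in> carrier G'"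
    then have B: "x \<in> B" by (auto simp: G'_def)
    show "\<one>\<^bsub>G'\<^esub> \<otimes>\<^bsub>G'\<^esub> x = x" unfolding G'_def using B by (intro eqI) (auto simp: inv hS hG)
    show "\<exists>y\<in>carrier G'. y \<otimes>\<^bsub>G'\<^esub> x = \<one>\<^bsub>G'\<^esub>"
      using B by (intro bexI[of _ "inv_into B h (inv\<^bsub>G\<^esub> h x)"]) (auto simp: G'_def inv hS hG)
  qed
  show "h \<in> hom G' G" by (rule homI) (auto simp: G'_def inv hS hG)
qed

text \<open>The value 5202 only witnesses existence: the choice operator may select another
  constant, about which no more than its validity over \<open>nat\<close> is known.\<close>

lemma valid_constant_nat: "valid_constant TYPE(nat) absolute_constant"
proof -
  have "valid_constant TYPE(nat) 5202"
    unfolding valid_constant_def structured_def[symmetric] by (auto intro: structured_comm_group)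
  then show ?thesis unfolding absolute_constant_def by (rule someI)
qed

text \<open>As \<open>absolute_constant\<close> is known to be valid only over \<open>nat\<close>,
  the instance is moved there: \<open>A\<close> lies in a finite subgroup, a copy of that subgroup
  has carrier in \<open>nat\<close>, and the conclusion is carried back by
  \<open>structured_hom\<close>.\<close>

lemma structured_absolute_constant:
  fixes G :: "'a monoid"
  assumes m: "2 \<le> m" and G: "comm_group G" and tor: "has_torsion G m"
    and A: "A \<subseteq> carrier G" "finite A" "A \<noteq> {}" and K: "real (card (A <#>\<^bsub>G\<^esub> A)) \<le> K * real (card A)"
  shows "structured G m A K absolute_constant"
proof -
  obtain S where S: "subgroup S G" "finite S" "A \<subseteq> S"
    by (rule finite_subgroup_containing[OF G m tor A(1,2)])
  obtain h where h: "bij_betw h {0..<card S} S" using ex_bij_betw_nat_finite[OF S(2)] by blast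
  define B where "B = {0..<card S}"
  define G' :: "nat monoid" where "G' = \<lparr>carrier = B, monoid.mult = \<lambda>x y. inv_into B h (h x \<otimes>\<^bsub>G\<^esub> h y), monoid.one = inv_into B h \<one>\<^bsub>G\<^esub>\<rparr>"
  have h: "bij_betw h B S" using h by (simp add: B_def)
  have G': "comm_group G'" "h \<in> hom G' G"
    unfolding G'_def by (rule subgroup_copy[OF G S(1) h])+
  have carr: "carrier G' = B" by (simp add: G'_def)
  interpret G: comm_group G by (rule G)
  interpret G': comm_group G' by (rule G'(1))
  interpret h: group_hom G' G h by unfold_locales (rule G'(2))
  have inj: "inj_on h (carrier G')" using h by (simp add: carr bij_betw_def)
  define A' where "A' = inv_into B h ` A"
  have hA': "h ` A' = A"
    unfolding A'_def image_image using h S(3) by (auto simp: bij_betw_def f_inv_into_f subset_eq)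
  have A': "A' \<subseteq> carrier G'" "finite A'" "A' \<noteq> {}"
    using h S(3) A by (auto simp: A'_def carr bij_betw_def inv_into_into subset_eq)
  have tor': "has_torsion G' m"
    unfolding has_torsion_def
  proof
    fix x assume x: "x \<in> carrier G'"
    have "h (x [^]\<^bsub>G'\<^esub> m) = h x [^]\<^bsub>G\<^esub> m" by (rule h.hom_nat_pow[OF x])
    also have "\<dots> = h \<one>\<^bsub>G'\<^esub>" using tor x by (simp add: has_torsion_def)
    finally show "x [^]\<^bsub>G'\<^esub> m = \<one>\<^bsub>G'\<^esub>" by (rule inj_onD[OF inj]) (use x in auto)
  qed
  have cA': "card A' = card A" using card_image[OF inj_on_subset[OF inj A'(1)]] by (simp add: hA')
  have "A' <#>\<^bsub>G'\<^esub> A' \<subseteq> carrier G'" by (rule G'.set_mult_closed[OF A'(1) A'(1)])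
  then have "card (A' <#>\<^bsub>G'\<^esub> A') = card (h ` (A' <#>\<^bsub>G'\<^esub> A'))"
    using inj by (simp add: card_image inj_on_subset)
  also have "h ` (A' <#>\<^bsub>G'\<^esub> A') = A <#>\<^bsub>G\<^esub> A"
    using hom_set_mult[OF G'(2) A'(1) A'(1)] by (simp add: hA')
  finally have "real (card (A' <#>\<^bsub>G'\<^esub> A')) \<le> K * real (card A')" using K cA' by simp
  then have "structured G' m A' K absolute_constant"
    using valid_constant_nat m G'(1) tor' A' unfolding valid_constant_def structured_def[symmetric] by blast
  from structured_hom[OF G G'(1) G'(2) inj A'(1) this] show ?thesis by (simp add: hA')
qed

theorem theorem1p1:
  shows "0 < absolute_constant \<and>
     (\<forall>(m::nat) (G :: 'a monoid) (A :: 'a set) (K::real).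
        2 \<le> m \<longrightarrow> comm_group G \<longrightarrow> has_torsion G m \<longrightarrow>
        A \<subseteq> carrier G \<longrightarrow> finite A \<longrightarrow> A \<noteq> {} \<longrightarrow>
        real (card (A <#>\<^bsub>G\<^esub> A)) \<le> K * real (card A) \<longrightarrow>
        (\<exists>H. subgroup H G \<and> finite H \<and> card H \<le> card A \<and>
             covered_by_cosets G H A ((2 * K) powr (absolute_constant * real m ^ 3)) \<and>
             (\<exists>l::nat. 0 < l \<and>
                real l \<le> absolute_constant *
                  (2 + real m * ln K) powr (absolute_constant * real m ^ 3 * ln (real m)) \<and>
                H \<subseteq> set_diff_mult G (iter_sumset G l A) (iter_sumset G l A))))"
  using valid_constant_nat structured_absolute_constant
  unfolding valid_constant_def structured_def by auto

end
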